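(* Let $T>0$ and let $\varphi\in L^2(0,T)$. Let $\widetilde\varphi:\mathbb{R}\to\mathbb{R}$ be the periodic reflection of $\varphi$, defined (almost everywhere) for all $k\in\mathbb{Z}$ by $$\widetilde\varphi(s)=\begin{cases}-\varphi(s+2T-4kT), & s\in((4k-2)T,(4k-1)T),\\ -\varphi(4kT-s), & s\in((4k-1)T,4kT),\\ \varphi(s-4kT), & s\in(4kT,(4k+1)T),\\ \varphi(4kT+2T-s), & s\in((4k+1)T,(4k+2)T).\end{cases}$$ Then $$\mathcal{H}_T\varphi=-\mathcal{H}\widetilde\varphi\quad\text{in }L^2(0,T),$$ i.e. $\mathcal{H}_T\varphi(t)=-\mathcal{H}\widetilde\varphi(t)$ for almost every $t\in(0,T)$, where $\mathcal{H}_T$ is the modified Hilbert transform on $(0,T)$ and $\mathcal{H}$ is the Hilbert transform on $\mathbb{R}$.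
   Context: Modified Hilbert transform: every $\varphi\in L^2(0,T)$ has the Fourier expansion (convergent in $L^2(0,T)$) $\varphi(t)=\sum_{k=0}^\infty\varphi_k\sin\left(\left(\frac{\pi}{2}+k\pi\right)\frac{t}{T}\right)$ with $\varphi_k=\frac{2}{T}\int_0^T\varphi(s)\sin\left(\left(\frac{\pi}{2}+k\pi\right)\frac{s}{T}\right)ds$. The operator $\mathcal{H}_T:L^2(0,T)\to L^2(0,T)$ is defined by $\mathcal{H}_T\varphi(t)=\sum_{k=0}^\infty\varphi_k\cos\left(\left(\frac{\pi}{2}+k\pi\right)\frac{t}{T}\right)$, $t\in(0,T)$ (series in $L^2(0,T)$). Hilbert transform: for a function $f$ on $\mathbb{R}$, $\mathcal{H}f(t)=\frac{1}{\pi}\,\mathrm{p.v.}\int_{\mathbb{R}}\frac{f(s)}{t-s}\,ds$ whenever this Cauchy principal value exists, the principal value being $\lim_{\varepsilon\to0^+,\,R\to\infty}\int_{\varepsilon<|t-s|<R}$. *)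

theory Defs
  imports "HOL-Analysis.Analysis"
begin

text \<open>
  Elements of \<open>L\<^sup>2(0,T)\<close> are handled through representatives: Lebesgue measurable,
  square integrable functions on the open interval. Equality in \<open>L\<^sup>2(0,T)\<close> is equality almost
  everywhere with respect to \<^term>\<open>lebesgue_on {0<..<T}\<close>.
\<close>

definition L2 :: "real \<Rightarrow> (real \<Rightarrow> real) \<Rightarrow> bool" where
  "L2 T f \<longleftrightarrow> f \<in> borel_measurable (lebesgue_on {0<..<T}) \<and>
              integrable (lebesgue_on {0<..<T}) (\<lambda>t. (f t)\<^sup>2)"

text \<open>
  The membership conditions are part of convergence, since the integral of a non-integrable
  function is 0 by convention.
\<close>

definition L2_converges :: "real \<Rightarrow> (nat \<Rightarrow> real \<Rightarrow> real) \<Rightarrow> (real \<Rightarrow> real) \<Rightarrow> bool" where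
  "L2_converges T X f \<longleftrightarrow> (\<forall>n. L2 T (X n)) \<and> L2 T f \<and>
     (\<lambda>n. integral\<^sup>L (lebesgue_on {0<..<T}) (\<lambda>t. (X n t - f t)\<^sup>2)) \<longlonglongrightarrow> 0"

definition sine_coeff :: "real \<Rightarrow> (real \<Rightarrow> real) \<Rightarrow> nat \<Rightarrow> real" where
  "sine_coeff T \<phi> k = 2 / T *
     integral\<^sup>L (lebesgue_on {0<..<T}) (\<lambda>s. \<phi> s * sin ((pi / 2 + real k * pi) * (s / T)))"

text \<open>
  The \<open>L\<^sup>2\<close>-sum of the cosine series is determined only up to null sets; \<open>modified_hilbert\<close>
  selects a representative.
\<close>

definition modified_hilbert :: "real \<Rightarrow> (real \<Rightarrow> real) \<Rightarrow> real \<Rightarrow> real" where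
  "modified_hilbert T \<phi> = (SOME \<psi>. L2_converges T
     (\<lambda>n t. \<Sum>k<n. sine_coeff T \<phi> k * cos ((pi / 2 + real k * pi) * (t / T))) \<psi>)"

definition truncated_hilbert :: "(real \<Rightarrow> real) \<Rightarrow> real \<Rightarrow> real \<Rightarrow> real \<Rightarrow> real" where
  "truncated_hilbert f t \<epsilon> R = 1 / pi *
     integral\<^sup>L (lebesgue_on {s. \<epsilon> < \<bar>t - s\<bar> \<and> \<bar>t - s\<bar> < R}) (\<lambda>s. f s / (t - s))"

text \<open>
  The principal value is the joint limit \<open>\<epsilon> \<rightarrow> 0+\<close>, \<open>R \<rightarrow> \<infinity>\<close>, with \<open>\<epsilon>\<close> and \<open>R\<close> independent of
  each other.
\<close>

definition hilbert_exists :: "(real \<Rightarrow> real) \<Rightarrow> real \<Rightarrow> bool" where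
  "hilbert_exists f t \<longleftrightarrow>
     (\<forall>\<epsilon>>0. \<forall>R. integrable (lebesgue_on {s. \<epsilon> < \<bar>t - s\<bar> \<and> \<bar>t - s\<bar> < R}) (\<lambda>s. f s / (t - s))) \<and>
     (\<exists>l. ((\<lambda>(\<epsilon>, R). truncated_hilbert f t \<epsilon> R) \<longlongrightarrow> l) (at_right 0 \<times>\<^sub>F at_top))"

text \<open>The value is meaningful only where \<open>hilbert_exists\<close> holds.\<close>

definition hilbert :: "(real \<Rightarrow> real) \<Rightarrow> real \<Rightarrow> real" where
  "hilbert f t = Lim (at_right 0 \<times>\<^sub>F at_top) (\<lambda>(\<epsilon>, R). truncated_hilbert f t \<epsilon> R)"

text \<open>
  For \<open>T > 0\<close>, the integer \<open>k\<close> below is the unique one with \<open>(4k-2)T \<le> s < (4k+2)T\<close>. On the null set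
  of multiples of \<open>T\<close>, where the reflection is left unspecified, the value is 0. The lemma
  \<open>periodic_reflection_cases\<close> gives the defining equations for every \<open>k\<close>.
\<close>

definition periodic_reflection :: "real \<Rightarrow> (real \<Rightarrow> real) \<Rightarrow> real \<Rightarrow> real" where
  "periodic_reflection T \<phi> s =
     (let k = real_of_int \<lfloor>(s + 2 * T) / (4 * T)\<rfloor> in
      if s \<in> {(4 * k - 2) * T <..< (4 * k - 1) * T} then - \<phi> (s + 2 * T - 4 * k * T)
      else if s \<in> {(4 * k - 1) * T <..< 4 * k * T} then - \<phi> (4 * k * T - s)
      else if s \<in> {4 * k * T <..< (4 * k + 1) * T} then \<phi> (s - 4 * k * T)
      else if s \<in> {(4 * k + 1) * T <..< (4 * k + 2) * T} then \<phi> (4 * k * T + 2 * T - s)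
      else 0)"

lemma periodic_reflection_cases:
  fixes T s :: real and k :: int
  assumes T: "T > 0"
  shows "s \<in> {(4 * k - 2) * T <..< (4 * k - 1) * T} \<Longrightarrow>
           periodic_reflection T \<phi> s = - \<phi> (s + 2 * T - 4 * k * T)"
    and "s \<in> {(4 * k - 1) * T <..< 4 * k * T} \<Longrightarrow>
           periodic_reflection T \<phi> s = - \<phi> (4 * k * T - s)"
    and "s \<in> {4 * k * T <..< (4 * k + 1) * T} \<Longrightarrow>
           periodic_reflection T \<phi> s = \<phi> (s - 4 * k * T)"
    and "s \<in> {(4 * k + 1) * T <..< (4 * k + 2) * T} \<Longrightarrow>
           periodic_reflection T \<phi> s = \<phi> (4 * k * T + 2 * T - s)"
proof -
  have fl: "\<lfloor>(s + 2 * T) / (4 * T)\<rfloor> = k" if "(4 * k - 2) * T < s" "s < (4 * k + 2) * T"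
    using that T by (intro floor_unique) (simp_all add: field_simps)
  have o: "(4 * k - 2) * T < (4 * k - 1) * T" "(4 * k - 1) * T < 4 * k * T"
    "4 * k * T < (4 * k + 1) * T" "(4 * k + 1) * T < (4 * k + 2) * T"
    using T by simp_all
  show "periodic_reflection T \<phi> s = - \<phi> (s + 2 * T - 4 * k * T)"
    if "s \<in> {(4 * k - 2) * T <..< (4 * k - 1) * T}"
  proof -
    have "\<lfloor>(s + 2 * T) / (4 * T)\<rfloor> = k" using that o by (intro fl) auto
    then show ?thesis using that o unfolding periodic_reflection_def Let_def by auto
  qed
  show "periodic_reflection T \<phi> s = - \<phi> (4 * k * T - s)"
    if "s \<in> {(4 * k - 1) * T <..< 4 * k * T}"
  proof -
    have "\<lfloor>(s + 2 * T) / (4 * T)\<rfloor> = k" using that o by (intro fl) auto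
    then show ?thesis using that o unfolding periodic_reflection_def Let_def by auto
  qed
  show "periodic_reflection T \<phi> s = \<phi> (s - 4 * k * T)"
    if "s \<in> {4 * k * T <..< (4 * k + 1) * T}"
  proof -
    have "\<lfloor>(s + 2 * T) / (4 * T)\<rfloor> = k" using that o by (intro fl) auto
    then show ?thesis using that o unfolding periodic_reflection_def Let_def by auto
  qed
  show "periodic_reflection T \<phi> s = \<phi> (4 * k * T + 2 * T - s)"
    if "s \<in> {(4 * k + 1) * T <..< (4 * k + 2) * T}"
  proof -
    have "\<lfloor>(s + 2 * T) / (4 * T)\<rfloor> = k" using that o by (intro fl) auto
    then show ?thesis using that o unfolding periodic_reflection_def Let_def by auto
  qed
qed

end

theory Submission
  imports Defs
begin

text \<open>
  Put \<open>S = modified_hilbert T \<phi>\<close>, let \<open>u\<close> be the restriction of the periodic reflection of \<open>\<phi>\<close> to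
  \<open>(-T, T)\<close> (an odd function) and \<open>v\<close> the even extension of \<open>S\<close>. Comparing coefficients, the Abel means of
  the cosine series at \<open>t\<close> equal both \<open>1/T \<integral> v(s) p\<^sub>w(t - s) ds\<close> and \<open>- 1/T \<integral> u(s) q\<^sub>w(t - s) ds\<close>, where \<open>p\<^sub>w\<close>, \<open>q\<^sub>w\<close> are the
  Poisson kernel and conjugate Poisson kernel of the odd harmonics. As \<open>w \<rightarrow> 0\<close>, the first integral tends
  to \<open>S(t)\<close> at every Lebesgue point of \<open>v\<close>. The difference between \<open>q\<^sub>w\<close> and the kernel
  \<open>1 / (2 sin (\<pi> x / (2T)))\<close> truncated at \<open>\<bar>x\<bar> > w\<close> is odd and of size \<open>min (1/w) (w/x\<^sup>2)\<close>, so at every Lebesgue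
  point of \<open>u\<close> the truncated cosecant integrals have the same limit as the second one. Finally, since the
  reflection changes sign under translation by \<open>2T\<close>, folding the principal value integral over the line
  onto one period turns \<open>1/x\<close> into the partial fraction series of the cosecant.
\<close>

subsection \<open>Lebesgue points and approximate identities\<close>

text \<open>Since \<open>\<phi>\<close> is merely square integrable, the cosine sum is known only as
  an \<open>L2\<close> limit, yet it has to be tied to a principal value at a point. The parameter
  \<open>w\<close> equals \<open>(1/r - r)/2\<close> for the Abel radius \<open>r\<close>; with it,
  one number is both the smoothing scale and the radius of the interval removed around
  \<open>t\<close>, so that existence of the principal value comes out of the comparison of kernels.
  In the approximate identity argument the two kernels differ only in their limiting mass:
  \<open>T\<close> for the Poisson kernel, 0 for the odd difference kernel. The other obstacle lies
  at infinity. The reflection does not decay, so the limit in \<open>R\<close> depends on the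
  alternation of signs and not on absolute integrability. Cutting \<open>1 / (t - s)\<close> at the
  distance \<open>T - t\<close>, the distance from \<open>t\<close> to the nearer end of the period,
  separates a singular part that depends only on \<open>\<epsilon>\<close> from a bounded kernel
  whose integral depends only on \<open>R\<close>. This is what makes the two limits
  independent.\<close>

lemma borel_measurable_lebesgueI:
  "f \<in> borel_measurable borel \<Longrightarrow> f \<in> borel_measurable lebesgue"
  by (simp add: measurable_completion)

lemma integrable_mult_bounded:
  fixes f g :: "real \<Rightarrow> real"
  assumes f: "integrable lebesgue f" and g: "g \<in> borel_measurable borel"
    and bd: "\<And>x. f x \<noteq> 0 \<Longrightarrow> \<bar>g x\<bar> \<le> C"
  shows "integrable lebesgue (\<lambda>x. f x * g x)"
proof (rule Bochner_Integration.integrable_bound)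
  show "integrable lebesgue (\<lambda>x. C * f x)" using f by simp
  show "(\<lambda>x. f x * g x) \<in> borel_measurable lebesgue"
    using borel_measurable_integrable[OF f] borel_measurable_lebesgueI[OF g] by simp
  show "AE x in lebesgue. norm (f x * g x) \<le> norm (C * f x)"
  proof (intro AE_I2)
    fix x
    show "norm (f x * g x) \<le> norm (C * f x)"
    proof (cases "f x = 0")
      case False
      then have "\<bar>g x\<bar> \<le> \<bar>C\<bar>" using bd by fastforce
      then show ?thesis using mult_left_mono[OF \<open>\<bar>g x\<bar> \<le> \<bar>C\<bar>\<close>, of "\<bar>f x\<bar>"] by (simp add: abs_mult mult.commute)
    qed simp
  qed
qed

lemma set_integrable_abs_diff:
  fixes f :: "real \<Rightarrow> real"
  assumes "integrable lebesgue f"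
  shows "set_integrable lebesgue {a..b} (\<lambda>s. \<bar>f s - c\<bar>)"
proof -
  have "set_integrable lebesgue {a..b} f"
    unfolding set_integrable_def using assms by (intro integrable_mult_indicator) auto
  moreover have "set_integrable lebesgue {a..b} (\<lambda>s. c)" by simp
  ultimately show ?thesis by (intro set_integrable_abs set_integral_diff(1))
qed

text \<open>The library differentiates the indefinite integral of a single function almost everywhere; applying
  this to \<open>\<bar>f - q\<bar>\<close> for all rational \<open>q\<close> yields Lebesgue points.\<close>

lemma right_lebesgue_points:
  fixes f :: "real \<Rightarrow> real"
  assumes f: "integrable lebesgue f"
  obtains N where "negligible N"
    "\<And>t. t \<notin> N \<Longrightarrow> ((\<lambda>h. (LINT s:{t..t+h}|lebesgue. \<bar>f s - f t\<bar>) / h) \<longlongrightarrow> 0) (at_right 0)"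
proof -
  note sint = set_integrable_abs_diff[OF f]
  have "\<exists>N. negligible N \<and> (\<forall>x e. x \<notin> N \<and> 0 < e \<longrightarrow> (\<exists>d>0. \<forall>h. 0 < h \<and> h < d \<longrightarrow>
      norm (integral (cbox x (x + h *\<^sub>R One)) (\<lambda>s. \<bar>f s - of_rat q\<bar>) /\<^sub>R h ^ DIM(real) - \<bar>f x - of_rat q\<bar>) < e))" for q
  proof -
    have "(\<lambda>s. \<bar>f s - of_rat q\<bar>) integrable_on cbox a b" for a b
      using set_lebesgue_integral_eq_integral(1)[OF sint] by (simp add: cbox_interval)
    then show ?thesis by (rule integrable_ccontinuous_explicit[where f="\<lambda>s. \<bar>f s - of_rat q\<bar>"]) blast
  qed
  then obtain N where N: "\<And>q. negligible (N q)"
    and NN: "\<And>q x e. x \<notin> N q \<Longrightarrow> 0 < e \<Longrightarrow> (\<exists>d>0. \<forall>h. 0 < h \<and> h < d \<longrightarrow>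
      norm (integral (cbox x (x + h *\<^sub>R One)) (\<lambda>s. \<bar>f s - of_rat q\<bar>) /\<^sub>R h ^ DIM(real) - \<bar>f x - of_rat q\<bar>) < e)"
    by metis
  show ?thesis
  proof
    show "negligible (\<Union>(range N))"
      using N by (intro negligible_countable_Union) auto
    fix t assume t: "t \<notin> \<Union>(range N)"
    show "((\<lambda>h. (LINT s:{t..t+h}|lebesgue. \<bar>f s - f t\<bar>) / h) \<longlongrightarrow> 0) (at_right 0)"
    proof (rule tendstoI)
      fix e :: real assume e: "0 < e"
      \<comment> \<open>Three thirds of \<open>e\<close>: one for replacing \<open>f t\<close> by
        \<open>q\<close> in the integrand, one for the error of the average, one for its limit
        \<open>\<bar>f t - of_rat q\<bar>\<close>, which is itself small.\<close>
      obtain q where "f t - e / 3 < of_rat q" "of_rat q < f t + e / 3"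
        using of_rat_dense[of "f t - e / 3" "f t + e / 3"] e by auto
      then have q: "\<bar>f t - of_rat q\<bar> < e / 3" by linarith
      obtain d where d: "d > 0" and dd: "\<And>h. 0 < h \<Longrightarrow> h < d \<Longrightarrow>
          \<bar>integral {t..t+h} (\<lambda>s. \<bar>f s - of_rat q\<bar>) / h - \<bar>f t - of_rat q\<bar>\<bar> < e / 3"
      proof -
        have eq: "norm (integral (cbox t (t + h *\<^sub>R One)) (\<lambda>s. \<bar>f s - of_rat q\<bar>) /\<^sub>R h ^ DIM(real) - \<bar>f t - of_rat q\<bar>)
            = \<bar>integral {t..t+h} (\<lambda>s. \<bar>f s - of_rat q\<bar>) / h - \<bar>f t - of_rat q\<bar>\<bar>" for h
          by (simp add: cbox_interval divide_inverse mult.commute)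
        have "t \<notin> N q" using t by blast
        from NN[OF this, of "e / 3"] e show ?thesis
          unfolding eq using that by (metis zero_less_divide_iff zero_less_numeral)
      qed
      have "dist ((LINT s:{t..t+h}|lebesgue. \<bar>f s - f t\<bar>) / h) 0 < e" if h: "0 < h" "h < d" for h
      proof -
        have "(LINT s:{t..t+h}|lebesgue. \<bar>f s - f t\<bar>) \<le>
            (LINT s:{t..t+h}|lebesgue. \<bar>f s - of_rat q\<bar> + \<bar>f t - of_rat q\<bar>)"
          by (intro set_integral_mono sint set_integral_add(1)) auto
        also have "\<dots> = (LINT s:{t..t+h}|lebesgue. \<bar>f s - of_rat q\<bar>) + h * \<bar>f t - of_rat q\<bar>"
          using h by (subst set_integral_add(2)) (auto intro: sint simp: set_integral_const)
        also have "(LINT s:{t..t+h}|lebesgue. \<bar>f s - of_rat q\<bar>) = integral {t..t+h} (\<lambda>s. \<bar>f s - of_rat q\<bar>)"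
          by (rule set_lebesgue_integral_eq_integral(2)[OF sint])
        finally have "(LINT s:{t..t+h}|lebesgue. \<bar>f s - f t\<bar>) / h \<le>
            integral {t..t+h} (\<lambda>s. \<bar>f s - of_rat q\<bar>) / h + \<bar>f t - of_rat q\<bar>"
          using h by (simp add: field_simps)
        moreover have "0 \<le> (LINT s:{t..t+h}|lebesgue. \<bar>f s - f t\<bar>) / h"
          using h unfolding set_lebesgue_integral_def by (intro divide_nonneg_pos Bochner_Integration.integral_nonneg) auto
        ultimately show ?thesis using dd[OF h] q unfolding dist_real_def by linarith
      qed
      then show "\<forall>\<^sub>F h in at_right 0. dist ((LINT s:{t..t+h}|lebesgue. \<bar>f s - f t\<bar>) / h) 0 < e"
        using d eventually_at_right_real[of 0 d] by (auto elim: eventually_mono)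
    qed
  qed
qed

text \<open>The one-sided result sees only intervals starting at \<open>t\<close>; applied to
  \<open>f (- s)\<close> it also covers those ending at \<open>t\<close>. Dividing by
  \<open>h\<close> instead of the length \<open>2 * h\<close> is harmless because the limit is
  0.\<close>

lemma lebesgue_points:
  fixes f :: "real \<Rightarrow> real"
  assumes f: "integrable lebesgue f"
  shows "AE t in lebesgue. ((\<lambda>h. (LINT s:{t-h..t+h}|lebesgue. \<bar>f s - f t\<bar>) / h) \<longlongrightarrow> 0) (at_right 0)"
proof -
  obtain N where N: "negligible N"
    "\<And>t. t \<notin> N \<Longrightarrow> ((\<lambda>h. (LINT s:{t..t+h}|lebesgue. \<bar>f s - f t\<bar>) / h) \<longlongrightarrow> 0) (at_right 0)"
    using right_lebesgue_points[OF f] by blast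
  have f': "integrable lebesgue (\<lambda>x. f (- x))"
    using lebesgue_integrable_real_affine[OF f, of "-1" 0] by simp
  obtain N' where N': "negligible N'"
    "\<And>t. t \<notin> N' \<Longrightarrow> ((\<lambda>h. (LINT s:{t..t+h}|lebesgue. \<bar>f (- s) - f (- t)\<bar>) / h) \<longlongrightarrow> 0) (at_right 0)"
    using right_lebesgue_points[OF f'] by blast
  have neg: "negligible (N \<union> uminus ` N')"
    using N(1) N'(1)
    by (intro negligible_Un negligible_differentiable_image_negligible) (auto intro: derivative_intros)
  have "((\<lambda>h. (LINT s:{t-h..t+h}|lebesgue. \<bar>f s - f t\<bar>) / h) \<longlongrightarrow> 0) (at_right 0)"
    if t: "t \<notin> N \<union> uminus ` N'" for t
  proof -
    have t': "- t \<notin> N'" using t by force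
    note sint = set_integrable_abs_diff[OF f]
    have "((\<lambda>h. (LINT s:{t..t+h}|lebesgue. \<bar>f s - f t\<bar>) / h + (LINT s:{-t..-t+h}|lebesgue. \<bar>f (- s) - f (- (-t))\<bar>) / h)
        \<longlongrightarrow> 0 + 0) (at_right 0)"
      using t by (intro tendsto_add N N'(2) t') auto
    then have lim: "((\<lambda>h. (LINT s:{t..t+h}|lebesgue. \<bar>f s - f t\<bar>) / h + (LINT s:{-t..-t+h}|lebesgue. \<bar>f (- s) - f t\<bar>) / h)
        \<longlongrightarrow> 0) (at_right 0)" by simp
    show ?thesis
    proof (rule tendsto_cong[THEN iffD1, OF _ lim])
      have "(LINT s:{t..t+h}|lebesgue. \<bar>f s - f t\<bar>) / h + (LINT s:{-t..-t+h}|lebesgue. \<bar>f (- s) - f t\<bar>) / h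
          = (LINT s:{t-h..t+h}|lebesgue. \<bar>f s - f t\<bar>) / h" if h: "0 < h" for h
      proof -
        have "(LINT s:{-t..-t+h}|lebesgue. \<bar>f (- s) - f t\<bar>) = (LINT s:{t-h..t}|lebesgue. \<bar>f s - f t\<bar>)"
          unfolding set_lebesgue_integral_def
          by (subst (2) lebesgue_integral_real_affine[where c="-1" and t=0])
             (auto intro!: Bochner_Integration.integral_cong simp: indicator_def)
        moreover have "(LINT s:{t-h..t+h}|lebesgue. \<bar>f s - f t\<bar>) =
            (LINT s:{t-h..t}|lebesgue. \<bar>f s - f t\<bar>) + (LINT s:{t..t+h}|lebesgue. \<bar>f s - f t\<bar>)"
        proof -
          have "{t-h..t+h} = {t-h..t} \<union> {t..t+h}" using h by auto
          moreover have "AE x in lebesgue. \<not> (x \<in> {t-h..t} \<and> x \<in> {t..t+h})"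
            by (rule AE_I'[where N="{t}"]) (auto simp: negligible_iff_null_sets[symmetric])
          ultimately show ?thesis
            by (simp only:) (rule set_integral_Un_AE, auto intro: sint)
        qed
        ultimately show ?thesis by (simp add: add_divide_distrib)
      qed
      then show "\<forall>\<^sub>F h in at_right 0. (LINT s:{t..t+h}|lebesgue. \<bar>f s - f t\<bar>) / h + (LINT s:{-t..-t+h}|lebesgue. \<bar>f (- s) - f t\<bar>) / h
          = (LINT s:{t-h..t+h}|lebesgue. \<bar>f s - f t\<bar>) / h"
        using eventually_at_right_less by (rule eventually_mono[rotated]) auto
    qed
  qed
  then show ?thesis
    by (intro AE_I'[where N="N \<union> uminus ` N'"]) (use neg in \<open>auto simp: negligible_iff_null_sets\<close>)
qed

text \<open>The kernel is dominated by \<open>\<Sum>j. 4 C 4\<^sup>-\<^sup>j / w\<close> times the indicator of \<open>\<bar>s - t\<bar> \<le> 2\<^sup>j w\<close>, which turns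
  the integral into a convergent combination of averages of \<open>\<bar>g\<bar>\<close>.\<close>

lemma approximate_kernel_tendsto_0:
  fixes g :: "real \<Rightarrow> real" and K :: "real \<Rightarrow> real \<Rightarrow> real"
  assumes g: "integrable lebesgue g"
    and avg: "((\<lambda>h. (LINT s:{t-h..t+h}|lebesgue. \<bar>g s\<bar>) / h) \<longlongrightarrow> 0) (at_right 0)"
    and K: "\<And>w. 0 < w \<Longrightarrow> K w \<in> borel_measurable borel"
    and near: "\<And>w s. 0 < w \<Longrightarrow> g s \<noteq> 0 \<Longrightarrow> \<bar>K w s\<bar> \<le> C / w"
    and far: "\<And>w s. 0 < w \<Longrightarrow> g s \<noteq> 0 \<Longrightarrow> \<bar>K w s\<bar> * (s - t)\<^sup>2 \<le> C * w"
    and C: "C \<ge> 0"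
  shows "((\<lambda>w. LINT s|lebesgue. g s * K w s) \<longlongrightarrow> 0) (at_right 0)"
proof -
  define A where "A a = (LINT s:{t-a..t+a}|lebesgue. \<bar>g s\<bar>)" for a
  define G where "G = (LINT s|lebesgue. \<bar>g s\<bar>)"
  have int: "integrable lebesgue (\<lambda>s. indicator {t-a..t+a} s * \<bar>g s\<bar>)" for a
    using integrable_mult_indicator[of "{t-a..t+a}" lebesgue "\<lambda>s. \<bar>g s\<bar>"] g by simp
  have A_int: "A a = (LINT s|lebesgue. indicator {t-a..t+a} s * \<bar>g s\<bar>)" for a
    by (simp add: A_def set_lebesgue_integral_def)
  have A0: "0 \<le> A a" for a
    unfolding A_int by (intro Bochner_Integration.integral_nonneg) auto
  have G0: "0 \<le> G"
    unfolding G_def by (intro Bochner_Integration.integral_nonneg) auto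
  have AG: "A a \<le> G" for a
    unfolding A_int G_def using g int by (intro integral_mono) (auto simp: indicator_def)
  \<comment> \<open>Small radii are controlled by the limit, large ones by the total mass
    \<open>G\<close>. A bound for all radii is needed because \<open>2^j * w\<close> becomes large
    for every fixed \<open>w\<close>.\<close>
  obtain B where B: "\<And>a. a > 0 \<Longrightarrow> A a / a \<le> B"
  proof -
    have "\<forall>\<^sub>F h in at_right 0. \<bar>A h / h\<bar> < 1"
      using order_tendstoD(2)[OF tendsto_rabs[OF avg], of 1] by (simp add: A_def)
    then obtain b where b: "b > 0" "\<And>h. 0 < h \<Longrightarrow> h < b \<Longrightarrow> \<bar>A h / h\<bar> < 1"
      by (auto simp: eventually_at_right_field)
    have "A a / a \<le> max 1 (G / b)" if "a > 0" for a
    proof (cases "a < b")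
      case True
      from b(2)[OF that this] have "A a / a < 1" by linarith
      then show ?thesis by auto
    next
      case False
      then have "A a / a \<le> G / b" using AG A0 b by (intro frac_le) (auto intro: order_trans G0)
      then show ?thesis by auto
    qed
    then show ?thesis using that by blast
  qed
  have dyadic: "norm ((1/2)^j * (A (2^j * w) / (2^j * w))) \<le> (1/2)^j * B" if "w > 0" for w :: real and j
  proof -
    have "0 \<le> A (2^j * w) / (2^j * w)" using A0 that by (intro divide_nonneg_pos) auto
    then have "norm ((1/2)^j * (A (2^j * w) / (2^j * w))) = (1/2)^j * (A (2^j * w) / (2^j * w))"
      unfolding real_norm_def by (intro abs_of_nonneg mult_nonneg_nonneg) simp_all
    also have "\<dots> \<le> (1/2)^j * B" using B[of "2^j * w"] that by (intro mult_left_mono) auto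
    finally show ?thesis .
  qed
  have far': "y \<le> C * (1/4)^J / w" if "w > 0" "2^J * w \<le> \<bar>s - t\<bar>" "y * (s - t)\<^sup>2 \<le> C * w" "y \<ge> 0" for y s w and J :: nat
  proof -
    have "(2^J * w)\<^sup>2 \<le> (s - t)\<^sup>2"
      using power_mono[OF that(2), of 2] that(1) by simp
    then have "y * (2^J * w)\<^sup>2 \<le> C * w" using that(3,4) 
      by (meson mult_left_mono order_trans)
    moreover have "(2^J * w)\<^sup>2 = 4^J * w * w"
      by (simp add: power2_eq_square mult_ac flip: power_mult_distrib)
    ultimately have "(y * (4^J * w)) * w \<le> C * w" by (simp add: mult_ac)
    then have "y * (4^J * w) \<le> C" using that(1) by simp
    then show ?thesis using that(1) by (simp add: field_simps power_divide)
  qed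
  define S where "S w = (\<Sum>j. (1/2)^j * (A (2^j * w) / (2^j * w)))" for w :: real
  have summ: "summable (\<lambda>j. (1/2)^j * (A (2^j * w) / (2^j * w)))" if "w > 0" for w :: real
  proof (rule summable_comparison_test')
    show "summable (\<lambda>j. (1/2)^j * B)" by (intro summable_mult2 summable_geometric) auto
    show "norm ((1/2)^j * (A (2^j * w) / (2^j * w))) \<le> (1/2)^j * B" for j
      by (rule dyadic[OF that])
  qed
  have "\<bar>LINT s|lebesgue. g s * K w s\<bar> \<le> 4 * C * S w" if w: "w > 0" for w
  proof -
    \<comment> \<open>The dyadic sum stops at \<open>J\<close>, and the last term pays for the
      points beyond \<open>2^J * w\<close>. Only finite sums are integrated; \<open>J\<close> tends
      to infinity after the integration.\<close>
    have pt: "\<bar>K w s\<bar> \<le> (\<Sum>j\<le>J. 4 * C * (1/4)^j / w * indicator {t-2^j*w..t+2^j*w} s) + C * (1/4)^J / w"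
      if gs: "g s \<noteq> 0" for s J
    proof (cases "\<exists>j\<le>J. \<bar>s - t\<bar> \<le> 2^j * w")
      case False
      then have "2^J * w \<le> \<bar>s - t\<bar>" by auto
      from far'[OF w this far[OF w gs]] have "\<bar>K w s\<bar> \<le> C * (1/4)^J / w" by simp
      moreover have "0 \<le> (\<Sum>j\<le>J. 4 * C * (1/4)^j / w * indicator {t-2^j*w..t+2^j*w} s)"
        using C w by (intro sum_nonneg) auto
      ultimately show ?thesis by linarith
    next
      case True
      \<comment> \<open>If \<open>j = Suc i\<close>, minimality gives
        \<open>\<bar>s - t\<bar> > 2^i * w\<close> and hence the bound
        \<open>C * (1/4)^i / w\<close>; passing from \<open>i\<close> to \<open>j\<close> is the
        origin of the factor 4.\<close>
      define j where "j = (LEAST j. \<bar>s - t\<bar> \<le> 2^j * w)"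
      have j: "\<bar>s - t\<bar> \<le> 2^j * w" unfolding j_def using True by (metis LeastI)
      have jJ: "j \<le> J" unfolding j_def using True by (meson Least_le order_trans)
      have "\<bar>K w s\<bar> \<le> 4 * C * (1/4)^j / w"
      proof (cases j)
        case 0
        have "C / w \<le> 4 * C / w" using C w by (intro divide_right_mono) auto
        then show ?thesis using near[OF w gs] 0 by simp
      next
        case (Suc i)
        then have "i < (LEAST j. \<bar>s - t\<bar> \<le> 2^j * w)" unfolding j_def by simp
        from not_less_Least[OF this] have "\<not> \<bar>s - t\<bar> \<le> 2^i * w" .
        then have "2^i * w \<le> \<bar>s - t\<bar>" by auto
        from far'[OF w this far[OF w gs]] show ?thesis using Suc by simp
      qed
      also have "\<dots> = 4 * C * (1/4)^j / w * indicator {t-2^j*w..t+2^j*w} s"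
        using j by (auto simp: indicator_def)
      also have "\<dots> \<le> (\<Sum>j\<le>J. 4 * C * (1/4)^j / w * indicator {t-2^j*w..t+2^j*w} s)"
        using C w jJ by (intro member_le_sum) auto
      finally show ?thesis using C w by (simp add: add_increasing2)
    qed
    have bound: "\<bar>LINT s|lebesgue. g s * K w s\<bar> \<le> 4 * C * S w + C * G / w * (1/4)^J" for J
    proof -
      have "norm (LINT s|lebesgue. g s * K w s) \<le> (LINT s|lebesgue. (\<Sum>j\<le>J. 4 * C * (1/4)^j / w * (indicator {t-2^j*w..t+2^j*w} s * \<bar>g s\<bar>)) + C * (1/4)^J / w * \<bar>g s\<bar>)"
      proof (rule Bochner_Integration.integral_norm_bound_integral)
        show "integrable lebesgue (\<lambda>s. g s * K w s)"
          by (rule integrable_mult_bounded[OF g K[OF w] near[OF w]])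
        show "integrable lebesgue (\<lambda>s. (\<Sum>j\<le>J. 4 * C * (1/4)^j / w * (indicator {t-2^j*w..t+2^j*w} s * \<bar>g s\<bar>)) + C * (1/4)^J / w * \<bar>g s\<bar>)"
          using g int by (intro Bochner_Integration.integrable_add Bochner_Integration.integrable_sum integrable_mult_right) auto
        fix s
        show "norm (g s * K w s) \<le> (\<Sum>j\<le>J. 4 * C * (1/4)^j / w * (indicator {t-2^j*w..t+2^j*w} s * \<bar>g s\<bar>)) + C * (1/4)^J / w * \<bar>g s\<bar>"
        proof (cases "g s = 0")
          case False
          have "norm (g s * K w s) = \<bar>K w s\<bar> * \<bar>g s\<bar>" by (simp add: abs_mult)
          also have "\<dots> \<le> ((\<Sum>j\<le>J. 4 * C * (1/4)^j / w * indicator {t-2^j*w..t+2^j*w} s) + C * (1/4)^J / w) * \<bar>g s\<bar>"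
            by (rule mult_right_mono[OF pt[OF False] abs_ge_zero])
          also have "\<dots> = (\<Sum>j\<le>J. 4 * C * (1/4)^j / w * (indicator {t-2^j*w..t+2^j*w} s * \<bar>g s\<bar>)) + C * (1/4)^J / w * \<bar>g s\<bar>"
            by (simp only: sum_distrib_right distrib_right mult.assoc)
          finally show ?thesis .
        qed simp
      qed
      also have "\<dots> = (\<Sum>j\<le>J. 4 * C * (1/4)^j / w * A (2^j*w)) + C * (1/4)^J / w * G"
        using g int by (subst Bochner_Integration.integral_add) (auto simp: A_int G_def Bochner_Integration.integral_sum)
      \<comment> \<open>Since \<open>(1/4)^j / w = (1/2)^j / (2^j * w)\<close>, half of the decay
        turns \<open>A\<close> into an average and the other half remains for summability.\<close>
      also have "(\<Sum>j\<le>J. 4 * C * (1/4)^j / w * A (2^j*w)) = 4 * C * (\<Sum>j\<le>J. (1/2)^j * (A (2^j * w) / (2^j * w)))"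
        unfolding sum_distrib_left using w
        by (intro sum.cong refl) (simp add: field_simps flip: power_mult_distrib)
      also have "\<dots> \<le> 4 * C * S w"
        unfolding S_def using C w A0 by (intro mult_left_mono sum_le_suminf summ) auto
      finally show ?thesis by (simp add: mult_ac)
    qed
    have "(\<lambda>J. 4 * C * S w + C * G / w * (1/4)^J) \<longlonglongrightarrow> 4 * C * S w + C * G / w * 0"
      by (intro tendsto_intros LIMSEQ_realpow_zero) auto
    then show ?thesis using bound by (intro LIMSEQ_le_const) auto
  qed
  then have ev: "\<forall>\<^sub>F w in at_right 0. norm (LINT s|lebesgue. g s * K w s) \<le> 4 * C * S w"
    using eventually_at_right_less[of "0::real"] by (auto elim: eventually_mono)
  have "((\<lambda>w. \<Sum>j. (1/2)^j * (A (2^j * w) / (2^j * w))) \<longlongrightarrow> (\<Sum>j::nat. 0)) (at_right 0)"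
  proof (rule conjunct2[OF conjunct2[OF tannerys_theorem]])
    show "((\<lambda>w. (1/2)^j * (A (2^j * w) / (2^j * w))) \<longlongrightarrow> 0) (at_right 0)" for j :: nat
    proof -
      have "filterlim (\<lambda>w::real. 2^j * w) (at_right 0) (at_right 0)"
        by (rule filterlim_times_pos[OF filterlim_ident]) auto
      from filterlim_compose[OF avg this]
      have "((\<lambda>w. (1/2)^j * (A (2^j * w) / (2^j * w))) \<longlongrightarrow> (1/2)^j * 0) (at_right 0)"
        unfolding A_def by (intro tendsto_intros)
      then show ?thesis by simp
    qed
    show "summable (\<lambda>j. (1/2)^j * B)" by (intro summable_mult2 summable_geometric) auto
    have "\<forall>\<^sub>F w in at_right 0. \<forall>j. norm ((1/2)^j * (A (2^j * w) / (2^j * w))) \<le> (1/2)^j * B"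
      using eventually_at_right_less[of "0::real"] by (rule eventually_mono) (use dyadic in blast)
    then show "\<forall>\<^sub>F (j, w) in at_top \<times>\<^sub>F at_right 0. norm ((1/2)^j * (A (2^j * w) / (2^j * w))) \<le> (1/2)^j * B"
      unfolding eventually_prod_filter by (intro exI[of _ "\<lambda>_. True"] exI conjI, simp, assumption, auto)
  qed simp
  then have "((\<lambda>w. 4 * C * S w) \<longlongrightarrow> 4 * C * 0) (at_right 0)"
    unfolding S_def by (intro tendsto_intros) simp
  then show ?thesis using Lim_null_comparison[OF ev] by simp
qed

subsection \<open>Poisson kernels of the odd harmonics\<close>

text \<open>With \<open>r = sqrt (1 + w\<^sup>2) - w\<close> and \<open>z = r e\<^sup>i\<^sup>\<theta>\<close> the odd geometric series \<open>\<Sum>k. z\<^sup>2\<^sup>k\<^sup>+\<^sup>1 = z / (1 - z\<^sup>2)\<close> has the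
  two kernels below as real and imaginary part; in terms of \<open>w\<close> they look like the kernels of the half
  plane, with \<open>sin \<theta>\<close> in place of the space variable.\<close>

definition radius :: "real \<Rightarrow> real" where
  "radius w = sqrt (1 + w\<^sup>2) - w"

definition poisson :: "real \<Rightarrow> real \<Rightarrow> real" where
  "poisson w \<theta> = w * cos \<theta> / (2 * (w\<^sup>2 + (sin \<theta>)\<^sup>2))"

definition conj_poisson :: "real \<Rightarrow> real \<Rightarrow> real" where
  "conj_poisson w \<theta> = sqrt (1 + w\<^sup>2) * sin \<theta> / (2 * (w\<^sup>2 + (sin \<theta>)\<^sup>2))"

lemma radius_bounds: "w > 0 \<Longrightarrow> 0 < radius w \<and> radius w < 1"
proof -
  assume w: "w > 0"
  have "w < sqrt (1 + w\<^sup>2)" using w by (intro real_less_rsqrt) auto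
  moreover have "sqrt (1 + w\<^sup>2) < 1 + w" using w by (intro real_less_lsqrt) (auto simp: power2_eq_square algebra_simps)
  ultimately show ?thesis by (auto simp: radius_def)
qed

text \<open>With \<open>c = sqrt (1 + w\<^sup>2)\<close> the radius satisfies
  \<open>r * (c + w) = 1\<close>, so \<open>1/z = (c + w) * cis (- \<theta>)\<close> and
  \<open>1/z - z\<close> is twice the conjugate of
  \<open>v = w * cos \<theta> + \<i> * c * sin \<theta>\<close>. Hence
  \<open>z / (1 - z\<^sup>2)\<close> is \<open>v\<close> divided by twice its squared modulus, and
  this modulus squared is \<open>w\<^sup>2 + (sin \<theta>)\<^sup>2\<close>.\<close>

lemma poisson_series:
  assumes w: "w > 0"
  shows "(\<lambda>k. radius w ^ (2 * k + 1) * cos ((2 * real k + 1) * \<theta>)) sums poisson w \<theta>"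
    and "(\<lambda>k. radius w ^ (2 * k + 1) * sin ((2 * real k + 1) * \<theta>)) sums conj_poisson w \<theta>"
proof -
  define r where "r = radius w"
  define c where "c = sqrt (1 + w\<^sup>2)"
  have r: "0 < r" "r < 1" using radius_bounds[OF w] by (auto simp: r_def)
  have c2: "c\<^sup>2 = 1 + w\<^sup>2" by (simp add: c_def)
  have rc: "r = c - w" by (simp add: r_def c_def radius_def)
  have r1: "r * (c + w) = 1" using c2 by (simp add: rc algebra_simps power2_eq_square)
  define z where "z = complex_of_real r * cis \<theta>"
  have nz: "norm (z\<^sup>2) < 1"
    using r by (simp add: z_def norm_power norm_mult power_less_one_iff)
  have D0: "w\<^sup>2 + (sin \<theta>)\<^sup>2 > 0" using w by (simp add: add_pos_nonneg)
  define v where "v = complex_of_real (w * cos \<theta>) + \<i> * of_real (c * sin \<theta>)"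
  define D where "D = complex_of_real (2 * (w\<^sup>2 + (sin \<theta>)\<^sup>2))"
  have "z * D = v * (1 - z\<^sup>2)"
  proof -
    have z1: "z * (of_real (c + w) * cis (- \<theta>)) = 1"
    proof -
      have "z * (of_real (c + w) * cis (- \<theta>)) = of_real (r * (c + w)) * (cis \<theta> * cis (- \<theta>))"
        by (simp add: z_def)
      then show ?thesis by (simp only: r1 cis_mult) simp
    qed
    have "of_real (c + w) * cis (- \<theta>) - z = 2 * cnj v"
      by (simp add: z_def v_def rc complex_eq_iff algebra_simps)
    then have h1: "1 - z\<^sup>2 = 2 * z * cnj v" using z1
      by (simp add: power2_eq_square algebra_simps)
    have h2: "2 * (cnj v * v) = D"
    proof -
      have "(w * cos \<theta>)\<^sup>2 + (c * sin \<theta>)\<^sup>2 = w\<^sup>2 + (sin \<theta>)\<^sup>2"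
        using c2 by (simp add: power_mult_distrib cos_squared_eq algebra_simps)
      then show ?thesis by (simp add: D_def v_def complex_eq_iff power2_eq_square)
    qed
    show ?thesis unfolding h1 h2[symmetric] by (simp add: mult_ac)
  qed
  moreover have "1 - z\<^sup>2 \<noteq> 0" using nz by auto
  moreover have "D \<noteq> 0" using D0 by (simp only: D_def of_real_eq_0_iff mult_eq_0_iff) auto
  ultimately have zv: "z / (1 - z\<^sup>2) = v / D" by (simp add: field_simps)
  have "(\<lambda>k. z * (z\<^sup>2) ^ k) sums (z * (1 / (1 - z\<^sup>2)))"
    by (intro sums_mult geometric_sums nz)
  then have S: "(\<lambda>k. z ^ (2 * k + 1)) sums (v / D)"
    by (simp only: power_add power_one_right power_mult mult.commute[of "(z\<^sup>2) ^ _" z] times_divide_eq_right mult_1_right zv)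
  have zk: "z ^ (2 * k + 1) = of_real (r ^ (2 * k + 1)) * cis ((2 * real k + 1) * \<theta>)" for k
    by (simp only: z_def power_mult_distrib Complex.DeMoivre of_real_power of_nat_add of_nat_mult of_nat_numeral of_nat_1)
  have Re: "Re (v / D) = poisson w \<theta>" "Im (v / D) = conj_poisson w \<theta>"
    unfolding D_def by (simp_all add: v_def poisson_def conj_poisson_def c_def del: of_real_mult of_real_add)
  have zkR: "Re (z ^ (2 * k + 1)) = r ^ (2 * k + 1) * cos ((2 * real k + 1) * \<theta>)"
    and zkI: "Im (z ^ (2 * k + 1)) = r ^ (2 * k + 1) * sin ((2 * real k + 1) * \<theta>)" for k
    unfolding zk by (simp_all del: of_real_power of_real_mult power_Suc)
  show "(\<lambda>k. radius w ^ (2 * k + 1) * cos ((2 * real k + 1) * \<theta>)) sums poisson w \<theta>"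
    using sums_Re[OF S] unfolding Re zkR r_def .
  show "(\<lambda>k. radius w ^ (2 * k + 1) * sin ((2 * real k + 1) * \<theta>)) sums conj_poisson w \<theta>"
    using sums_Im[OF S] unfolding Re zkI r_def .
qed

lemma poisson_near: "w > 0 \<Longrightarrow> \<bar>poisson w \<theta>\<bar> \<le> 1 / w"
proof -
  assume w: "w > 0"
  have "\<bar>w * cos \<theta>\<bar> * w \<le> 2 * (w\<^sup>2 + (sin \<theta>)\<^sup>2)"
  proof -
    have "w\<^sup>2 * \<bar>cos \<theta>\<bar> \<le> w\<^sup>2 * 1" by (intro mult_left_mono) auto
    moreover have "\<bar>w * cos \<theta>\<bar> * w = w\<^sup>2 * \<bar>cos \<theta>\<bar>" using w by (simp add: abs_mult power2_eq_square)
    ultimately show ?thesis using zero_le_power2[of w] zero_le_power2[of "sin \<theta>"]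
      unfolding distrib_left by linarith
  qed
  moreover have "w\<^sup>2 + (sin \<theta>)\<^sup>2 > 0" using w by (simp add: add_pos_nonneg)
  ultimately show ?thesis using w by (simp add: poisson_def abs_mult field_simps)
qed

lemma poisson_far: "w > 0 \<Longrightarrow> \<bar>poisson w \<theta>\<bar> * (sin \<theta>)\<^sup>2 \<le> w"
proof -
  assume w: "w > 0"
  have pos: "w\<^sup>2 + (sin \<theta>)\<^sup>2 > 0" using w by (simp add: add_pos_nonneg)
  have "\<bar>w * cos \<theta>\<bar> * (sin \<theta>)\<^sup>2 \<le> w * (sin \<theta>)\<^sup>2"
    using w by (intro mult_right_mono) (auto simp: abs_mult)
  also have "\<dots> \<le> w * (2 * (w\<^sup>2 + (sin \<theta>)\<^sup>2))" using w by (intro mult_left_mono) auto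
  finally have "\<bar>w * cos \<theta>\<bar> * (sin \<theta>)\<^sup>2 / (2 * (w\<^sup>2 + (sin \<theta>)\<^sup>2)) \<le> w"
    using pos by (subst pos_divide_le_eq) auto
  then show ?thesis using pos by (simp add: poisson_def abs_mult)
qed

lemma conj_poisson_near:
  assumes w: "0 < w" "w \<le> 1" and s: "\<bar>sin \<theta>\<bar> \<le> B * w"
  shows "\<bar>conj_poisson w \<theta>\<bar> \<le> B / w"
proof -
  have pos: "w\<^sup>2 + (sin \<theta>)\<^sup>2 > 0" using w by (simp add: add_pos_nonneg)
  have c: "sqrt (1 + w\<^sup>2) \<le> 2"
    using w by (intro real_le_lsqrt) (auto simp: power_le_one order_trans[of _ 1])
  have "\<bar>sqrt (1 + w\<^sup>2) * sin \<theta>\<bar> \<le> 2 * (B * w)"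
    unfolding abs_mult using c s by (intro mult_mono) auto
  then have "\<bar>sqrt (1 + w\<^sup>2) * sin \<theta>\<bar> / (2 * (w\<^sup>2 + (sin \<theta>)\<^sup>2)) \<le> 2 * (B * w) / (2 * w\<^sup>2)"
    using w pos by (intro frac_le) auto
  also have "\<dots> = B / w" using w by (simp add: power2_eq_square)
  finally show ?thesis using pos by (simp add: conj_poisson_def abs_mult)
qed

text \<open>Multiplied by the sine, the difference has numerator
  \<open>(C - 1) * \<sigma>\<^sup>2 - w\<^sup>2\<close>, where \<open>C - 1 \<le> w\<close>. The
  first term is already of order \<open>w\<close>; in the second, the hypothesis trades one factor
  \<open>w\<close> for \<open>\<bar>\<sigma>\<bar> / c\<close>, which produces the summand
  \<open>1 / c\<close>.\<close>

lemma conj_poisson_far: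
  assumes w: "0 < w" and s: "c * w \<le> \<bar>sin \<theta>\<bar>" "c > 0"
  shows "\<bar>conj_poisson w \<theta> - 1 / (2 * sin \<theta>)\<bar> * (sin \<theta>)\<^sup>2 \<le> (1 + 1 / c) * w"
proof -
  define \<sigma> where "\<sigma> = sin \<theta>"
  define C where "C = sqrt (1 + w\<^sup>2)"
  have \<sigma>: "\<sigma> \<noteq> 0" "\<bar>\<sigma>\<bar> \<le> 1" "c * w \<le> \<bar>\<sigma>\<bar>" using s w by (auto simp: \<sigma>_def) (smt (verit) mult_pos_pos)
  have pos: "w\<^sup>2 + \<sigma>\<^sup>2 > 0" using w by (simp add: add_pos_nonneg)
  have C: "1 \<le> C" "C \<le> 1 + w"
    unfolding C_def using w by (auto intro!: real_le_lsqrt simp: power2_eq_square algebra_simps)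
  define X where "X = C * \<sigma> / (2 * (w\<^sup>2 + \<sigma>\<^sup>2)) - 1 / (2 * \<sigma>)"
  have "X * \<sigma> = C * \<sigma>\<^sup>2 / (2 * (w\<^sup>2 + \<sigma>\<^sup>2)) - 1 / 2"
    using \<sigma> by (simp add: X_def left_diff_distrib power2_eq_square)
  also have "\<dots> = ((C - 1) * \<sigma>\<^sup>2 - w\<^sup>2) / (2 * (w\<^sup>2 + \<sigma>\<^sup>2))"
    using pos by (simp add: field_simps)
  finally have X\<sigma>: "X * \<sigma> = ((C - 1) * \<sigma>\<^sup>2 - w\<^sup>2) / (2 * (w\<^sup>2 + \<sigma>\<^sup>2))" .
  have "\<bar>X\<bar> * \<sigma>\<^sup>2 = \<bar>X * \<sigma>\<bar> * \<bar>\<sigma>\<bar>"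
    by (simp add: abs_mult power2_eq_square)
  then have eq: "\<bar>X\<bar> * \<sigma>\<^sup>2 = \<bar>(C - 1) * \<sigma>\<^sup>2 - w\<^sup>2\<bar> * \<bar>\<sigma>\<bar> / (2 * (w\<^sup>2 + \<sigma>\<^sup>2))"
    using pos by (simp add: X\<sigma>)
  have "\<bar>(C - 1) * \<sigma>\<^sup>2 - w\<^sup>2\<bar> * \<bar>\<sigma>\<bar> \<le> (w * \<sigma>\<^sup>2 + w\<^sup>2) * \<bar>\<sigma>\<bar>"
  proof (intro mult_right_mono)
    have "(C - 1) * \<sigma>\<^sup>2 \<le> w * \<sigma>\<^sup>2" "0 \<le> (C - 1) * \<sigma>\<^sup>2" using C by (auto intro!: mult_right_mono)
    then show "\<bar>(C - 1) * \<sigma>\<^sup>2 - w\<^sup>2\<bar> \<le> w * \<sigma>\<^sup>2 + w\<^sup>2" using zero_le_power2[of w] by linarith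
  qed simp
  also have "\<dots> = w * \<sigma>\<^sup>2 * \<bar>\<sigma>\<bar> + w * (w * \<bar>\<sigma>\<bar>)" by (simp add: algebra_simps power2_eq_square)
  also have "\<dots> \<le> w * \<sigma>\<^sup>2 * 1 + w * (\<sigma>\<^sup>2 / c)"
  proof (intro add_mono mult_left_mono)
    have "w * \<bar>\<sigma>\<bar> \<le> \<bar>\<sigma>\<bar> / c * \<bar>\<sigma>\<bar>" using \<sigma> s by (intro mult_right_mono) (auto simp: field_simps)
    then show "w * \<bar>\<sigma>\<bar> \<le> \<sigma>\<^sup>2 / c" by (simp add: power2_eq_square)
  qed (use w \<sigma> in auto)
  also have "\<dots> = (1 + 1 / c) * w * \<sigma>\<^sup>2" by (simp add: algebra_simps)
  also have "\<dots> \<le> (1 + 1 / c) * w * (2 * (w\<^sup>2 + \<sigma>\<^sup>2))"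
    using w s by (intro mult_left_mono) auto
  finally show ?thesis
    using pos eq unfolding conj_poisson_def C_def[symmetric] \<sigma>_def[symmetric] X_def[symmetric] by (simp add: pos_divide_le_eq)
qed

section \<open>Approximate identities on one period\<close>

lemma sin_lower_bound:
  assumes "\<bar>x\<bar> \<le> a" "0 < a" "a < pi"
  shows "\<bar>sin x\<bar> \<ge> sin a / pi * \<bar>x\<bar>"
proof -
  \<comment> \<open>Up to \<open>pi / 2\<close> the sine lies above its chord of slope
    \<open>2 / pi\<close>; beyond, it decreases, so \<open>sin x \<ge> sin a\<close> while
    \<open>x / pi \<le> 1\<close>. The slope \<open>sin a / pi\<close> is below both.\<close>
  have *: "sin x \<ge> sin a / pi * x" if x: "0 \<le> x" "x \<le> a" for x
  proof (cases "x \<le> pi / 2")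
    case True
    have "convex_on {0..pi/2} (\<lambda>x. - sin x)"
    proof (rule convex_on_realI)
      show "((\<lambda>x. - sin x) has_real_derivative - cos x) (at x)" for x
        by (auto intro!: derivative_eq_intros)
      show "- cos x \<le> - cos y" if "x \<in> {0..pi/2}" "y \<in> {0..pi/2}" "x \<le> y" for x y
        using that cos_monotone_0_pi_le[of x y] by auto
    qed auto
    from convex_onD_Icc'[OF this, of x] have "- sin x \<le> (- 1) / (pi/2) * x"
      using x True by simp
    then have "sin x \<ge> 2 / pi * x" by (simp add: field_simps)
    moreover have "sin a / pi * x \<le> 2 / pi * x"
      using x order_trans[OF sin_le_one[of a], of 2] by (intro mult_right_mono divide_right_mono) auto
    ultimately show ?thesis by linarith
  next
    case False
    have "sin a \<le> sin x"
    proof -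
      have "sin (pi - a) \<le> sin (pi - x)" using False x assms by (intro sin_monotone_2pi_le) auto
      then show ?thesis by simp
    qed
    moreover have "sin a / pi * x \<le> sin a"
      using x assms sin_gt_zero[of a] by (simp add: field_simps mult_left_mono)
    ultimately show ?thesis by linarith
  qed
  show ?thesis
  proof (cases "x \<ge> 0")
    case True then show ?thesis using *[of x] assms by auto
  next
    case False then show ?thesis using *[of "-x"] assms by auto
  qed
qed

text \<open>On the period the angle has modulus at most \<open>a = pi * ((t + T) / (2 * T))\<close>,
  which is below \<open>pi\<close> because \<open>t < T\<close>; so \<open>s = t\<close> is the only
  zero of the sine there. The constant found here degenerates as \<open>t\<close> approaches
  \<open>T\<close>.\<close>

lemma sin_angle_lower_bound:
  fixes T t s :: real
  assumes t: "0 < t" "t < T"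
  obtains c where "c > 0" "\<And>s. s \<in> {-T..<T} \<Longrightarrow> c * \<bar>s - t\<bar> \<le> \<bar>sin (pi * ((t - s) / (2 * T)))\<bar>"
proof
  define a where "a = pi * ((t + T) / (2 * T))"
  have "(t + T) / (2 * T) < 1" "0 < (t + T) / (2 * T)" using t by (simp_all add: field_simps)
  then have a: "0 < a" "a < pi"
    unfolding a_def using mult_strict_left_mono[of "(t + T) / (2 * T)" 1 pi] by (simp_all only: mult_pos_pos pi_gt_zero mult_1_right)
  show "0 < sin a / pi * (pi / (2 * T))" using a t by (simp add: sin_gt_zero)
  fix s assume s: "s \<in> {-T..<T}"
  have abs: "\<bar>pi * ((t - s) / (2 * T))\<bar> = pi / (2 * T) * \<bar>s - t\<bar>"
    using t by (simp add: abs_mult abs_minus_commute)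
  have "\<bar>s - t\<bar> \<le> t + T" using s t by auto
  then have "pi / (2 * T) * \<bar>s - t\<bar> \<le> pi / (2 * T) * (t + T)" using t by (intro mult_left_mono) auto
  then have "\<bar>pi * ((t - s) / (2 * T))\<bar> \<le> a" unfolding abs a_def by simp
  from sin_lower_bound[OF this a] show "sin a / pi * (pi / (2 * T)) * \<bar>s - t\<bar> \<le> \<bar>sin (pi * ((t - s) / (2 * T)))\<bar>"
    unfolding abs by (simp only: mult.assoc)
qed

text \<open>A nonzero constant \<open>g t\<close> is not integrable on the line, so the difference
  is cut off to the period before it is fed to the kernel estimate. For \<open>h < T - t\<close> the
  averages do not notice the cut.\<close>

lemma average_restrict:
  fixes g :: "real \<Rightarrow> real"
  assumes t: "0 < t" "t < T"
    and leb: "((\<lambda>h. (LINT s:{t-h..t+h}|lebesgue. \<bar>g s - g t\<bar>) / h) \<longlongrightarrow> 0) (at_right 0)"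
  shows "((\<lambda>h. (LINT s:{t-h..t+h}|lebesgue. \<bar>indicator {-T..<T} s * (g s - g t)\<bar>) / h) \<longlongrightarrow> 0) (at_right 0)"
proof (rule Lim_transform_eventually[OF leb])
  have "\<forall>\<^sub>F h in at_right 0. 0 < h \<and> h < T - t"
    using eventually_at_right_real[of 0 "T - t"] t by (auto elim: eventually_mono)
  then show "\<forall>\<^sub>F h in at_right 0. (LINT s:{t-h..t+h}|lebesgue. \<bar>g s - g t\<bar>) / h =
     (LINT s:{t-h..t+h}|lebesgue. \<bar>indicator {-T..<T} s * (g s - g t)\<bar>) / h"
  proof eventually_elim
    case (elim h)
    then have "(LINT s:{t-h..t+h}|lebesgue. \<bar>g s - g t\<bar>) =
       (LINT s:{t-h..t+h}|lebesgue. \<bar>indicator {-T..<T} s * (g s - g t)\<bar>)"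
      unfolding set_lebesgue_integral_def using t
      by (intro Bochner_Integration.integral_cong refl) (auto simp: indicator_def)
    then show ?case by simp
  qed
qed

text \<open>On the period, \<open>g\<close> is the constant \<open>g t\<close> plus a part whose
  averages of absolute values at \<open>t\<close> vanish. The kernel estimate kills the second part,
  and the first contributes the mass \<open>M\<close>.\<close>

lemma approximate_kernel_tendsto:
  fixes g :: "real \<Rightarrow> real"
  assumes t: "0 < t" "t < T" and g: "integrable lebesgue g" "\<And>s. s \<notin> {-T..<T} \<Longrightarrow> g s = 0"
    and leb: "((\<lambda>h. (LINT s:{t-h..t+h}|lebesgue. \<bar>g s - g t\<bar>) / h) \<longlongrightarrow> 0) (at_right 0)"
    and K: "\<And>w. 0 < w \<Longrightarrow> K w \<in> borel_measurable borel"
    and near: "\<And>w s. 0 < w \<Longrightarrow> s \<in> {-T..<T} \<Longrightarrow> \<bar>K w s\<bar> \<le> C / w"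
    and far: "\<And>w s. 0 < w \<Longrightarrow> s \<in> {-T..<T} \<Longrightarrow> \<bar>K w s\<bar> * (s - t)\<^sup>2 \<le> C * w"
    and C: "C \<ge> 0"
    and mass: "((\<lambda>w. LINT s|lebesgue. indicator {-T..<T} s * K w s) \<longlongrightarrow> M) (at_right 0)"
  shows "((\<lambda>w. LINT s|lebesgue. g s * K w s) \<longlongrightarrow> g t * M) (at_right 0)"
proof -
  have ind: "integrable lebesgue (\<lambda>s. indicator {-T..<T} s :: real)"
    using t by (intro integrable_real_indicator) auto
  have eq: "indicator {-T..<T} s * (g s - g t) = g s - g t * indicator {-T..<T} s" for s
    using g(2)[of s] by (auto simp: indicator_def)
  have e: "integrable lebesgue (\<lambda>s. indicator {-T..<T} s * (g s - g t))"
    unfolding eq by (intro Bochner_Integration.integrable_diff g integrable_mult_right ind)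
  have nz: "s \<in> {-T..<T}" if "indicator {-T..<T} s * (g s - g t) \<noteq> 0" for s
    using that by (auto simp: indicator_def split: if_splits)
  have "((\<lambda>w. LINT s|lebesgue. indicator {-T..<T} s * (g s - g t) * K w s) \<longlongrightarrow> 0) (at_right 0)"
    by (rule approximate_kernel_tendsto_0[OF e average_restrict[OF t leb] K near far C]) (use nz in blast)+
  from tendsto_add[OF this tendsto_mult[OF tendsto_const[of "g t"] mass]]
  have "((\<lambda>w. (LINT s|lebesgue. indicator {-T..<T} s * (g s - g t) * K w s) + g t * (LINT s|lebesgue. indicator {-T..<T} s * K w s)) \<longlongrightarrow> g t * M) (at_right 0)"
    by simp
  moreover have "(LINT s|lebesgue. indicator {-T..<T} s * (g s - g t) * K w s) + g t * (LINT s|lebesgue. indicator {-T..<T} s * K w s)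
      = (LINT s|lebesgue. g s * K w s)" if w: "w > 0" for w
  proof -
    have i1: "integrable lebesgue (\<lambda>s. indicator {-T..<T} s * K w s)"
      by (rule integrable_mult_bounded[OF ind K[OF w], of "C / w"]) (use near[OF w] in \<open>auto simp: indicator_def split: if_splits\<close>)
    have i2: "integrable lebesgue (\<lambda>s. g s * K w s)"
      by (rule integrable_mult_bounded[OF g(1) K[OF w], of "C / w"]) (use near[OF w] g(2) in blast)
    show ?thesis
      unfolding eq left_diff_distrib mult.assoc using i1 i2 by simp
  qed
  then have "\<forall>\<^sub>F w in at_right 0. (LINT s|lebesgue. indicator {-T..<T} s * (g s - g t) * K w s) + g t * (LINT s|lebesgue. indicator {-T..<T} s * K w s)
      = (LINT s|lebesgue. g s * K w s)"
    using eventually_at_right_less[of "0::real"] by (auto elim: eventually_mono)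
  ultimately show ?thesis by (rule Lim_transform_eventually)
qed

text \<open>Up to a constant factor the kernel is the derivative of
  \<open>arctan (sin \<theta> / w)\<close>. Since \<open>poisson\<close> changes sign under a shift
  of the angle by \<open>pi\<close>, it is not positive and its integral depends on \<open>t\<close>
  and \<open>w\<close>; only the limit is \<open>T\<close>, with one half from each end of the
  period.\<close>

lemma poisson_mass:
  assumes t: "0 < t" "t < T"
  shows "((\<lambda>w. LINT s|lebesgue. indicator {-T..<T} s * poisson w (pi * ((t - s) / (2 * T)))) \<longlongrightarrow> T) (at_right 0)"
proof -
  define F where "F w s = - (T / pi) * arctan (sin (pi * ((t - s) / (2 * T))) / w)" for w s
  have "(LINT s|lebesgue. indicator {-T..<T} s * poisson w (pi * ((t - s) / (2 * T)))) = F w T - F w (-T)" if w: "w > 0" for w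
  proof -
    have "0 < 2 * w\<^sup>2 + 2 * (sin x)\<^sup>2" for x using w by (intro add_pos_nonneg) auto
    then have nz: "2 * w\<^sup>2 + 2 * (sin x)\<^sup>2 \<noteq> 0" for x by (metis less_irrefl)
    have "(LINT s|lebesgue. indicator {-T..<T} s * poisson w (pi * ((t - s) / (2 * T))))
       = (LINT s|lebesgue. poisson w (pi * ((t - s) / (2 * T))) * indicator {-T..T} s)"
    proof (rule integral_cong_AE)
      show "AE s in lebesgue. indicator {-T..<T} s * poisson w (pi * ((t - s) / (2 * T))) = poisson w (pi * ((t - s) / (2 * T))) * indicator {-T..T} s"
        by (rule AE_I'[where N="{T}"]) (auto simp: indicator_def simp flip: negligible_iff_null_sets)
    qed (auto intro!: borel_measurable_lebesgueI simp: poisson_def)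
    also have "\<dots> = (LINT s|lborel. poisson w (pi * ((t - s) / (2 * T))) * indicator {-T..T} s)"
      by (rule integral_completion) (auto simp: poisson_def)
    also have "\<dots> = F w T - F w (-T)"
    proof (rule integral_FTC_Icc_real)
      show "-T \<le> T" using t by simp
      fix s
      define y where "y = pi * ((t - s) / (2 * T))"
      have "DERIV (F w) s :> - (T / pi) * (inverse (1 + (sin y / w)\<^sup>2) * ((cos y * (pi * (- 1 / (2 * T)))) / w))"
        unfolding F_def y_def using w t by (auto intro!: derivative_eq_intros)
      moreover have "- (T / pi) * (inverse (1 + (sin y / w)\<^sup>2) * ((cos y * (pi * (- 1 / (2 * T)))) / w)) = poisson w y"
      proof -
        have "inverse (1 + (sin y / w)\<^sup>2) = w\<^sup>2 / (w\<^sup>2 + (sin y)\<^sup>2)"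
          using w by (simp add: power_divide field_simps)
        moreover have "- (T / pi) * (Y * ((cos y * (pi * (- 1 / (2 * T)))) / w)) = Y * cos y / (2 * w)" for Y
          using w t by simp
        ultimately show ?thesis using w t by (simp add: poisson_def power2_eq_square)
      qed
      ultimately show "DERIV (F w) s :> poisson w (pi * ((t - s) / (2 * T)))" by (simp add: y_def)
      show "isCont (\<lambda>s. poisson w (pi * ((t - s) / (2 * T)))) s"
        unfolding poisson_def using nz t by (intro continuous_intros) auto
    qed
    finally show ?thesis .
  qed
  then have ev: "\<forall>\<^sub>F w in at_right 0. F w T - F w (-T) = (LINT s|lebesgue. indicator {-T..<T} s * poisson w (pi * ((t - s) / (2 * T))))"
    using eventually_at_right_less[of "0::real"] by (auto elim: eventually_mono)
  have inv: "filterlim (\<lambda>w. c / w) at_top (at_right 0)" if "c > 0" for c :: real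
    unfolding divide_inverse by (intro filterlim_tendsto_pos_mult_at_top[OF tendsto_const that] filterlim_inverse_at_top_right)
  have sin_pos: "sin (pi * x) > 0" if "0 < x" "x < 1" for x
    using that mult_strict_left_mono[of x 1 pi] by (intro sin_gt_zero mult_pos_pos) auto
  have "0 < (t + T) / (2 * T)" "(t + T) / (2 * T) < 1" using t by (simp_all add: field_simps)
  then have s1: "sin (pi * ((t + T) / (2 * T))) > 0" by (rule sin_pos)
  have "0 < (T - t) / (2 * T)" "(T - t) / (2 * T) < 1" using t by (simp_all add: field_simps)
  then have s2: "sin (pi * ((T - t) / (2 * T))) > 0" by (rule sin_pos)
  have lim: "((\<lambda>w. arctan (c / w)) \<longlongrightarrow> pi / 2) (at_right 0)" if "c > 0" for c
    by (rule filterlim_compose[OF tendsto_arctan_at_top inv[OF that]])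
  have "((\<lambda>w. (T / pi) * arctan (sin (pi * ((T - t) / (2 * T))) / w) + (T / pi) * arctan (sin (pi * ((t + T) / (2 * T))) / w)) \<longlongrightarrow> (T / pi) * (pi / 2) + (T / pi) * (pi / 2)) (at_right 0)"
    by (intro tendsto_intros lim s1 s2)
  moreover have "F w T - F w (-T) = (T / pi) * arctan (sin (pi * ((T - t) / (2 * T))) / w) + (T / pi) * arctan (sin (pi * ((t + T) / (2 * T))) / w)" for w
  proof -
    have "pi * ((t - T) / (2 * T)) = - (pi * ((T - t) / (2 * T)))"
      by (metis minus_diff_eq minus_divide_left mult_minus_right)
    then have "F w T = (T / pi) * arctan (sin (pi * ((T - t) / (2 * T))) / w)"
      by (simp only: F_def sin_minus minus_divide_left[symmetric] arctan_minus mult_minus_left mult_minus_right minus_minus)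
    then show ?thesis by (simp add: F_def)
  qed
  ultimately have "((\<lambda>w. F w T - F w (-T)) \<longlongrightarrow> T) (at_right 0)" by simp
  from Lim_transform_eventually[OF this ev] show ?thesis .
qed

lemma poisson_integral_tendsto:
  fixes g :: "real \<Rightarrow> real"
  assumes t: "0 < t" "t < T" and g: "integrable lebesgue g" "\<And>s. s \<notin> {-T..<T} \<Longrightarrow> g s = 0"
    and leb: "((\<lambda>h. (LINT s:{t-h..t+h}|lebesgue. \<bar>g s - g t\<bar>) / h) \<longlongrightarrow> 0) (at_right 0)"
  shows "((\<lambda>w. LINT s|lebesgue. g s * poisson w (pi * ((t - s) / (2 * T)))) \<longlongrightarrow> g t * T) (at_right 0)"
proof -
  obtain c where c: "c > 0" "\<And>s. s \<in> {-T..<T} \<Longrightarrow> c * \<bar>s - t\<bar> \<le> \<bar>sin (pi * ((t - s) / (2 * T)))\<bar>"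
    using sin_angle_lower_bound[OF t] by blast
  show ?thesis
  \<comment> \<open>The near bound needs the constant 1, the far bound \<open>1 / c\<^sup>2\<close>
    for the passage from the sine to \<open>s - t\<close>.\<close>
  proof (rule approximate_kernel_tendsto[where K="\<lambda>w s. poisson w (pi * ((t - s) / (2 * T)))" and C="max 1 (1 / c\<^sup>2)", OF t g leb])
    show "(\<lambda>s. poisson w (pi * ((t - s) / (2 * T)))) \<in> borel_measurable borel" for w
      unfolding poisson_def by measurable
    show "\<bar>poisson w (pi * ((t - s) / (2 * T)))\<bar> \<le> max 1 (1 / c\<^sup>2) / w" if "w > 0" for w s
      by (rule order_trans[OF poisson_near[OF that] divide_right_mono]) (use that in auto)
    show "\<bar>poisson w (pi * ((t - s) / (2 * T)))\<bar> * (s - t)\<^sup>2 \<le> max 1 (1 / c\<^sup>2) * w" if w: "w > 0" and s: "s \<in> {-T..<T}" for w s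
    proof -
      define \<sigma> where "\<sigma> = sin (pi * ((t - s) / (2 * T)))"
      have "(c * \<bar>s - t\<bar>)\<^sup>2 \<le> \<bar>\<sigma>\<bar>\<^sup>2" unfolding \<sigma>_def using c by (intro power_mono c(2) s) auto
      then have "(s - t)\<^sup>2 \<le> 1 / c\<^sup>2 * \<sigma>\<^sup>2" using c(1) by (simp add: power_mult_distrib field_simps)
      then have "\<bar>poisson w (pi * ((t - s) / (2 * T)))\<bar> * (s - t)\<^sup>2 \<le> \<bar>poisson w (pi * ((t - s) / (2 * T)))\<bar> * (1 / c\<^sup>2 * \<sigma>\<^sup>2)"
        by (intro mult_left_mono) auto
      also have "\<dots> = 1 / c\<^sup>2 * (\<bar>poisson w (pi * ((t - s) / (2 * T)))\<bar> * \<sigma>\<^sup>2)" by simp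
      also have "\<dots> \<le> 1 / c\<^sup>2 * w" unfolding \<sigma>_def by (intro mult_left_mono poisson_far w) auto
      also have "\<dots> \<le> max 1 (1 / c\<^sup>2) * w" using w by (intro mult_right_mono) auto
      finally show ?thesis .
    qed
  qed (use poisson_mass[OF t] in auto)
qed

lemma integral_odd_about:
  fixes h :: "real \<Rightarrow> real"
  assumes "\<And>s. h (2 * t - s) = - h s"
  shows "(LINT s|lebesgue. h s) = 0"
  using lebesgue_integral_real_affine[of "-1" h "2 * t"] assms by simp

lemma conj_poisson_integral_tendsto:
  fixes g :: "real \<Rightarrow> real"
  assumes t: "0 < t" "t < T" and g: "integrable lebesgue g" "\<And>s. s \<notin> {-T..<T} \<Longrightarrow> g s = 0"
    and leb: "((\<lambda>h. (LINT s:{t-h..t+h}|lebesgue. \<bar>g s - g t\<bar>) / h) \<longlongrightarrow> 0) (at_right 0)"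
  shows "((\<lambda>w. (LINT s|lebesgue. g s * conj_poisson w (pi * ((t - s) / (2 * T))))
      - (LINT s|lebesgue. g s * (if w < \<bar>t - s\<bar> then 1 / (2 * sin (pi * ((t - s) / (2 * T)))) else 0))) \<longlongrightarrow> 0) (at_right 0)"
proof -
  define \<theta> where "\<theta> s = pi * ((t - s) / (2 * T))" for s
  define J where "J w s = conj_poisson w (\<theta> s) - (if w < \<bar>t - s\<bar> then 1 / (2 * sin (\<theta> s)) else 0)" for w s
  \<comment> \<open>The estimate of \<open>conj_poisson\<close> near \<open>t\<close> requires
    \<open>w \<le> 1\<close>, whereas the approximate identity asks for bounds at every positive
    \<open>w\<close>. Setting the kernel to 0 for larger \<open>w\<close> does not affect the
    limit.\<close>
  define K where "K w s = (if w \<le> 1 then J w s else 0)" for w s :: real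
  obtain c where c: "c > 0" "\<And>s. s \<in> {-T..<T} \<Longrightarrow> c * \<bar>s - t\<bar> \<le> \<bar>sin (\<theta> s)\<bar>"
    unfolding \<theta>_def using sin_angle_lower_bound[OF t] by blast
  define B where "B = pi / (2 * T)"
  define D where "D = (1 + 1 / c) / c\<^sup>2"
  have B: "B > 0" and D: "D > 0" using t c by (simp_all add: B_def D_def add_pos_pos)
  have upper: "\<bar>sin (\<theta> s)\<bar> \<le> B * \<bar>s - t\<bar>" for s
  proof -
    have "\<bar>sin (\<theta> s)\<bar> \<le> \<bar>\<theta> s\<bar>" by (rule abs_sin_x_le_abs_x)
    also have "\<dots> = B * \<bar>s - t\<bar>" using t by (simp add: \<theta>_def B_def abs_mult abs_minus_commute)
    finally show ?thesis .
  qed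
  have near1: "\<bar>J w s\<bar> \<le> B / w" if "0 < w" "w \<le> 1" "\<bar>t - s\<bar> \<le> w" for w s
  proof -
    have "B * \<bar>s - t\<bar> \<le> B * w" using that B by (intro mult_left_mono) auto
    then have "\<bar>sin (\<theta> s)\<bar> \<le> B * w" using upper[of s] by linarith
    from conj_poisson_near[OF that(1,2) this] show ?thesis using that by (simp add: J_def)
  qed
  have far1: "\<bar>J w s\<bar> * (s - t)\<^sup>2 \<le> D * w" if w: "0 < w" "w \<le> 1" and ws: "w < \<bar>t - s\<bar>" and s: "s \<in> {-T..<T}" for w s
  proof -
    have "c * w \<le> c * \<bar>s - t\<bar>" using ws c by (intro mult_left_mono) auto
    then have "c * w \<le> \<bar>sin (\<theta> s)\<bar>" using c(2)[OF s] by linarith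
    from conj_poisson_far[OF w(1) this c(1)] have J: "\<bar>J w s\<bar> * (sin (\<theta> s))\<^sup>2 \<le> (1 + 1 / c) * w"
      using ws by (simp add: J_def)
    have "(c * \<bar>s - t\<bar>)\<^sup>2 \<le> \<bar>sin (\<theta> s)\<bar>\<^sup>2" using c by (intro power_mono c(2) s) auto
    then have "(s - t)\<^sup>2 \<le> 1 / c\<^sup>2 * (sin (\<theta> s))\<^sup>2" using c(1) by (simp add: power_mult_distrib field_simps)
    then have "\<bar>J w s\<bar> * (s - t)\<^sup>2 \<le> \<bar>J w s\<bar> * (1 / c\<^sup>2 * (sin (\<theta> s))\<^sup>2)" by (intro mult_left_mono) auto
    also have "\<dots> = 1 / c\<^sup>2 * (\<bar>J w s\<bar> * (sin (\<theta> s))\<^sup>2)" by simp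
    also have "\<dots> \<le> 1 / c\<^sup>2 * ((1 + 1 / c) * w)" by (intro mult_left_mono J) auto
    finally show ?thesis by (simp add: D_def)
  qed
  have near: "\<bar>K w s\<bar> \<le> (B + D) / w" if w: "0 < w" and s: "s \<in> {-T..<T}" for w s
  proof (cases "w \<le> 1")
    case w1: True
    show ?thesis
    proof (cases "\<bar>t - s\<bar> \<le> w")
      case True
      have "B / w \<le> (B + D) / w" using w D by (intro divide_right_mono) auto
      then show ?thesis using near1[OF w w1 True] w1 by (simp add: K_def)
    next
      case False
      have "w\<^sup>2 \<le> \<bar>s - t\<bar>\<^sup>2" using False w by (intro power_mono) auto
      then have "\<bar>J w s\<bar> * w\<^sup>2 \<le> \<bar>J w s\<bar> * (s - t)\<^sup>2" by (intro mult_left_mono) auto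
      also have "\<dots> \<le> D * w" using far1[OF w w1 _ s] False by simp
      finally have "\<bar>J w s\<bar> * w \<le> D" using w by (simp add: power2_eq_square)
      also have "D \<le> B + D" using B by simp
      finally show ?thesis using w w1 by (simp add: K_def field_simps)
    qed
  qed (use w B D in \<open>simp add: K_def\<close>)
  have far: "\<bar>K w s\<bar> * (s - t)\<^sup>2 \<le> (B + D) * w" if w: "0 < w" and s: "s \<in> {-T..<T}" for w s
  proof (cases "w \<le> 1")
    case w1: True
    show ?thesis
    proof (cases "\<bar>t - s\<bar> \<le> w")
      case True
      have "\<bar>s - t\<bar>\<^sup>2 \<le> w\<^sup>2" using True by (intro power_mono) auto
      then have "\<bar>J w s\<bar> * (s - t)\<^sup>2 \<le> B / w * w\<^sup>2" using near1[OF w w1 True] w B by (intro mult_mono) auto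
      also have "\<dots> = B * w" using w by (simp add: power2_eq_square)
      also have "\<dots> \<le> (B + D) * w" using w D by (intro mult_right_mono) auto
      finally show ?thesis using w1 by (simp add: K_def)
    next
      case False
      have "D * w \<le> (B + D) * w" using w B by (intro mult_right_mono) auto
      then show ?thesis using far1[OF w w1 _ s] False w1 by (simp add: K_def)
    qed
  qed (use w B D in \<open>simp add: K_def\<close>)
  have J_meas: "J w \<in> borel_measurable borel" for w
    unfolding J_def \<theta>_def conj_poisson_def by measurable
  then have meas: "K w \<in> borel_measurable borel" for w
    unfolding K_def by (cases "w \<le> 1") simp_all
  have odd: "K w (2 * t - s) = - K w s" for w s
  proof -
    have "\<theta> (2 * t - s) = - \<theta> s" using t by (simp add: \<theta>_def field_simps)
    then show ?thesis by (simp add: K_def J_def conj_poisson_def abs_minus_commute)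
  qed
  have "((\<lambda>w. LINT s|lebesgue. indicator {-T..<T} s * K w s) \<longlongrightarrow> 0) (at_right 0)"
  proof (rule Lim_null_comparison)
    define E where "E = (B + D) / (T - t)\<^sup>2"
    show "((\<lambda>w. 2 * T * (E * w)) \<longlongrightarrow> 0) (at_right 0)" by (auto intro!: tendsto_eq_intros)
    have "norm (LINT s|lebesgue. indicator {-T..<T} s * K w s) \<le> 2 * T * (E * w)" if w: "w > 0" for w
    proof -
      \<comment> \<open>The interval of radius \<open>T - t\<close> about \<open>t\<close> fits into
        the period, and there the odd kernel integrates to 0. On the rest of the period
        \<open>\<bar>s - t\<bar>\<close> is at least \<open>T - t\<close>, so the far bound makes
        the kernel \<open>O(w)\<close>.\<close>
      define I where "I s = (if \<bar>s - t\<bar> < T - t then K w s else 0)" for s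
      have "(LINT s|lebesgue. I s) = 0"
        by (rule integral_odd_about[where t=t]) (simp add: I_def odd abs_minus_commute)
      have ind: "integrable lebesgue (\<lambda>s. indicator {-T..<T} s :: real)"
        using t by (intro integrable_real_indicator) auto
      have iK: "integrable lebesgue (\<lambda>s. indicator {-T..<T} s * K w s)"
        by (rule integrable_mult_bounded[OF ind meas[of w], where C="(B + D) / w"]) (use near[OF w] in \<open>auto simp: indicator_def split: if_splits\<close>)
      have "(\<lambda>s. if \<bar>s - t\<bar> < T - t then K w s else 0) \<in> borel_measurable borel" using meas by measurable
      then have "integrable lebesgue (\<lambda>s. indicator {-T..<T} s * I s)"
        unfolding I_def by (rule integrable_mult_bounded[OF ind, of _ "(B + D) / w"]) (use near[OF w] B D w in \<open>auto simp: indicator_def split: if_splits\<close>)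
      moreover have Ieq: "indicator {-T..<T} s * I s = I s" for s
        using t by (auto simp: indicator_def I_def)
      ultimately have iI: "integrable lebesgue I" by simp
      have "(LINT s|lebesgue. indicator {-T..<T} s * K w s) = (LINT s|lebesgue. indicator {-T..<T} s * K w s - I s)"
        using iK iI \<open>(LINT s|lebesgue. I s) = 0\<close> by simp
      also have "norm \<dots> \<le> (LINT s|lebesgue. indicator {-T..<T} s * (E * w))"
      proof (rule Bochner_Integration.integral_norm_bound_integral)
        show "integrable lebesgue (\<lambda>s. indicator {-T..<T} s * K w s - I s)" using iK iI by simp
        show "integrable lebesgue (\<lambda>s. indicator {-T..<T} s * (E * w))" using ind by simp
        fix s
        show "norm (indicator {-T..<T} s * K w s - I s) \<le> indicator {-T..<T} s * (E * w)"
        proof (cases "s \<in> {-T..<T} \<and> \<not> \<bar>s - t\<bar> < T - t")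
          case True
          then have "(T - t)\<^sup>2 \<le> \<bar>s - t\<bar>\<^sup>2" using t by (intro power_mono) auto
          then have "\<bar>K w s\<bar> * (T - t)\<^sup>2 \<le> \<bar>K w s\<bar> * (s - t)\<^sup>2" by (intro mult_left_mono) auto
          also have "\<dots> \<le> (B + D) * w" using far[OF w] True by blast
          finally have "\<bar>K w s\<bar> \<le> E * w" using t by (simp add: E_def field_simps)
          then show ?thesis using True by (simp add: I_def)
        next
          case False
          have "0 \<le> E * w" using w B D by (simp add: E_def)
          then show ?thesis using False t by (auto simp: I_def indicator_def)
        qed
      qed
      also have "\<dots> = 2 * T * (E * w)" using t by simp
      finally show ?thesis .
    qed
    then show "\<forall>\<^sub>F w in at_right 0. norm (LINT s|lebesgue. indicator {-T..<T} s * K w s) \<le> 2 * T * (E * w)"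
      using eventually_at_right_less[of "0::real"] by (auto elim: eventually_mono)
  qed
  from approximate_kernel_tendsto[where K=K, OF t g leb meas near far _ this]
  have "((\<lambda>w. LINT s|lebesgue. g s * K w s) \<longlongrightarrow> 0) (at_right 0)"
    using B D by simp
  moreover have "\<forall>\<^sub>F w in at_right 0. (LINT s|lebesgue. g s * K w s) =
     (LINT s|lebesgue. g s * conj_poisson w (\<theta> s)) - (LINT s|lebesgue. g s * (if w < \<bar>t - s\<bar> then 1 / (2 * sin (\<theta> s)) else 0))"
  proof -
    have "\<forall>\<^sub>F w in at_right 0. 0 < w \<and> w < (1::real)"
      using eventually_at_right_real[of 0 "1::real"] by (auto elim: eventually_mono)
    then show ?thesis
    proof eventually_elim
      case (elim w)
      have gs: "s \<in> {-T..<T}" if "g s \<noteq> 0" for s using g(2) that by blast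
      have i1: "integrable lebesgue (\<lambda>s. g s * K w s)"
        by (rule integrable_mult_bounded[OF g(1) meas[of w], where C="(B + D) / w"]) (use near elim gs in blast)
      have i2: "integrable lebesgue (\<lambda>s. g s * (if w < \<bar>t - s\<bar> then 1 / (2 * sin (\<theta> s)) else 0))"
      proof (rule integrable_mult_bounded[OF g(1)])
        show "(\<lambda>s. if w < \<bar>t - s\<bar> then 1 / (2 * sin (\<theta> s)) else 0) \<in> borel_measurable borel"
          unfolding \<theta>_def by measurable
        fix s assume "g s \<noteq> 0"
        show "\<bar>if w < \<bar>t - s\<bar> then 1 / (2 * sin (\<theta> s)) else 0\<bar> \<le> 1 / (2 * (c * w))"
        proof (cases "w < \<bar>t - s\<bar>")
          case True
          have "c * w \<le> c * \<bar>s - t\<bar>" using True c by (intro mult_left_mono) auto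
          then have "c * w \<le> \<bar>sin (\<theta> s)\<bar>" using c(2)[OF gs[OF \<open>g s \<noteq> 0\<close>]] by linarith
          moreover have "0 < c * w" using c elim by simp
          ultimately have "1 / (2 * \<bar>sin (\<theta> s)\<bar>) \<le> 1 / (2 * (c * w))" by (intro divide_left_mono) auto
          then show ?thesis using True by (simp add: abs_mult)
        qed (use c elim in simp)
      qed
      have "g s * conj_poisson w (\<theta> s) = g s * K w s + g s * (if w < \<bar>t - s\<bar> then 1 / (2 * sin (\<theta> s)) else 0)" for s
        using elim by (simp add: K_def J_def algebra_simps)
      then show ?case using i1 i2 by simp
    qed
  qed
  ultimately show ?thesis unfolding \<theta>_def by (rule Lim_transform_eventually)
qed

subsection \<open>Partial fractions of the cosecant\<close>

lemma sin_pi_nonzero: "z \<notin> \<int> \<Longrightarrow> sin (pi * z) \<noteq> 0" for z :: real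
proof
  assume z: "z \<notin> \<int>" and "sin (pi * z) = 0"
  then obtain n where "pi * z = of_int n * pi" unfolding sin_zero_iff_int2 by blast
  then have "z = of_int n" by simp
  then show False using z by simp
qed

text \<open>Logarithmic differentiation of the reflection formula for \<open>Gamma\<close> gives
  \<open>Digamma (1 - z) - Digamma z = pi * cot (pi * z)\<close>. In the difference of the limit
  formulas for \<open>Digamma\<close> the logarithms cancel and the partial fractions
  remain.\<close>

lemma cot_partial_fractions:
  fixes z :: real
  assumes z: "z \<notin> \<int>"
  shows "(\<lambda>m. \<Sum>n<m. 1 / (z + real n) + 1 / (z - 1 - real n)) \<longlonglongrightarrow> pi * cot (pi * z)"
proof -
  have z': "1 - z \<notin> \<int>" using z by (metis Ints_1 Ints_diff diff_diff_eq2 add_diff_cancel_left')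
  have nn: "z \<notin> \<int>\<^sub>\<le>\<^sub>0" "1 - z \<notin> \<int>\<^sub>\<le>\<^sub>0" using z z' nonpos_Ints_subset_Ints by auto
  have s0: "sin (pi * z) \<noteq> 0"
    using sin_pi_nonzero[OF z] .
  \<comment> \<open>This holds at integers too, where both sides are 0 by the default values of
    \<open>Gamma\<close> and of division. It can therefore replace the product as a function before
    differentiating.\<close>
  have refl: "Gamma x * Gamma (1 - x) = pi / sin (pi * x)" for x :: real
  proof -
    have e1: "1 - complex_of_real x = of_real (1 - x)" by simp
    have e2: "of_real pi * of_real x = complex_of_real (pi * x)" by simp
    have "of_real (Gamma x) * of_real (Gamma (1 - x)) = complex_of_real pi / of_real (sin (pi * x))"
      using Gamma_reflection_complex[of "of_real x"] unfolding e1 e2 sin_of_real Gamma_complex_of_real .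
    then show ?thesis by (metis of_real_mult of_real_divide of_real_eq_iff)
  qed
  have "((\<lambda>x. Gamma x * Gamma (1 - x)) has_real_derivative
      (Gamma z * Digamma z) * Gamma (1 - z) + (Gamma (1 - z) * Digamma (1 - z) * (-1)) * Gamma z) (at z)"
    by (rule DERIV_mult) (use nn in \<open>auto intro!: derivative_eq_intros\<close>)
  moreover have "((\<lambda>x. Gamma x * Gamma (1 - x)) has_real_derivative
      - (pi * (cos (pi * z) * pi)) / (sin (pi * z) * sin (pi * z))) (at z)"
    unfolding refl using s0 by (auto intro!: derivative_eq_intros)
  ultimately have "(Gamma z * Digamma z) * Gamma (1 - z) + (Gamma (1 - z) * Digamma (1 - z) * (-1)) * Gamma z
      = - (pi * (cos (pi * z) * pi)) / (sin (pi * z) * sin (pi * z))"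
    by (rule DERIV_unique)
  then have "(Gamma z * Gamma (1 - z)) * (Digamma (1 - z) - Digamma z) = (pi * (cos (pi * z) * pi)) / (sin (pi * z) * sin (pi * z))"
    by (simp add: algebra_simps)
  then have D: "Digamma (1 - z) - Digamma z = pi * cot (pi * z)"
  proof -
    assume *: "Gamma z * Gamma (1 - z) * (Digamma (1 - z) - Digamma z) = pi * (cos (pi * z) * pi) / (sin (pi * z) * sin (pi * z))"
    have "Digamma (1 - z) - Digamma z = sin (pi * z) / pi * (pi / sin (pi * z) * (Digamma (1 - z) - Digamma z))"
      using s0 by simp
    also have "\<dots> = sin (pi * z) / pi * (pi * (cos (pi * z) * pi) / (sin (pi * z) * sin (pi * z)))"
      using * unfolding refl by (simp only:)
    also have "\<dots> = pi * cot (pi * z)" using s0 by (simp add: cot_def)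
    finally show ?thesis .
  qed
  have "(\<lambda>m. (ln (real m) - (\<Sum>n<m. inverse ((1 - z) + of_nat n))) - (ln (real m) - (\<Sum>n<m. inverse (z + of_nat n))))
      \<longlonglongrightarrow> Digamma (1 - z) - Digamma z"
  proof (rule tendsto_diff)
    have "1 - z \<noteq> 0" "z \<noteq> 0" using z by auto
    then show "(\<lambda>m. ln (real m) - (\<Sum>n<m. inverse ((1 - z) + of_nat n))) \<longlonglongrightarrow> Digamma (1 - z)"
      "(\<lambda>m. ln (real m) - (\<Sum>n<m. inverse (z + of_nat n))) \<longlonglongrightarrow> Digamma z"
      using Digamma_LIMSEQ[of z] Digamma_LIMSEQ[of "1 - z"] by simp_all
  qed
  moreover have "(ln (real m) - (\<Sum>n<m. inverse ((1 - z) + of_nat n))) - (ln (real m) - (\<Sum>n<m. inverse (z + of_nat n)))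
      = (\<Sum>n<m. 1 / (z + real n) + 1 / (z - 1 - real n))" for m
  proof -
    have "1 / (z - 1 - real n) = - inverse ((1 - z) + of_nat n)" for n
      by (metis add_uminus_conv_diff diff_diff_eq2 inverse_eq_divide inverse_minus_eq minus_diff_eq diff_add_eq_diff_diff_swap add.commute)
    then show ?thesis by (simp add: sum_subtractf inverse_eq_divide)
  qed
  ultimately show ?thesis unfolding D by simp
qed

text \<open>The entries \<open>(-1)^k / (z + k)\<close> for
  \<open>k = 2n, 2n+1, -2n-2, -2n-1\<close>; the first \<open>m\<close> groups cover
  \<open>-2m \<le> k < 2m\<close>. The grouping follows the four translates that enlarge
  \<open>window m\<close> to \<open>window (Suc m)\<close>.\<close>

definition csc_term :: "real \<Rightarrow> nat \<Rightarrow> real" where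
  "csc_term z n = 1 / (z + 2 * real n) - 1 / (z + 2 * real n + 1)
     + 1 / (z - 2 * real n - 2) - 1 / (z - 2 * real n - 1)"

text \<open>From \<open>cot y - cot (2 * y) = 1 / sin (2 * y)\<close>: the cotangent series at
  \<open>z / 2\<close> contains the even poles with weight 2, and subtracting the series at
  \<open>z\<close> leaves alternating signs. Twice as many terms are taken at \<open>z\<close> so
  that the same poles occur on both sides.\<close>

lemma csc_partial_fractions:
  assumes z: "z \<notin> \<int>"
  shows "(\<lambda>m. \<Sum>n<m. csc_term z n) \<longlonglongrightarrow> pi / sin (pi * z)"
proof -
  define c where "c x n = 1 / (x + real n) + 1 / (x - 1 - real n)" for x n
  have z2: "z / 2 \<notin> \<int>"
  proof
    assume "z / 2 \<in> \<int>"
    then have "2 * (z / 2) \<in> \<int>" by (intro Ints_mult) auto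
    then show False using z by simp
  qed
  have s0: "sin (pi * z) \<noteq> 0"
    using sin_pi_nonzero[OF z] .
  have "(\<lambda>m. \<Sum>n<2 * m. c z n) \<longlonglongrightarrow> pi * cot (pi * z)"
    using LIMSEQ_linear[OF cot_partial_fractions[OF z], of 2] by (simp add: c_def mult.commute)
  moreover have "(\<lambda>m. \<Sum>n<m. c (z / 2) n) \<longlonglongrightarrow> pi * cot (pi * (z / 2))"
    using cot_partial_fractions[OF z2] by (simp add: c_def)
  ultimately have "(\<lambda>m. (\<Sum>n<m. c (z / 2) n) - (\<Sum>n<2 * m. c z n)) \<longlonglongrightarrow> pi * cot (pi * (z / 2)) - pi * cot (pi * z)"
    by (intro tendsto_diff)
  moreover have "(\<Sum>n<m. c (z / 2) n) - (\<Sum>n<2 * m. c z n) = (\<Sum>n<m. csc_term z n)" for m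
  proof (induction m)
    case (Suc m)
    have "c (z / 2) m = 2 / (z + 2 * real m) + 2 / (z - 2 * real m - 2)"
    proof -
      have "1 / (z / 2 + real m) = 2 / (z + 2 * real m)"
        by (simp add: divide_simps)
      moreover have "1 / (z / 2 - 1 - real m) = 2 / (z - 2 * real m - 2)"
        by (simp add: divide_simps)
      ultimately show ?thesis by (simp add: c_def)
    qed
    moreover have "c z (2 * m) = 1 / (z + 2 * real m) + 1 / (z - 2 * real m - 1)"
      by (simp add: c_def algebra_simps)
    moreover have "c z (Suc (2 * m)) = 1 / (z + 2 * real m + 1) + 1 / (z - 2 * real m - 2)"
      by (simp add: c_def algebra_simps)
    ultimately have "c (z / 2) m - c z (2 * m) - c z (Suc (2 * m)) = csc_term z m"
      by (simp add: csc_term_def)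
    then show ?case using Suc by simp
  qed simp
  moreover have "pi * cot (pi * (z / 2)) - pi * cot (pi * z) = pi / sin (pi * z)"
  proof -
    define y where "y = pi * (z / 2)"
    have y: "pi * z = 2 * y" by (simp add: y_def)
    have "sin (2 * y) \<noteq> 0" using s0 by (simp add: y)
    then have "sin y \<noteq> 0" "cos y \<noteq> 0" by (auto simp: sin_double)
    then have "cot y - cot (2 * y) = 1 / sin (2 * y)"
      unfolding cot_def sin_double cos_double_cos
      by (simp add: field_simps power2_eq_square)
    then show ?thesis unfolding y y_def[symmetric] by (metis mult.right_neutral right_diff_distrib times_divide_eq_right)
  qed
  ultimately show ?thesis by simp
qed

text \<open>Adjacent reciprocals of opposite sign combine to \<open>1\<close> over a product of size
  at least \<open>n\<^sup>2\<close>. The range of \<open>z\<close> contains all values of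
  \<open>(t - s) / (2 * T)\<close> for \<open>0 < t < T\<close> and \<open>s\<close> in the
  period.\<close>

lemma csc_term_bound:
  assumes z: "- 1 / 2 \<le> z" "z \<le> 1" and n: "n \<ge> 1"
  shows "\<bar>csc_term z n\<bar> \<le> 2 / (real n)\<^sup>2"
proof -
  have n1: "real n \<ge> 1" using n by simp
  then have nn: "real n * real n \<ge> 1" using mult_mono[of 1 "real n" 1 "real n"] by simp
  have p: "z + 2 * real n > 0" "2 * real n + 1 - z > 0" using z n1 by auto
  have "(z + 2 * real n) * (z + 2 * real n + 1) \<ge> (2 * real n - 1/2) * (2 * real n + 1/2)"
    using z n1 by (intro mult_mono) auto
  moreover have "(2 * real n - 1/2) * (2 * real n + 1/2) \<ge> (real n)\<^sup>2"
    using nn by (simp add: algebra_simps power2_eq_square)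
  ultimately have a: "(real n)\<^sup>2 \<le> (z + 2 * real n) * (z + 2 * real n + 1)" by linarith
  have "1 / (z + 2 * real n) - 1 / (z + 2 * real n + 1) = 1 / ((z + 2 * real n) * (z + 2 * real n + 1))"
    using p by (simp add: field_simps)
  then have A: "0 \<le> 1 / (z + 2 * real n) - 1 / (z + 2 * real n + 1)"
    "1 / (z + 2 * real n) - 1 / (z + 2 * real n + 1) \<le> 1 / (real n)\<^sup>2"
    using a p n1 by (auto intro!: divide_left_mono mult_pos_pos)
  have "(2 * real n + 1 - z) * (2 * real n + 2 - z) \<ge> real n * real n"
    using z n1 by (intro mult_mono) auto
  then have b: "(real n)\<^sup>2 \<le> (2 * real n + 1 - z) * (2 * real n + 2 - z)" by (simp add: power2_eq_square)
  have "1 / (z - 2 * real n - 2) = - (1 / (2 * real n + 2 - z))" "1 / (z - 2 * real n - 1) = - (1 / (2 * real n + 1 - z))"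
    by (simp_all add: divide_simps)
  then have "1 / (z - 2 * real n - 2) - 1 / (z - 2 * real n - 1) = 1 / ((2 * real n + 1 - z) * (2 * real n + 2 - z))"
    using p by (simp add: field_simps)
  then have B: "0 \<le> 1 / (z - 2 * real n - 2) - 1 / (z - 2 * real n - 1)"
    "1 / (z - 2 * real n - 2) - 1 / (z - 2 * real n - 1) \<le> 1 / (real n)\<^sup>2"
    using b p n1 by (auto intro!: divide_left_mono mult_pos_pos)
  show ?thesis unfolding csc_term_def using A B by linarith
qed

text \<open>Only \<open>1 / z\<close> and \<open>1 / (z - 1)\<close>, both in group 0, can be large.
  The first is subtracted and \<open>\<delta>\<close> controls the second; the summand 2 pays for
  \<open>1 / (z + 1)\<close>, and the series for all later groups. \<open>Suc k\<close> guarantees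
  that group 0 is present.\<close>

lemma csc_partial_sum_bound:
  assumes z: "- 1 / 2 \<le> z" "z \<le> 1 - \<delta>" and \<delta>: "\<delta> > 0"
  shows "\<bar>(\<Sum>n<Suc k. csc_term z n) - 1 / z\<bar> \<le> 2 + 1 / \<delta> + 2 * (\<Sum>n. 1 / (real (Suc n))\<^sup>2)"
proof -
  have s: "summable (\<lambda>n. 1 / (real (Suc n))\<^sup>2)"
    using inverse_power_summable[of 2, where 'a=real] by (subst summable_Suc_iff) (simp add: inverse_eq_divide)
  have "(\<Sum>n<Suc k. csc_term z n) = csc_term z 0 + (\<Sum>n<k. csc_term z (Suc n))"
    by (rule sum.lessThan_Suc_shift)
  moreover have "\<bar>\<Sum>n<k. csc_term z (Suc n)\<bar> \<le> 2 * (\<Sum>n. 1 / (real (Suc n))\<^sup>2)"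
  proof -
    have "\<bar>csc_term z (Suc n)\<bar> \<le> 2 * (1 / (real (Suc n))\<^sup>2)" for n
      using csc_term_bound[of z "Suc n"] z \<delta> by simp
    then have "\<bar>\<Sum>n<k. csc_term z (Suc n)\<bar> \<le> (\<Sum>n<k. 2 * (1 / (real (Suc n))\<^sup>2))"
      by (intro order_trans[OF sum_abs sum_mono])
    also have "\<dots> \<le> 2 * (\<Sum>n. 1 / (real (Suc n))\<^sup>2)"
      unfolding sum_distrib_left[symmetric] by (intro mult_left_mono sum_le_suminf s) auto
    finally show ?thesis .
  qed
  moreover have "\<bar>csc_term z 0 - 1 / z\<bar> \<le> 2 + 1 / \<delta>"
  proof -
    have "1 / (z - 1) = - (1 / (1 - z))" "1 / (z - 2) = - (1 / (2 - z))"
      by (simp_all add: divide_simps)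
    then have "csc_term z 0 - 1 / z = - (1 / (z + 1)) + (1 / (1 - z) - 1 / (2 - z))"
      by (simp add: csc_term_def)
    moreover have "0 \<le> 1 / (z + 1)" "1 / (z + 1) \<le> 2" using z by (auto simp: field_simps)
    moreover have "0 \<le> 1 / (2 - z)" using z \<delta> by simp
    moreover have "1 / (1 - z) \<le> 1 / \<delta>" using z \<delta> by (intro divide_left_mono) auto
    moreover have "1 / (2 - z) \<le> 1 / (1 - z)" using z \<delta> by (intro divide_left_mono) auto
    ultimately show ?thesis by linarith
  qed
  ultimately show ?thesis by linarith
qed

subsection \<open>The Hilbert transform of an antiperiodic function\<close>

lemma integrable_shift_window:
  fixes f :: "real \<Rightarrow> real"
  assumes "integrable lebesgue (\<lambda>s. indicator {a..<b} s * f (s + c))"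
  shows "integrable lebesgue (\<lambda>s. indicator {a + c..<b + c} s * f s)"
    and "(LINT s|lebesgue. indicator {a + c..<b + c} s * f s) = (LINT s|lebesgue. indicator {a..<b} s * f (s + c))"
proof -
  have eq: "(\<lambda>s. indicator {a + c..<b + c} (c + 1 * s) * f (c + 1 * s)) = (\<lambda>s. indicator {a..<b} s * f (s + c))"
    by (auto simp: indicator_def add.commute fun_eq_iff)
  show "integrable lebesgue (\<lambda>s. indicator {a + c..<b + c} s * f s)"
    using lebesgue_integrable_real_affine_iff[of 1 "\<lambda>s. indicator {a + c..<b + c} s * f s" c] assms
    unfolding eq by simp
  show "(LINT s|lebesgue. indicator {a + c..<b + c} s * f s) = (LINT s|lebesgue. indicator {a..<b} s * f (s + c))"
    using lebesgue_integral_real_affine[of 1 "\<lambda>s. indicator {a + c..<b + c} s * f s" c]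
    unfolding eq by simp
qed

lemma antiperiodic_multiple:
  fixes f :: "real \<Rightarrow> real"
  assumes "\<And>s. f (s + 2 * T) = - f s"
  shows "f (s + 4 * real n * T) = f s" "f (s - 4 * real n * T) = f s"
    "f (s + (4 * real n + 2) * T) = - f s" "f (s - (4 * real n + 2) * T) = - f s"
proof -
  have 4: "f (s + 4 * T) = f s" for s
    using assms[of s] assms[of "s + 2 * T"] by (simp add: add.assoc)
  show *: "f (s + 4 * real n * T) = f s" for s
  proof (induction n)
    case (Suc n)
    then show ?case using 4[of "s + 4 * real n * T"] by (simp add: algebra_simps)
  qed simp
  show **: "f (s - 4 * real n * T) = f s" for s
    using *[of "s - 4 * real n * T"] by simp
  show "f (s + (4 * real n + 2) * T) = - f s"
    using assms[of "s + 4 * real n * T"] * by (simp add: algebra_simps)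
  show "f (s - (4 * real n + 2) * T) = - f s"
    using assms[of "s - 4 * real n * T - 2 * T"] ** by (simp add: algebra_simps)
qed

text \<open>What the line integral needs to know about the reflection. The interval from
  \<open>-T\<close> to \<open>T\<close> is half of the true period \<open>4 * T\<close>; the other
  half is determined by the sign change.\<close>

locale antiperiodic =
  fixes f :: "real \<Rightarrow> real" and T :: real
  assumes T: "T > 0" and anti: "\<And>s. f (s + 2 * T) = - f s"
    and integrable_period: "integrable lebesgue (\<lambda>s. indicator {-T..<T} s * f s)"
begin

text \<open>A union of \<open>4 * m\<close> translates of the half period. Their number is even, so
  that both signs occur equally often; therefore the window is centred at \<open>T\<close> and not
  at 0.\<close>

definition window :: "nat \<Rightarrow> real set" where
  "window m = {- (4 * real m - 1) * T ..< (4 * real m + 1) * T}"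

definition period :: "real \<Rightarrow> real set" where
  "period c = {- T + c ..< T + c}"

lemma window_0 [simp]: "window 0 = {}"
  by (simp add: window_def)

lemma window_Suc:
  "indicator (window (Suc m)) s = (indicator (window m) s :: real)
     + indicator (period (- (4 * real m) * T)) s
     + indicator (period (- (4 * real m + 2) * T)) s
     + indicator (period ((4 * real m + 4) * T)) s
     + indicator (period ((4 * real m + 2) * T)) s"
proof -
  define M where "M = real m * T"
  have M: "0 \<le> M" using T by (simp add: M_def)
  have eqs: "- (4 * real (Suc m) - 1) * T = - 4 * M - 3 * T" "(4 * real (Suc m) + 1) * T = 4 * M + 5 * T"
    "- (4 * real m - 1) * T = - 4 * M + T" "(4 * real m + 1) * T = 4 * M + T"
    "- (4 * real m) * T = - 4 * M" "- (4 * real m + 2) * T = - 4 * M - 2 * T"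
    "(4 * real m + 4) * T = 4 * M + 4 * T" "(4 * real m + 2) * T = 4 * M + 2 * T"
    by (simp_all add: M_def algebra_simps)
  show ?thesis using T M
    unfolding window_def period_def eqs by (auto simp: indicator_def)
qed

lemma window_Suc_mult:
  "indicator (window (Suc m)) s * y = indicator (window m) s * y
     + indicator (period (- (4 * real m) * T)) s * y
     + indicator (period (- (4 * real m + 2) * T)) s * y
     + indicator (period ((4 * real m + 4) * T)) s * y
     + indicator (period ((4 * real m + 2) * T)) s * (y::real)"
proof -
  have "(a + b + c + d + e) * y = a * y + b * y + c * y + d * y + e * y" for a b c d e :: real
    by (simp add: distrib_right)
  then show ?thesis unfolding window_Suc .
qed

lemma period_mult_integrable:
  assumes "k \<in> borel_measurable borel" "\<And>s. \<bar>k s\<bar> \<le> C"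
  shows "integrable lebesgue (\<lambda>s. indicator {-T..<T} s * (f s * k s))"
  using integrable_mult_bounded[OF integrable_period assms(1), of C] assms(2) by (simp add: mult.assoc)

text \<open>Every translate is moved back to the half period from \<open>-T\<close> to
  \<open>T\<close>. Shifts by multiples of \<open>4 * T\<close> leave \<open>f\<close> unchanged and
  the remaining ones reverse its sign; these are the alternating signs of
  \<open>csc_term\<close>.\<close>

lemma window_fold:
  assumes k: "k \<in> borel_measurable borel" and bd: "\<And>s. \<bar>k s\<bar> \<le> C"
  shows "integrable lebesgue (\<lambda>s. indicator (window m) s * (f s * k s))"
    and "(LINT s|lebesgue. indicator (window m) s * (f s * k s)) =
      (LINT s|lebesgue. indicator {-T..<T} s * (f s * (\<Sum>n<m. k (s - 4 * real n * T) - k (s - (4 * real n + 2) * T)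
         + k (s + (4 * real n + 4) * T) - k (s + (4 * real n + 2) * T))))"
proof (induction m)
  case 0
  { case 1 show ?case by simp }
  { case 2 show ?case by simp }
next
  case (Suc m)
  have per: "f (s + - (4 * real m) * T) = f s" "f (s + - (4 * real m + 2) * T) = - f s"
    "f (s + (4 * real m + 4) * T) = f s" "f (s + (4 * real m + 2) * T) = - f s" for s
    using antiperiodic_multiple[of f T, OF anti, of s m] antiperiodic_multiple[of f T, OF anti, of s "Suc m"]
    by (simp_all add: algebra_simps)
  have meas: "(\<lambda>s. k (s + c)) \<in> borel_measurable borel" for c
    using k by measurable
  have int: "integrable lebesgue (\<lambda>s. indicator {-T..<T} s * (f s * k (s + c)))" for c
    by (rule period_mult_integrable[OF meas bd])
  have intm: "integrable lebesgue (\<lambda>s. indicator {-T..<T} s * (- f s * k (s + c)))" for c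
    using int[of c] by simp
  have p1: "integrable lebesgue (\<lambda>s. indicator (period (- (4 * real m) * T)) s * (f s * k s))"
     "(LINT s|lebesgue. indicator (period (- (4 * real m) * T)) s * (f s * k s))
      = (LINT s|lebesgue. indicator {-T..<T} s * (f s * k (s + - (4 * real m) * T)))"
    using integrable_shift_window[where f="\<lambda>s. f s * k s" and a="-T" and b=T and c="- (4 * real m) * T"] int[of "- (4 * real m) * T"]
    unfolding per period_def by blast+
  have p2: "integrable lebesgue (\<lambda>s. indicator (period (- (4 * real m + 2) * T)) s * (f s * k s))"
     "(LINT s|lebesgue. indicator (period (- (4 * real m + 2) * T)) s * (f s * k s))
      = (LINT s|lebesgue. indicator {-T..<T} s * (- f s * k (s + - (4 * real m + 2) * T)))"
    using integrable_shift_window[where f="\<lambda>s. f s * k s" and a="-T" and b=T and c="- (4 * real m + 2) * T"] intm[of "- (4 * real m + 2) * T"]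
    unfolding per period_def by blast+
  have p3: "integrable lebesgue (\<lambda>s. indicator (period ((4 * real m + 4) * T)) s * (f s * k s))"
     "(LINT s|lebesgue. indicator (period ((4 * real m + 4) * T)) s * (f s * k s))
      = (LINT s|lebesgue. indicator {-T..<T} s * (f s * k (s + (4 * real m + 4) * T)))"
    using integrable_shift_window[where f="\<lambda>s. f s * k s" and a="-T" and b=T and c="(4 * real m + 4) * T"] int[of "(4 * real m + 4) * T"]
    unfolding per period_def by blast+
  have p4: "integrable lebesgue (\<lambda>s. indicator (period ((4 * real m + 2) * T)) s * (f s * k s))"
     "(LINT s|lebesgue. indicator (period ((4 * real m + 2) * T)) s * (f s * k s))
      = (LINT s|lebesgue. indicator {-T..<T} s * (- f s * k (s + (4 * real m + 2) * T)))"
    using integrable_shift_window[where f="\<lambda>s. f s * k s" and a="-T" and b=T and c="(4 * real m + 2) * T"] intm[of "(4 * real m + 2) * T"]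
    unfolding per period_def by blast+
  { case 1 show ?case unfolding window_Suc_mult
      by (intro Bochner_Integration.integrable_add Suc.IH(1) p1(1) p2(1) p3(1) p4(1)) }
  { case 2
    have sumint: "integrable lebesgue (\<lambda>s. indicator {-T..<T} s * (f s * (\<Sum>n<m. k (s - 4 * real n * T) - k (s - (4 * real n + 2) * T)
         + k (s + (4 * real n + 4) * T) - k (s + (4 * real n + 2) * T))))"
    proof -
      have "integrable lebesgue (\<lambda>s. (\<Sum>n<m. indicator {-T..<T} s * (f s * k (s + - (4 * real n * T)))
         + indicator {-T..<T} s * (- f s * k (s + - ((4 * real n + 2) * T)))
         + indicator {-T..<T} s * (f s * k (s + (4 * real n + 4) * T)) 
         + indicator {-T..<T} s * (- f s * k (s + (4 * real n + 2) * T))))"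
        by (intro Bochner_Integration.integrable_sum Bochner_Integration.integrable_add int intm)
      also have "(\<lambda>s. (\<Sum>n<m. indicator {-T..<T} s * (f s * k (s + - (4 * real n * T)))
         + indicator {-T..<T} s * (- f s * k (s + - ((4 * real n + 2) * T)))
         + indicator {-T..<T} s * (f s * k (s + (4 * real n + 4) * T)) 
         + indicator {-T..<T} s * (- f s * k (s + (4 * real n + 2) * T)))) = 
        (\<lambda>s. indicator {-T..<T} s * (f s * (\<Sum>n<m. k (s - 4 * real n * T) - k (s - (4 * real n + 2) * T)
         + k (s + (4 * real n + 4) * T) - k (s + (4 * real n + 2) * T))))"
        unfolding sum_distrib_left by (intro ext sum.cong refl) (simp add: algebra_simps)
      finally show ?thesis .
    qed
    show ?case
      unfolding window_Suc_mult
      apply (subst Bochner_Integration.integral_add, (intro Bochner_Integration.integrable_add Suc.IH(1) p1(1) p2(1) p3(1) p4(1))+)+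
      unfolding p1(2) p2(2) p3(2) p4(2) Suc.IH(2) sum.lessThan_Suc
      apply (subst Bochner_Integration.integral_add[symmetric], (intro Bochner_Integration.integrable_add sumint int intm)+)+
      by (intro Bochner_Integration.integral_cong refl) (simp add: algebra_simps)
  }
qed

end

lemma lebesgue_on_integral:
  fixes g :: "real \<Rightarrow> real"
  assumes "{s. P s} \<in> sets lebesgue"
  shows "integrable (lebesgue_on {s. P s}) g \<longleftrightarrow> integrable lebesgue (\<lambda>s. if P s then g s else 0)"
    and "integral\<^sup>L (lebesgue_on {s. P s}) g = (LINT s|lebesgue. (if P s then g s else 0))"
proof -
  have eq: "(\<lambda>s. indicator {s. P s} s * g s) = (\<lambda>s. if P s then g s else 0)" by (auto simp: fun_eq_iff)
  show "integrable (lebesgue_on {s. P s}) g \<longleftrightarrow> integrable lebesgue (\<lambda>s. if P s then g s else 0)"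
    using assms by (subst integrable_restrict_space) (auto simp: eq)
  show "integral\<^sup>L (lebesgue_on {s. P s}) g = (LINT s|lebesgue. (if P s then g s else 0))"
    using assms by (subst integral_restrict_space) (auto simp: eq)
qed

section \<open>Near and far parts of the kernel \<open>1 / (t - s)\<close>\<close>

context antiperiodic
begin

definition cut :: "real \<Rightarrow> real \<Rightarrow> real \<Rightarrow> real \<Rightarrow> real" where
  "cut t a b s = (if a < \<bar>t - s\<bar> \<and> \<bar>t - s\<bar> < b then 1 / (t - s) else 0)"

definition far_kernel :: "real \<Rightarrow> real \<Rightarrow> real \<Rightarrow> real" where
  "far_kernel t d s = (if \<bar>t - s\<bar> < d then 0 else 1 / (t - s))"

text \<open>The sum of \<open>far_kernel t (T - t)\<close> over all translates with their signs: the
  cosecant kernel without its singularity at \<open>t\<close>. It is bounded on the period, and its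
  value at \<open>s = t\<close> is 0 by the convention for division.\<close>

definition residual :: "real \<Rightarrow> real \<Rightarrow> real" where
  "residual t s = pi / (2 * T * sin (pi * ((t - s) / (2 * T)))) - (if \<bar>t - s\<bar> < T - t then 1 / (t - s) else 0)"

lemma cut_measurable [measurable]: "cut t a b \<in> borel_measurable borel"
  unfolding cut_def by measurable

lemma far_kernel_measurable [measurable]: "far_kernel t d \<in> borel_measurable borel"
  unfolding far_kernel_def by measurable

lemma residual_measurable [measurable]: "residual t \<in> borel_measurable borel"
  unfolding residual_def by measurable

lemma cut_bound: "a > 0 \<Longrightarrow> \<bar>cut t a b s\<bar> \<le> 1 / a"
  by (auto simp: cut_def intro!: divide_left_mono)

lemma far_kernel_bound: "d > 0 \<Longrightarrow> \<bar>far_kernel t d s\<bar> \<le> 1 / d"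
  by (auto simp: far_kernel_def intro!: divide_left_mono)

lemma window_superset:
  assumes t: "0 < t" "t < T"
  obtains m where "\<And>s. \<bar>t - s\<bar> < R \<Longrightarrow> s \<in> window m"
proof -
  obtain m :: nat where m: "(R + 2 * T) / T \<le> real m" using real_arch_simple by blast
  then have m': "R + 2 * T \<le> real m * T" using T by (simp add: field_simps)
  have "0 \<le> real m * T" using T by simp
  show ?thesis
    by (rule that[of m]) (use m' t T \<open>0 \<le> real m * T\<close> in \<open>auto simp: window_def algebra_simps\<close>)
qed

lemma integrable_cut:
  assumes t: "0 < t" "t < T" and a: "a > 0"
  shows "integrable lebesgue (\<lambda>s. f s * cut t a b s)"
proof -
  obtain m where m: "\<And>s. \<bar>t - s\<bar> < b \<Longrightarrow> s \<in> window m" using window_superset[OF t] by blast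
  have "integrable lebesgue (\<lambda>s. indicator (window m) s * (f s * cut t a b s))"
    by (rule window_fold(1)[OF cut_measurable cut_bound[OF a]])
  also have "(\<lambda>s. indicator (window m) s * (f s * cut t a b s)) = (\<lambda>s. f s * cut t a b s)"
    using m by (auto simp: indicator_def cut_def fun_eq_iff)
  finally show ?thesis .
qed

lemma truncated_hilbert_cut:
  assumes t: "0 < t" "t < T" and a: "a > 0"
  shows "integrable (lebesgue_on {s. a < \<bar>t - s\<bar> \<and> \<bar>t - s\<bar> < b}) (\<lambda>s. f s / (t - s))"
    and "truncated_hilbert f t a b = 1 / pi * (LINT s|lebesgue. f s * cut t a b s)"
proof -
  have eq: "(\<lambda>s. if a < \<bar>t - s\<bar> \<and> \<bar>t - s\<bar> < b then f s / (t - s) else 0) = (\<lambda>s. f s * cut t a b s)"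
    by (auto simp: cut_def fun_eq_iff)
  have sets: "{s. a < \<bar>t - s\<bar> \<and> \<bar>t - s\<bar> < b} \<in> sets lebesgue"
    by (intro sets_completionI_sets) simp
  show "integrable (lebesgue_on {s. a < \<bar>t - s\<bar> \<and> \<bar>t - s\<bar> < b}) (\<lambda>s. f s / (t - s))"
    unfolding lebesgue_on_integral(1)[OF sets] eq by (rule integrable_cut[OF t a])
  show "truncated_hilbert f t a b = 1 / pi * (LINT s|lebesgue. f s * cut t a b s)"
    unfolding truncated_hilbert_def lebesgue_on_integral(2)[OF sets] eq ..
qed

text \<open>The hole of radius \<open>T - t\<close> about \<open>t\<close> lies between
  \<open>-T\<close> and \<open>T\<close>, so it meets only the unshifted copy of the period. All
  other copies contribute plain reciprocals, which are the entries of \<open>csc_term\<close> scaled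
  by \<open>2 * T\<close>.\<close>

lemma folded_far_kernel:
  assumes t: "0 < t" "t < T" and s: "s \<in> {-T..<T}"
  shows "(\<Sum>n<Suc m. far_kernel t (T - t) (s - 4 * real n * T) - far_kernel t (T - t) (s - (4 * real n + 2) * T)
         + far_kernel t (T - t) (s + (4 * real n + 4) * T) - far_kernel t (T - t) (s + (4 * real n + 2) * T))
    = (\<Sum>n<Suc m. csc_term ((t - s) / (2 * T)) n) / (2 * T) - (if \<bar>t - s\<bar> < T - t then 1 / (t - s) else 0)"
proof -
  have far: "far_kernel t (T - t) y = 1 / (t - y)" if "y \<notin> {-T<..<T}" for y
    using that t by (auto simp: far_kernel_def)
  have sc: "1 / (t - (s - c * T)) = 1 / ((t - s) / (2 * T) + c / 2) / (2 * T)" for c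
  proof -
    have "(t - s) / (2 * T) + c / 2 = (t - (s - c * T)) / (2 * T)" using T by (simp add: field_simps)
    then show ?thesis using T by simp
  qed
  have nT: "real n * T \<ge> 0" for n using T by simp
  have 2: "far_kernel t (T - t) (s - (4 * real n + 2) * T) = 1 / ((t - s) / (2 * T) + 2 * real n + 1) / (2 * T)" for n
  proof -
    obtain N where N: "real n * T = N" "0 \<le> N" using nT by blast
    have eq: "s - (4 * real n + 2) * T = s - 4 * N - 2 * T" by (simp add: algebra_simps flip: N(1))
    have "s - (4 * real n + 2) * T \<notin> {-T<..<T}" using s N(2) T unfolding eq by auto
    then have "far_kernel t (T - t) (s - (4 * real n + 2) * T) = 1 / (t - (s - (4 * real n + 2) * T))" by (rule far)
    also have "1 / (t - (s - (4 * real n + 2) * T)) = 1 / ((t - s) / (2 * T) + (4 * real n + 2) / 2) / (2 * T)" by (rule sc)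
    also have "(t - s) / (2 * T) + (4 * real n + 2) / 2 = (t - s) / (2 * T) + 2 * real n + 1" by simp
    finally show ?thesis .
  qed
  have 3: "far_kernel t (T - t) (s + (4 * real n + 4) * T) = 1 / ((t - s) / (2 * T) - 2 * real n - 2) / (2 * T)" for n
  proof -
    obtain N where N: "real n * T = N" "0 \<le> N" using nT by blast
    have eq: "s + (4 * real n + 4) * T = s + 4 * N + 4 * T" by (simp add: algebra_simps flip: N(1))
    have "s + (4 * real n + 4) * T \<notin> {-T<..<T}" using s N(2) T unfolding eq by auto
    then have "far_kernel t (T - t) (s + (4 * real n + 4) * T) = 1 / (t - (s + (4 * real n + 4) * T))" by (rule far)
    also have "t - (s + (4 * real n + 4) * T) = t - (s - (- (4 * real n + 4)) * T)" by (simp add: algebra_simps)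
    also have "1 / (t - (s - (- (4 * real n + 4)) * T)) = 1 / ((t - s) / (2 * T) + (- (4 * real n + 4)) / 2) / (2 * T)" by (rule sc)
    also have "(t - s) / (2 * T) + (- (4 * real n + 4)) / 2 = (t - s) / (2 * T) - 2 * real n - 2" by simp
    finally show ?thesis .
  qed
  have 4: "far_kernel t (T - t) (s + (4 * real n + 2) * T) = 1 / ((t - s) / (2 * T) - 2 * real n - 1) / (2 * T)" for n
  proof -
    obtain N where N: "real n * T = N" "0 \<le> N" using nT by blast
    have eq: "s + (4 * real n + 2) * T = s + 4 * N + 2 * T" by (simp add: algebra_simps flip: N(1))
    have "s + (4 * real n + 2) * T \<notin> {-T<..<T}" using s N(2) T unfolding eq by auto
    then have "far_kernel t (T - t) (s + (4 * real n + 2) * T) = 1 / (t - (s + (4 * real n + 2) * T))" by (rule far)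
    also have "t - (s + (4 * real n + 2) * T) = t - (s - (- (4 * real n + 2)) * T)" by (simp add: algebra_simps)
    also have "1 / (t - (s - (- (4 * real n + 2)) * T)) = 1 / ((t - s) / (2 * T) + (- (4 * real n + 2)) / 2) / (2 * T)" by (rule sc)
    also have "(t - s) / (2 * T) + (- (4 * real n + 2)) / 2 = (t - s) / (2 * T) - 2 * real n - 1" by simp
    finally show ?thesis .
  qed
  have 1: "far_kernel t (T - t) (s - 4 * real (Suc n) * T) = 1 / ((t - s) / (2 * T) + 2 * real (Suc n)) / (2 * T)" for n
  proof -
    obtain N where N: "real n * T = N" "0 \<le> N" using nT by blast
    have eq: "s - 4 * real (Suc n) * T = s - 4 * N - 4 * T" by (simp add: algebra_simps flip: N(1))
    have "s - 4 * real (Suc n) * T \<notin> {-T<..<T}" using s N(2) T unfolding eq by auto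
    then have "far_kernel t (T - t) (s - 4 * real (Suc n) * T) = 1 / (t - (s - 4 * real (Suc n) * T))" by (rule far)
    also have "1 / (t - (s - (4 * real (Suc n)) * T)) = 1 / ((t - s) / (2 * T) + (4 * real (Suc n)) / 2) / (2 * T)" by (rule sc)
    also have "(t - s) / (2 * T) + (4 * real (Suc n)) / 2 = (t - s) / (2 * T) + 2 * real (Suc n)" by simp
    finally show ?thesis .
  qed
  \<comment> \<open>The unshifted copy, the only one that meets the hole; this is why the shifts by
    multiples of \<open>4 * T\<close> are treated above from \<open>Suc n\<close> on.\<close>
  have 0: "far_kernel t (T - t) (s - 4 * real 0 * T) = 1 / ((t - s) / (2 * T) + 2 * real 0) / (2 * T) - (if \<bar>t - s\<bar> < T - t then 1 / (t - s) else 0)"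
    using sc[of 0] by (simp add: far_kernel_def)
  show ?thesis
    unfolding sum.lessThan_Suc_shift 0 1 2 3 4 csc_term_def add_divide_distrib sum_divide_distrib diff_divide_distrib
    by simp
qed

text \<open>The first part is the bound of \<open>csc_partial_sum_bound\<close> with
  \<open>\<delta> = (T - t) / (2 * T)\<close>, rescaled by \<open>2 * T\<close>. The summand
  \<open>1 / (T - t)\<close> bounds \<open>1 / (t - s)\<close> at points outside the hole, where
  this term is not subtracted.\<close>

definition residual_bound :: "real \<Rightarrow> real" where
  "residual_bound t = (2 + 1 / ((T - t) / (2 * T)) + 2 * (\<Sum>n. 1 / (real (Suc n))\<^sup>2)) / (2 * T) + 1 / (T - t)"

lemma folded_far_kernel_bound:
  assumes t: "0 < t" "t < T" and s: "s \<in> {-T..<T}"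
  shows "\<bar>(\<Sum>n<Suc m. csc_term ((t - s) / (2 * T)) n) / (2 * T) - (if \<bar>t - s\<bar> < T - t then 1 / (t - s) else 0)\<bar>
    \<le> residual_bound t"
proof -
  have "\<bar>(\<Sum>n<Suc m. csc_term ((t - s) / (2 * T)) n) - 1 / ((t - s) / (2 * T))\<bar> \<le>
      2 + 1 / ((T - t) / (2 * T)) + 2 * (\<Sum>n. 1 / (real (Suc n))\<^sup>2)" (is "\<bar>?S\<bar> \<le> ?K")
  proof (rule csc_partial_sum_bound)
    have "(- T) / (2 * T) \<le> (t - s) / (2 * T)" using s t T by (intro divide_right_mono) auto
    then show "- 1 / 2 \<le> (t - s) / (2 * T)" using T by simp
    have "(t - s) / (2 * T) \<le> (t + T) / (2 * T)" using s t T by (intro divide_right_mono) auto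
    also have "\<dots> = 1 - (T - t) / (2 * T)" using T by (simp add: field_simps)
    finally show "(t - s) / (2 * T) \<le> 1 - (T - t) / (2 * T)" .
    show "(T - t) / (2 * T) > 0" using t T by simp
  qed
  then have "\<bar>?S\<bar> / (2 * T) \<le> ?K / (2 * T)"
    using T by (intro divide_right_mono) auto
  then have B1: "\<bar>?S / (2 * T)\<bar> \<le> ?K / (2 * T)" using T by (simp add: abs_div)
  define Y where "Y = (\<Sum>n<Suc m. csc_term ((t - s) / (2 * T)) n) / (2 * T)"
  have B2: "?S / (2 * T) = Y - 1 / (t - s)"
  proof -
    have "1 / ((t - s) / (2 * T)) / (2 * T) = 1 / (t - s)" using T by simp
    then show ?thesis unfolding Y_def by (simp only: diff_divide_distrib[of _ "1 / ((t - s) / (2 * T))"])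
  qed
  note Y = B1[unfolded B2]
  have "\<bar>Y - (if \<bar>t - s\<bar> < T - t then 1 / (t - s) else 0)\<bar> \<le> ?K / (2 * T) + 1 / (T - t)"
  proof (cases "\<bar>t - s\<bar> < T - t")
    case True
    moreover have "0 \<le> 1 / (T - t)" using t by simp
    ultimately show ?thesis unfolding if_P[OF True] using Y by linarith
  next
    case False
    then have "\<bar>1 / (t - s)\<bar> \<le> 1 / (T - t)" using t by (auto intro!: divide_left_mono)
    then show ?thesis unfolding if_not_P[OF False] using Y by linarith
  qed
  then show ?thesis unfolding residual_bound_def Y_def .
qed

lemma not_Ints:
  assumes t: "0 < t" "t < T" and s: "s \<in> {-T..<T}" "s \<noteq> t"
  shows "(t - s) / (2 * T) \<notin> \<int>"
proof
  assume "(t - s) / (2 * T) \<in> \<int>"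
  then obtain k where k: "(t - s) / (2 * T) = of_int k" by (auto elim: Ints_cases)
  have "\<bar>(t - s) / (2 * T)\<bar> < 1" using s t T by (auto simp: field_simps abs_if)
  then have "k = 0" unfolding k by linarith
  then show False using k s T by simp
qed

lemma residual_limit:
  assumes t: "0 < t" "t < T" and s: "s \<in> {-T..<T}" "s \<noteq> t"
  shows "(\<lambda>m. (\<Sum>n<Suc m. csc_term ((t - s) / (2 * T)) n) / (2 * T) - (if \<bar>t - s\<bar> < T - t then 1 / (t - s) else 0))
    \<longlonglongrightarrow> residual t s"
proof -
  have "(\<lambda>m. \<Sum>n<Suc m. csc_term ((t - s) / (2 * T)) n) \<longlonglongrightarrow> pi / sin (pi * ((t - s) / (2 * T)))"
    using csc_partial_fractions[OF not_Ints[OF assms]] by (rule LIMSEQ_Suc)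
  then have "(\<lambda>m. (\<Sum>n<Suc m. csc_term ((t - s) / (2 * T)) n) / (2 * T) - (if \<bar>t - s\<bar> < T - t then 1 / (t - s) else 0))
    \<longlonglongrightarrow> pi / sin (pi * ((t - s) / (2 * T))) / (2 * T) - (if \<bar>t - s\<bar> < T - t then 1 / (t - s) else 0)"
    using T by (intro tendsto_intros) auto
  then show ?thesis by (simp add: residual_def mult.commute mult.left_commute)
qed

lemma residual_bounded:
  assumes t: "0 < t" "t < T" and s: "s \<in> {-T..<T}"
  shows "\<bar>residual t s\<bar> \<le> residual_bound t"
proof (cases "s = t")
  case True
  have "0 \<le> residual_bound t" using folded_far_kernel_bound[OF assms, of 0] by linarith
  then show ?thesis using True by (simp add: residual_def)
next
  case False
  from tendsto_rabs[OF residual_limit[OF t s False]] show ?thesis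
    by (rule LIMSEQ_le_const2) (use folded_far_kernel_bound[OF assms] in blast)
qed

lemma far_integral_window_limit:
  assumes t: "0 < t" "t < T"
  shows "(\<lambda>m. LINT s|lebesgue. indicator (window m) s * (f s * far_kernel t (T - t) s)) \<longlonglongrightarrow>
    (LINT s|lebesgue. indicator {-T..<T} s * (f s * residual t s))"
\<comment> \<open>The folded kernel contains the hole only once group 0 is present, so the limit is
  taken along \<open>Suc m\<close>.\<close>
proof (rule LIMSEQ_imp_Suc)
  define S where "S m s = (\<Sum>n<Suc m. csc_term ((t - s) / (2 * T)) n) / (2 * T) - (if \<bar>t - s\<bar> < T - t then 1 / (t - s) else 0)" for m s
  have d: "T - t > 0" using t by simp
  have "(LINT s|lebesgue. indicator (window (Suc m)) s * (f s * far_kernel t (T - t) s)) =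
      (LINT s|lebesgue. indicator {-T..<T} s * (f s * S m s))" for m
    unfolding window_fold(2)[OF far_kernel_measurable far_kernel_bound[OF d]]
  proof (intro Bochner_Integration.integral_cong refl)
    fix s
    show "indicator {-T..<T} s * (f s * (\<Sum>n<Suc m. far_kernel t (T - t) (s - 4 * real n * T) - far_kernel t (T - t) (s - (4 * real n + 2) * T)
         + far_kernel t (T - t) (s + (4 * real n + 4) * T) - far_kernel t (T - t) (s + (4 * real n + 2) * T)))
       = indicator {-T..<T} s * (f s * S m s)"
    proof (cases "s \<in> {-T..<T}")
      case True
      show ?thesis unfolding folded_far_kernel[OF t True] S_def ..
    qed simp
  qed
  moreover have "(\<lambda>m. LINT s|lebesgue. indicator {-T..<T} s * (f s * S m s)) \<longlonglongrightarrow>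
    (LINT s|lebesgue. indicator {-T..<T} s * (f s * residual t s))"
  proof (rule integral_dominated_convergence[where w="\<lambda>s. residual_bound t * \<bar>indicator {-T..<T} s * f s\<bar>"])
    have f0: "(\<lambda>s. indicator {-T..<T} s * f s) \<in> borel_measurable lebesgue"
      using integrable_period by simp
    show "(\<lambda>s. indicator {-T..<T} s * (f s * residual t s)) \<in> borel_measurable lebesgue"
      using borel_measurable_times[OF f0 borel_measurable_lebesgueI[OF residual_measurable]] by (simp add: mult.assoc)
    have "S m \<in> borel_measurable borel" for m
      unfolding S_def csc_term_def by measurable
    from borel_measurable_times[OF f0 borel_measurable_lebesgueI[OF this]]
    show "(\<lambda>s. indicator {-T..<T} s * (f s * S m s)) \<in> borel_measurable lebesgue" for m
      by (simp add: mult.assoc)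
    show "integrable lebesgue (\<lambda>s. residual_bound t * \<bar>indicator {-T..<T} s * f s\<bar>)"
      using integrable_period by (intro integrable_mult_right integrable_abs)
    show "AE s in lebesgue. (\<lambda>m. indicator {-T..<T} s * (f s * S m s)) \<longlonglongrightarrow> indicator {-T..<T} s * (f s * residual t s)"
    proof (rule AE_I'[where N="{t}"])
      show "{t} \<in> null_sets lebesgue" by (simp flip: negligible_iff_null_sets)
      have "(\<lambda>m. indicator {-T..<T} s * (f s * S m s)) \<longlonglongrightarrow> indicator {-T..<T} s * (f s * residual t s)" if "s \<noteq> t" for s
      proof (cases "s \<in> {-T..<T}")
        case True
        show ?thesis using residual_limit[OF t True that] unfolding S_def by (intro tendsto_mult tendsto_const)
      qed simp
      then show "{s \<in> space lebesgue. \<not> (\<lambda>m. indicator {-T..<T} s * (f s * S m s)) \<longlonglongrightarrow> indicator {-T..<T} s * (f s * residual t s)} \<subseteq> {t}"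
        by blast
    qed
    show "AE s in lebesgue. norm (indicator {-T..<T} s * (f s * S m s)) \<le> residual_bound t * \<bar>indicator {-T..<T} s * f s\<bar>" for m
    proof (intro AE_I2)
      fix s
      show "norm (indicator {-T..<T} s * (f s * S m s)) \<le> residual_bound t * \<bar>indicator {-T..<T} s * f s\<bar>"
      proof (cases "s \<in> {-T..<T}")
        case True
        then show ?thesis
          using mult_left_mono[OF folded_far_kernel_bound[OF t True, of m] abs_ge_zero[of "f s"]]
          by (simp add: S_def abs_mult mult.commute del: sum.lessThan_Suc)
      qed simp
    qed
  qed
  ultimately show "(\<lambda>m. LINT s|lebesgue. indicator (window (Suc m)) s * (f s * far_kernel t (T - t) s)) \<longlonglongrightarrow>
    (LINT s|lebesgue. indicator {-T..<T} s * (f s * residual t s))" by simp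
qed

text \<open>Its purpose is the mass of \<open>\<bar>f\<bar>\<close> between two windows whose
  indices differ by a constant: it stays bounded, so the decay of the kernel wins there.\<close>

lemma window_abs_integral:
  "integrable lebesgue (\<lambda>s. indicator (window m) s * \<bar>f s\<bar>)"
  "(LINT s|lebesgue. indicator (window m) s * \<bar>f s\<bar>) =
    4 * real m * (LINT s|lebesgue. indicator {-T..<T} s * \<bar>f s\<bar>)"
proof -
  have int: "integrable lebesgue (\<lambda>s. indicator {a..<b} s * \<bar>f s\<bar>)" if "integrable lebesgue (\<lambda>s. indicator {a..<b} s * f s)" for a b
    using integrable_abs[OF that] by (simp add: abs_mult)
  have P: "integrable lebesgue (\<lambda>s. indicator {-T..<T} s * \<bar>f s\<bar>)"
    by (rule int[OF integrable_period])
  have piece: "integrable lebesgue (\<lambda>s. indicator (period c) s * \<bar>f s\<bar>)"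
     "(LINT s|lebesgue. indicator (period c) s * \<bar>f s\<bar>) = (LINT s|lebesgue. indicator {-T..<T} s * \<bar>f s\<bar>)"
    if "\<And>s. \<bar>f (s + c)\<bar> = \<bar>f s\<bar>" for c
    using integrable_shift_window[where f="\<lambda>s. \<bar>f s\<bar>" and a="-T" and b=T and c=c] P
    unfolding that period_def by blast+
  have per: "\<bar>f (s + - (4 * real m) * T)\<bar> = \<bar>f s\<bar>" "\<bar>f (s + - (4 * real m + 2) * T)\<bar> = \<bar>f s\<bar>"
    "\<bar>f (s + (4 * real m + 4) * T)\<bar> = \<bar>f s\<bar>" "\<bar>f (s + (4 * real m + 2) * T)\<bar> = \<bar>f s\<bar>" for s m
    using antiperiodic_multiple[of f T, OF anti, of s m] antiperiodic_multiple[of f T, OF anti, of s "Suc m"]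
    by (simp_all add: algebra_simps)
  note p = piece[OF per(1)] piece[OF per(2)] piece[OF per(3)] piece[OF per(4)]
  have "integrable lebesgue (\<lambda>s. indicator (window m) s * \<bar>f s\<bar>) \<and>
    (LINT s|lebesgue. indicator (window m) s * \<bar>f s\<bar>) = 4 * real m * (LINT s|lebesgue. indicator {-T..<T} s * \<bar>f s\<bar>)"
  proof (induction m)
    case (Suc m)
    have "integrable lebesgue (\<lambda>s. indicator (window (Suc m)) s * \<bar>f s\<bar>)"
      unfolding window_Suc_mult by (intro Bochner_Integration.integrable_add p conjunct1[OF Suc.IH])
    moreover have "(LINT s|lebesgue. indicator (window (Suc m)) s * \<bar>f s\<bar>) = 4 * real (Suc m) * (LINT s|lebesgue. indicator {-T..<T} s * \<bar>f s\<bar>)"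
      unfolding window_Suc_mult
      apply (subst Bochner_Integration.integral_add, (intro Bochner_Integration.integrable_add p conjunct1[OF Suc.IH])+)+
      unfolding p conjunct2[OF Suc.IH] by (simp add: algebra_simps)
    ultimately show ?case by blast
  qed simp
  then show "integrable lebesgue (\<lambda>s. indicator (window m) s * \<bar>f s\<bar>)"
  "(LINT s|lebesgue. indicator (window m) s * \<bar>f s\<bar>) =
    4 * real m * (LINT s|lebesgue. indicator {-T..<T} s * \<bar>f s\<bar>)" by auto
qed

text \<open>The windows reach infinity in discrete steps and are not centred at \<open>t\<close>.
  The ball of radius \<open>R\<close> lies between \<open>window (n R)\<close> and
  \<open>window (n R + 2)\<close>; between these two the mass of \<open>\<bar>f\<bar>\<close> is
  \<open>8 * M\<close> and the kernel is at most \<open>1 / (2 * N)\<close> with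
  \<open>N = n R * T\<close>, so the discrepancy vanishes.\<close>

lemma far_integral_limit:
  assumes t: "0 < t" "t < T"
  shows "((\<lambda>R. LINT s|lebesgue. f s * (if \<bar>t - s\<bar> < R then far_kernel t (T - t) s else 0)) \<longlongrightarrow>
    (LINT s|lebesgue. indicator {-T..<T} s * (f s * residual t s))) at_top"
proof -
  define M where "M = (LINT s|lebesgue. indicator {-T..<T} s * \<bar>f s\<bar>)"
  \<comment> \<open>Chosen so that \<open>4 * N \<le> R - 2 * T < 4 * N + 4 * T\<close> once
    \<open>R\<close> is large; the margin \<open>2 * T\<close> absorbs the eccentric position of the
    windows.\<close>
  define n where "n R = nat \<lfloor>(R - 2 * T) / (4 * T)\<rfloor>" for R
  define F where "F m = (LINT s|lebesgue. indicator (window m) s * (f s * far_kernel t (T - t) s))" for m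
  define G where "G R = (LINT s|lebesgue. f s * (if \<bar>t - s\<bar> < R then far_kernel t (T - t) s else 0))" for R
  have d: "T - t > 0" using t by simp
  have n_top: "filterlim n sequentially at_top"
  proof -
    have "filterlim (\<lambda>R. (R - 2 * T) / (4 * T)) at_top at_top"
    proof -
      have "filterlim (\<lambda>R. 1 / (4 * T) * (- 2 * T + R)) at_top at_top"
        using T by (intro filterlim_tendsto_pos_mult_at_top[OF tendsto_const] filterlim_tendsto_add_at_top[OF tendsto_const] filterlim_ident) auto
      then show ?thesis by (simp add: algebra_simps)
    qed
    then show ?thesis unfolding n_def
      by (intro filterlim_compose[OF filterlim_nat_sequentially] filterlim_compose[OF filterlim_floor_sequentially])
  qed
  have lim: "((\<lambda>R. F (n R)) \<longlongrightarrow> (LINT s|lebesgue. indicator {-T..<T} s * (f s * residual t s))) at_top"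
    unfolding F_def by (rule filterlim_compose[OF far_integral_window_limit[OF t] n_top])
  \<comment> \<open>The condition \<open>R \<ge> 6 * T\<close> ensures \<open>n R \<ge> 1\<close>,
    hence \<open>N \<ge> T\<close>. Then every point outside the inner window has distance at least
    \<open>2 * N\<close> from \<open>t\<close>.\<close>
  have diff: "\<bar>G R - F (n R)\<bar> \<le> 8 * M / (2 * T) / real (n R)" if R: "R \<ge> 6 * T" for R
  proof -
    define N where "N = n R * T"
    have *: "1 \<le> (R - 2 * T) / (4 * T)" using R T by (simp add: field_simps)
    have fl: "1 \<le> real (n R)" "real (n R) \<le> (R - 2 * T) / (4 * T)" "(R - 2 * T) / (4 * T) < real (n R) + 1"
    proof -
      have "0 \<le> \<lfloor>(R - 2 * T) / (4 * T)\<rfloor>" "1 \<le> \<lfloor>(R - 2 * T) / (4 * T)\<rfloor>" using * by linarith+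
      then have "real (n R) = of_int \<lfloor>(R - 2 * T) / (4 * T)\<rfloor>" "1 \<le> n R" unfolding n_def by (simp_all add: le_nat_iff)
      then show "1 \<le> real (n R)" "real (n R) \<le> (R - 2 * T) / (4 * T)" "(R - 2 * T) / (4 * T) < real (n R) + 1"
        by linarith+
    qed
    then have N: "T \<le> N" "4 * N \<le> R - 2 * T" "R - 2 * T < 4 * N + 4 * T"
      using T by (simp_all add: N_def field_simps)
    have win: "window (n R) = {- 4 * N + T..<4 * N + T}" "window (n R + 2) = {- 4 * N - 7 * T..<4 * N + 9 * T}"
    proof -
      have "- (4 * real (n R) - 1) * T = - 4 * N + T" "(4 * real (n R) + 1) * T = 4 * N + T"
        "- (4 * real (n R + 2) - 1) * T = - 4 * N - 7 * T" "(4 * real (n R + 2) + 1) * T = 4 * N + 9 * T"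
        by (simp_all add: N_def algebra_simps)
      then show "window (n R) = {- 4 * N + T..<4 * N + T}" "window (n R + 2) = {- 4 * N - 7 * T..<4 * N + 9 * T}"
        unfolding window_def by simp_all
    qed
    define k where "k s = (if \<bar>t - s\<bar> < R then far_kernel t (T - t) s else 0)" for s
    have k: "k \<in> borel_measurable borel" unfolding k_def by measurable
    have kb: "\<bar>k s\<bar> \<le> 1 / (T - t)" for s
      using far_kernel_bound[OF d, of t s] d by (simp add: k_def)
    have kw: "f s * k s = indicator (window (n R + 2)) s * (f s * k s)" for s
      unfolding win using N t by (auto simp: indicator_def k_def)
    have ik: "integrable lebesgue (\<lambda>s. f s * k s)"
      using window_fold(1)[OF k kb, of "n R + 2"] unfolding kw[symmetric] .
    have iF: "integrable lebesgue (\<lambda>s. indicator (window (n R)) s * (f s * far_kernel t (T - t) s))"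
      by (rule window_fold(1)[OF far_kernel_measurable far_kernel_bound[OF d]])
    have "norm (G R - F (n R)) = norm (LINT s|lebesgue. f s * k s - indicator (window (n R)) s * (f s * far_kernel t (T - t) s))"
      unfolding G_def F_def k_def[symmetric] using ik iF by simp
    also have "\<dots> \<le> (LINT s|lebesgue. (indicator (window (n R + 2)) s * \<bar>f s\<bar> - indicator (window (n R)) s * \<bar>f s\<bar>) * (1 / (2 * N)))"
    proof (rule Bochner_Integration.integral_norm_bound_integral)
      show "integrable lebesgue (\<lambda>s. f s * k s - indicator (window (n R)) s * (f s * far_kernel t (T - t) s))"
        using ik iF by simp
      show "integrable lebesgue (\<lambda>s. (indicator (window (n R + 2)) s * \<bar>f s\<bar> - indicator (window (n R)) s * \<bar>f s\<bar>) * (1 / (2 * N)))"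
        by (intro integrable_mult_left Bochner_Integration.integrable_diff window_abs_integral)
      fix s
      show "norm (f s * k s - indicator (window (n R)) s * (f s * far_kernel t (T - t) s)) \<le>
         (indicator (window (n R + 2)) s * \<bar>f s\<bar> - indicator (window (n R)) s * \<bar>f s\<bar>) * (1 / (2 * N))"
      proof (cases "s \<in> window (n R)")
        case True
        then have "\<bar>t - s\<bar> < R" "s \<in> window (n R + 2)" using N t T unfolding win by auto
        then show ?thesis using True by (simp add: k_def)
      next
        case False
        then have sN: "2 * N \<le> \<bar>t - s\<bar>" using N t T unfolding win by auto
        show ?thesis
        proof (cases "s \<in> window (n R + 2)")
          case True
          have "\<bar>k s\<bar> \<le> 1 / (2 * N)"
            using sN N T by (auto simp: k_def far_kernel_def intro!: divide_left_mono)
          then have "\<bar>f s\<bar> * \<bar>k s\<bar> \<le> \<bar>f s\<bar> * (1 / (2 * N))" by (intro mult_left_mono) auto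
          then show ?thesis using True False by (simp add: abs_mult)
        next
          case F2: False
          then have "f s * k s = 0" using kw[of s] by simp
          then show ?thesis using False F2 by simp
        qed
      qed
    qed
    also have "\<dots> = (4 * real (n R + 2) * M - 4 * real (n R) * M) * (1 / (2 * N))"
      using window_abs_integral[of "n R"] window_abs_integral[of "n R + 2"] by (simp add: M_def)
    also have "\<dots> = 8 * M / (2 * T) / real (n R)"
      using T fl by (simp add: N_def field_simps)
    finally show ?thesis by simp
  qed
  have "((\<lambda>R. G R - F (n R)) \<longlongrightarrow> 0) at_top"
  proof (rule Lim_null_comparison)
    show "\<forall>\<^sub>F R in at_top. norm (G R - F (n R)) \<le> 8 * M / (2 * T) / real (n R)"
      using eventually_ge_at_top[of "6 * T"] by eventually_elim (use diff in simp)
    show "((\<lambda>R. 8 * M / (2 * T) / real (n R)) \<longlongrightarrow> 0) at_top"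
      by (intro real_tendsto_divide_at_top[OF tendsto_const] filterlim_compose[OF filterlim_real_sequentially n_top])
  qed
  from tendsto_add[OF this lim] show ?thesis by (simp add: G_def)
qed

end

section \<open>The joint limit of the truncated integrals\<close>

context antiperiodic
begin

text \<open>For \<open>\<epsilon> < T - t \<le> R\<close> the truncated integral is
  \<open>1 / pi * (A \<epsilon> + G R)\<close>, with separated variables, so the joint limit reduces
  to two single ones. Here \<open>A \<epsilon>\<close> is \<open>pi\<close> times the truncated
  cosecant integral minus a residual integral tending to \<open>H0\<close>, while \<open>G R\<close>
  tends to the same \<open>H0\<close>; the two cancel.\<close>

lemma hilbert_limit:
  assumes t: "0 < t" "t < T"
    and lim: "((\<lambda>\<epsilon>. LINT s|lebesgue. indicator {-T..<T} s *
      (f s * (if \<epsilon> < \<bar>t - s\<bar> then 1 / (2 * T * sin (pi * ((t - s) / (2 * T)))) else 0))) \<longlongrightarrow> L) (at_right 0)"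
  shows "hilbert_exists f t" and "hilbert f t = L"
proof -
  define Q where "Q \<epsilon> = (LINT s|lebesgue. indicator {-T..<T} s *
      (f s * (if \<epsilon> < \<bar>t - s\<bar> then 1 / (2 * T * sin (pi * ((t - s) / (2 * T)))) else 0)))" for \<epsilon>
  define A where "A \<epsilon> = (LINT s|lebesgue. f s * cut t \<epsilon> (T - t) s)" for \<epsilon>
  define H where "H \<epsilon> = (LINT s|lebesgue. indicator {-T..<T} s * (f s * (if \<epsilon> < \<bar>t - s\<bar> then residual t s else 0)))" for \<epsilon>
  define H0 where "H0 = (LINT s|lebesgue. indicator {-T..<T} s * (f s * residual t s))"
  define G where "G R = (LINT s|lebesgue. f s * (if \<bar>t - s\<bar> < R then far_kernel t (T - t) s else 0))" for R
  have f0: "(\<lambda>s. indicator {-T..<T} s * f s) \<in> borel_measurable lebesgue"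
    using integrable_period by simp
  have meas: "(\<lambda>s. if \<epsilon> < \<bar>t - s\<bar> then residual t s else 0) \<in> borel_measurable borel" for \<epsilon>
    by measurable
  have rb0: "0 \<le> residual_bound t"
    using residual_bounded[OF t, of 0] T by (auto intro: order_trans[OF abs_ge_zero])
  have bound: "norm (indicator {-T..<T} s * (f s * (if \<epsilon> < \<bar>t - s\<bar> then residual t s else 0))) \<le> residual_bound t * \<bar>indicator {-T..<T} s * f s\<bar>" for \<epsilon> s
  proof (cases "s \<in> {-T..<T}")
    case True
    have "\<bar>if \<epsilon> < \<bar>t - s\<bar> then residual t s else 0\<bar> \<le> residual_bound t"
      using residual_bounded[OF t True] rb0 by auto
    from mult_left_mono[OF this abs_ge_zero[of "f s"]]
    have "\<bar>f s\<bar> * \<bar>if \<epsilon> < \<bar>t - s\<bar> then residual t s else 0\<bar> \<le> \<bar>f s\<bar> * residual_bound t" .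
    moreover have "norm (indicator {-T..<T} s * (f s * x)) = \<bar>f s\<bar> * \<bar>x\<bar>" for x
      using True by (simp add: abs_mult)
    moreover have "residual_bound t * \<bar>indicator {-T..<T} s * f s\<bar> = \<bar>f s\<bar> * residual_bound t"
      using True by simp
    ultimately show ?thesis by (simp only:)
  qed simp
  have measH: "(\<lambda>s. indicator {-T..<T} s * (f s * (if \<epsilon> < \<bar>t - s\<bar> then residual t s else 0))) \<in> borel_measurable lebesgue" for \<epsilon>
    using borel_measurable_times[OF f0 borel_measurable_lebesgueI[OF meas]] by (simp add: mult.assoc)
  have intw: "integrable lebesgue (\<lambda>s. residual_bound t * \<bar>indicator {-T..<T} s * f s\<bar>)"
    using integrable_period by (intro integrable_mult_right integrable_abs)
  have intH: "integrable lebesgue (\<lambda>s. indicator {-T..<T} s * (f s * (if \<epsilon> < \<bar>t - s\<bar> then residual t s else 0)))" for \<epsilon>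
    by (rule Bochner_Integration.integrable_bound[OF intw measH], intro AE_I2 order_trans[OF bound]) simp
  have H: "(H \<longlongrightarrow> H0) (at_right 0)"
  proof (rule tendsto_at_right_sequentially[where b=1])
    fix S :: "nat \<Rightarrow> real" assume S: "\<And>n. 0 < S n" "S \<longlonglongrightarrow> 0"
    show "(\<lambda>n. H (S n)) \<longlonglongrightarrow> H0"
      unfolding H_def H0_def
    proof (rule integral_dominated_convergence[OF _ measH intw])
      show "(\<lambda>s. indicator {-T..<T} s * (f s * residual t s)) \<in> borel_measurable lebesgue"
        using borel_measurable_times[OF f0 borel_measurable_lebesgueI[OF residual_measurable]] by (simp add: mult.assoc)
      show "AE s in lebesgue. (\<lambda>n. indicator {-T..<T} s * (f s * (if S n < \<bar>t - s\<bar> then residual t s else 0))) \<longlonglongrightarrow> indicator {-T..<T} s * (f s * residual t s)"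
      proof (rule AE_I'[where N="{t}"])
        show "{t} \<in> null_sets lebesgue" by (simp flip: negligible_iff_null_sets)
        have "(\<lambda>n. indicator {-T..<T} s * (f s * (if S n < \<bar>t - s\<bar> then residual t s else 0))) \<longlonglongrightarrow> indicator {-T..<T} s * (f s * residual t s)" if "s \<noteq> t" for s
        proof (rule tendsto_eventually)
          have "\<forall>\<^sub>F n in sequentially. S n < \<bar>t - s\<bar>"
            using order_tendstoD(2)[OF S(2), of "\<bar>t - s\<bar>"] that by simp
          then show "\<forall>\<^sub>F n in sequentially. indicator {-T..<T} s * (f s * (if S n < \<bar>t - s\<bar> then residual t s else 0)) = indicator {-T..<T} s * (f s * residual t s)"
            by (rule eventually_mono) simp
        qed
        then show "{s \<in> space lebesgue. \<not> (\<lambda>n. indicator {-T..<T} s * (f s * (if S n < \<bar>t - s\<bar> then residual t s else 0))) \<longlonglongrightarrow> indicator {-T..<T} s * (f s * residual t s)} \<subseteq> {t}"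
          by blast
      qed
    qed (use bound in auto)
  qed simp
  \<comment> \<open>By its definition \<open>residual\<close> is \<open>pi\<close> times the
    cosecant kernel minus \<open>1 / (t - s)\<close> on the ball of radius \<open>T - t\<close>.
    This ball lies in the period, so the indicator has no effect on the cut part.\<close>
  have A_eq: "A \<epsilon> = pi * Q \<epsilon> - H \<epsilon>" if \<epsilon>: "\<epsilon> > 0" for \<epsilon>
  proof -
    have "pi * Q \<epsilon> = (LINT s|lebesgue. indicator {-T..<T} s * (f s * (if \<epsilon> < \<bar>t - s\<bar> then residual t s else 0)) + f s * cut t \<epsilon> (T - t) s)"
      unfolding Q_def integral_mult_right_zero[symmetric]
    proof (intro Bochner_Integration.integral_cong refl)
      fix s
      have "cut t \<epsilon> (T - t) s = 0" if "s \<notin> {-T..<T}" using that t by (auto simp: cut_def)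
      then show "pi * (indicator {-T..<T} s * (f s * (if \<epsilon> < \<bar>t - s\<bar> then 1 / (2 * T * sin (pi * ((t - s) / (2 * T)))) else 0)))
        = indicator {-T..<T} s * (f s * (if \<epsilon> < \<bar>t - s\<bar> then residual t s else 0)) + f s * cut t \<epsilon> (T - t) s"
        by (cases "s \<in> {-T..<T}") (auto simp: cut_def residual_def right_diff_distrib)
    qed
    also have "\<dots> = H \<epsilon> + A \<epsilon>"
      unfolding H_def A_def by (rule Bochner_Integration.integral_add[OF intH integrable_cut[OF t \<epsilon>]])
    finally show ?thesis by simp
  qed
  have A: "(A \<longlongrightarrow> pi * L - H0) (at_right 0)"
  proof (rule Lim_transform_eventually)
    show "((\<lambda>\<epsilon>. pi * Q \<epsilon> - H \<epsilon>) \<longlongrightarrow> pi * L - H0) (at_right 0)"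
      using lim H unfolding Q_def[symmetric] by (intro tendsto_intros)
    show "\<forall>\<^sub>F \<epsilon> in at_right 0. pi * Q \<epsilon> - H \<epsilon> = A \<epsilon>"
      using eventually_at_right_less[of "0::real"] by (rule eventually_mono) (simp add: A_eq)
  qed
  have G: "(G \<longlongrightarrow> H0) at_top"
    unfolding G_def H0_def by (rule far_integral_limit[OF t])
  have trunc: "truncated_hilbert f t \<epsilon> R = 1 / pi * (A \<epsilon> + G R)" if \<epsilon>: "0 < \<epsilon>" "\<epsilon> < T - t" and R: "T - t \<le> R" for \<epsilon> R
  proof -
    have split: "f s * cut t \<epsilon> R s = f s * cut t \<epsilon> (T - t) s + f s * (if \<bar>t - s\<bar> < R then far_kernel t (T - t) s else 0)" for s
      using \<epsilon> R by (auto simp: cut_def far_kernel_def)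
    have "integrable lebesgue (\<lambda>s. f s * cut t \<epsilon> R s - f s * cut t \<epsilon> (T - t) s)"
      by (intro Bochner_Integration.integrable_diff integrable_cut t \<epsilon>)
    then have "integrable lebesgue (\<lambda>s. f s * (if \<bar>t - s\<bar> < R then far_kernel t (T - t) s else 0))"
      unfolding split by simp
    then show ?thesis
      unfolding truncated_hilbert_cut(2)[OF t \<epsilon>(1)] split A_def G_def
      by (subst Bochner_Integration.integral_add[OF integrable_cut[OF t \<epsilon>(1)]]) auto
  qed
  have "((\<lambda>p. 1 / pi * (A (fst p) + G (snd p))) \<longlongrightarrow> 1 / pi * ((pi * L - H0) + H0)) (at_right 0 \<times>\<^sub>F at_top)"
    by (intro tendsto_mult tendsto_const tendsto_add filterlim_compose[OF A filterlim_fst] filterlim_compose[OF G filterlim_snd])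
  then have "((\<lambda>p. 1 / pi * (A (fst p) + G (snd p))) \<longlongrightarrow> L) (at_right 0 \<times>\<^sub>F at_top)"
    by simp
  moreover have "\<forall>\<^sub>F p in at_right 0 \<times>\<^sub>F at_top. 1 / pi * (A (fst p) + G (snd p)) = (\<lambda>(\<epsilon>, R). truncated_hilbert f t \<epsilon> R) p"
  proof -
    have "\<forall>\<^sub>F \<epsilon> in at_right 0. 0 < \<epsilon> \<and> \<epsilon> < T - t"
      using eventually_at_right_real[of 0 "T - t"] t by (auto elim: eventually_mono)
    moreover have "\<forall>\<^sub>F R in at_top. T - t \<le> R" by (rule eventually_ge_at_top)
    ultimately show ?thesis
      unfolding eventually_prod_filter using trunc by (intro exI conjI) (assumption, assumption, simp)
  qed
  ultimately have L: "((\<lambda>(\<epsilon>, R). truncated_hilbert f t \<epsilon> R) \<longlongrightarrow> L) (at_right 0 \<times>\<^sub>F at_top)"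
    by (rule Lim_transform_eventually)
  then show "hilbert_exists f t"
    unfolding hilbert_exists_def using truncated_hilbert_cut(1)[OF t] by blast
  show "hilbert f t = L"
    unfolding hilbert_def by (rule tendsto_Lim[OF _ L]) (simp add: prod_filter_eq_bot)
qed

end

subsection \<open>Orthogonal series in \<open>L\<^sup>2(0,T)\<close>\<close>

lemma emeasure_interval: "T > 0 \<Longrightarrow> emeasure (lebesgue_on {0<..<T}) (space (lebesgue_on {0<..<T})) = ennreal T"
  by (simp add: emeasure_restrict_space)

lemma finite_measure_interval: "T > 0 \<Longrightarrow> finite_measure (lebesgue_on {0<..<T::real})"
  by (intro finite_measureI) (subst emeasure_interval, auto)

lemma borel_measurable_lebesgue_onI:
  "f \<in> borel_measurable borel \<Longrightarrow> f \<in> borel_measurable (lebesgue_on S)"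
  by (simp add: borel_measurable_lebesgueI measurable_restrict_space1)

lemma L2_measurable: "L2 T f \<Longrightarrow> f \<in> borel_measurable (lebesgue_on {0<..<T})"
  by (simp add: L2_def)

lemma L2_bounded:
  assumes T: "T > 0" and f: "f \<in> borel_measurable borel" and bd: "\<And>s. \<bar>f s\<bar> \<le> C"
  shows "L2 T f"
proof -
  interpret finite_measure "lebesgue_on {0<..<T}" by (rule finite_measure_interval[OF T])
  have m: "f \<in> borel_measurable (lebesgue_on {0<..<T})" by (rule borel_measurable_lebesgue_onI[OF f])
  moreover have "integrable (lebesgue_on {0<..<T}) (\<lambda>t. (f t)\<^sup>2)"
  proof (rule integrable_const_bound[where B="C\<^sup>2"])
    show "AE t in lebesgue_on {0<..<T}. norm ((f t)\<^sup>2) \<le> C\<^sup>2"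
    proof (intro AE_I2)
      show "norm ((f s)\<^sup>2) \<le> C\<^sup>2" for s using power_mono[OF bd[of s] abs_ge_zero, of 2] by simp
    qed
  qed (use m in simp)
  ultimately show ?thesis by (simp add: L2_def)
qed

lemma L2_mult_integrable:
  assumes "L2 T f" "L2 T g"
  shows "integrable (lebesgue_on {0<..<T}) (\<lambda>s. f s * g s)"
proof (rule Bochner_Integration.integrable_bound)
  show "integrable (lebesgue_on {0<..<T}) (\<lambda>s. (f s)\<^sup>2 + (g s)\<^sup>2)" using assms by (simp add: L2_def)
  show "(\<lambda>s. f s * g s) \<in> borel_measurable (lebesgue_on {0<..<T})"
    by (intro borel_measurable_times L2_measurable assms)
  have "\<bar>a * b\<bar> \<le> a\<^sup>2 + b\<^sup>2" for a b :: real
  proof -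
    have "2 * \<bar>a * b\<bar> \<le> a\<^sup>2 + b\<^sup>2"
      using sum_squares_bound[of "\<bar>a\<bar>" "\<bar>b\<bar>"] by (simp add: abs_mult mult.assoc)
    then show ?thesis using abs_ge_zero[of "a * b"] by linarith
  qed
  then show "AE s in lebesgue_on {0<..<T}. norm (f s * g s) \<le> norm ((f s)\<^sup>2 + (g s)\<^sup>2)"
    by (intro AE_I2) simp
qed

lemma L2_scale: "L2 T f \<Longrightarrow> L2 T (\<lambda>s. c * f s)"
  by (auto simp: L2_def power_mult_distrib)

lemma L2_add:
  assumes "L2 T f" "L2 T g"
  shows "L2 T (\<lambda>s. f s + g s)"
proof -
  have "integrable (lebesgue_on {0<..<T}) (\<lambda>s. (f s)\<^sup>2 + (g s)\<^sup>2 + 2 * (f s * g s))"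
    using assms L2_mult_integrable[OF assms] by (simp add: L2_def)
  also have "(\<lambda>s. (f s)\<^sup>2 + (g s)\<^sup>2 + 2 * (f s * g s)) = (\<lambda>s. (f s + g s)\<^sup>2)"
    by (simp add: power2_sum mult.assoc)
  finally show ?thesis
    using borel_measurable_add[OF assms[THEN L2_measurable]] by (simp add: L2_def)
qed

lemma L2_diff: "L2 T f \<Longrightarrow> L2 T g \<Longrightarrow> L2 T (\<lambda>s. f s - g s)"
  using L2_add[of T f "\<lambda>s. (- 1) * g s"] L2_scale[of T g "- 1"] by simp

lemma L2_sum: "(\<And>k. k \<in> A \<Longrightarrow> L2 T (f k)) \<Longrightarrow> L2 T (\<lambda>s. \<Sum>k\<in>A. f k s)"
proof (induction A rule: infinite_finite_induct)
  case (insert x A)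
  then show ?case by (simp add: L2_add)
qed (simp_all add: L2_def)

lemma L2_integrable:
  assumes "T > 0" "L2 T f"
  shows "integrable (lebesgue_on {0<..<T}) f"
  using L2_mult_integrable[OF assms(2) L2_bounded[OF assms(1), of "\<lambda>_. 1" 1]] by simp

text \<open>The form in \<open>x\<close> and \<open>y\<close> is nonnegative; testing it at
  \<open>(-C, A)\<close> or \<open>(B, -C)\<close> yields \<open>A * B - C\<^sup>2\<close> times a
  positive factor. If both norms vanish, the points \<open>(1, 1)\<close> and \<open>(1, -1)\<close>
  force \<open>C = 0\<close>.\<close>

lemma L2_Cauchy_Schwarz:
  assumes f: "L2 T f" and g: "L2 T g"
  shows "(integral\<^sup>L (lebesgue_on {0<..<T}) (\<lambda>s. f s * g s))\<^sup>2 \<le>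
    integral\<^sup>L (lebesgue_on {0<..<T}) (\<lambda>s. (f s)\<^sup>2) * integral\<^sup>L (lebesgue_on {0<..<T}) (\<lambda>s. (g s)\<^sup>2)"
proof -
  let ?I = "\<lambda>h. integral\<^sup>L (lebesgue_on {0<..<T}) h"
  have quad: "0 \<le> x\<^sup>2 * ?I (\<lambda>s. (f s)\<^sup>2) + y\<^sup>2 * ?I (\<lambda>s. (g s)\<^sup>2) + 2 * x * y * ?I (\<lambda>s. f s * g s)" for x y
  proof -
    have "0 \<le> ?I (\<lambda>s. (x * f s + y * g s)\<^sup>2)" by (intro Bochner_Integration.integral_nonneg) auto
    also have "(\<lambda>s. (x * f s + y * g s)\<^sup>2) = (\<lambda>s. x\<^sup>2 * (f s)\<^sup>2 + y\<^sup>2 * (g s)\<^sup>2 + 2 * x * y * (f s * g s))"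
      by (simp add: power2_eq_square algebra_simps)
    also have "?I \<dots> = x\<^sup>2 * ?I (\<lambda>s. (f s)\<^sup>2) + y\<^sup>2 * ?I (\<lambda>s. (g s)\<^sup>2) + 2 * x * y * ?I (\<lambda>s. f s * g s)"
      using f g L2_mult_integrable[OF f g] by (simp add: L2_def)
    finally show ?thesis .
  qed
  define A where "A = ?I (\<lambda>s. (f s)\<^sup>2)"
  define B where "B = ?I (\<lambda>s. (g s)\<^sup>2)"
  define C where "C = ?I (\<lambda>s. f s * g s)"
  have q: "0 \<le> x\<^sup>2 * A + y\<^sup>2 * B + 2 * x * y * C" for x y
    using quad[of x y] by (simp add: A_def B_def C_def)
  have AB: "0 \<le> A" "0 \<le> B" using q[of 1 0] q[of 0 1] by simp_all
  consider "A > 0" | "B > 0" | "A = 0" "B = 0" using AB by fastforce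
  then have "C\<^sup>2 \<le> A * B"
  proof cases
    case 1
    have "0 \<le> A * (A * B - C\<^sup>2)" using q[of "- C" A] by (simp add: power2_eq_square algebra_simps)
    then show ?thesis using 1 by (simp add: zero_le_mult_iff)
  next
    case 2
    have "0 \<le> B * (A * B - C\<^sup>2)" using q[of B "- C"] by (simp add: power2_eq_square algebra_simps)
    then show ?thesis using 2 by (simp add: zero_le_mult_iff)
  next
    case 3
    have "C = 0" using q[of 1 1] q[of 1 "-1"] 3 by simp
    then show ?thesis using 3 by simp
  qed
  then show ?thesis by (simp add: A_def B_def C_def)
qed

lemma L2_converges_inner:
  assumes X: "L2_converges T X \<psi>" and g: "L2 T g"
  shows "(\<lambda>n. integral\<^sup>L (lebesgue_on {0<..<T}) (\<lambda>s. X n s * g s)) \<longlonglongrightarrow> integral\<^sup>L (lebesgue_on {0<..<T}) (\<lambda>s. \<psi> s * g s)"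
proof -
  let ?I = "\<lambda>h. integral\<^sup>L (lebesgue_on {0<..<T}) h"
  have L: "L2 T (X n)" "L2 T \<psi>" for n using X by (auto simp: L2_converges_def)
  have "(\<lambda>n. ?I (\<lambda>s. (X n s - \<psi> s)\<^sup>2) * ?I (\<lambda>s. (g s)\<^sup>2)) \<longlonglongrightarrow> 0 * ?I (\<lambda>s. (g s)\<^sup>2)"
    using X by (intro tendsto_mult tendsto_const) (simp add: L2_converges_def)
  then have lim0: "(\<lambda>n. sqrt (?I (\<lambda>s. (X n s - \<psi> s)\<^sup>2) * ?I (\<lambda>s. (g s)\<^sup>2))) \<longlonglongrightarrow> 0"
    using tendsto_real_sqrt by fastforce
  have bd: "norm (?I (\<lambda>s. X n s * g s) - ?I (\<lambda>s. \<psi> s * g s)) \<le> sqrt (?I (\<lambda>s. (X n s - \<psi> s)\<^sup>2) * ?I (\<lambda>s. (g s)\<^sup>2))" for n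
  proof -
    have "?I (\<lambda>s. X n s * g s) - ?I (\<lambda>s. \<psi> s * g s) = ?I (\<lambda>s. (X n s - \<psi> s) * g s)"
      using L2_mult_integrable[OF L(1) g] L2_mult_integrable[OF L(2) g] by (simp add: left_diff_distrib)
    then show ?thesis
      using L2_Cauchy_Schwarz[OF L2_diff[OF L(1,2)] g, of n] by (simp add: real_le_rsqrt)
  qed
  have "(\<lambda>n. ?I (\<lambda>s. X n s * g s) - ?I (\<lambda>s. \<psi> s * g s)) \<longlonglongrightarrow> 0"
    by (rule Lim_null_comparison[OF always_eventually lim0]) (use bd in blast)
  then show ?thesis by (simp add: LIM_zero_iff)
qed

text \<open>The squared norm is \<open>T / 2\<close> and not 1, in accordance with the factor
  \<open>2 / T\<close> of \<open>sine_coeff\<close>. Both the sine and the cosine system are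
  instances.\<close>

locale L2_orthogonal =
  fixes T :: real and e :: "nat \<Rightarrow> real \<Rightarrow> real"
  assumes T: "T > 0" and L2_e: "\<And>k. L2 T (e k)"
    and orthogonal: "\<And>j k. integral\<^sup>L (lebesgue_on {0<..<T}) (\<lambda>s. e j s * e k s) = (if j = k then T / 2 else 0)"
begin

abbreviation integral_T :: "(real \<Rightarrow> real) \<Rightarrow> real" where
  "integral_T h \<equiv> integral\<^sup>L (lebesgue_on {0<..<T}) h"

lemma L2_partial_sum: "L2 T (\<lambda>s. \<Sum>k\<in>A. a k * e k s)"
  by (intro L2_sum L2_scale L2_e)

lemma integral_partial_sum_mult:
  assumes "finite A"
  shows "integral_T (\<lambda>s. (\<Sum>k\<in>A. a k * e k s) * e j s) = (if j \<in> A then a j * (T / 2) else 0)"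
proof -
  have "integral_T (\<lambda>s. (\<Sum>k\<in>A. a k * e k s) * e j s) = integral_T (\<lambda>s. \<Sum>k\<in>A. a k * (e k s * e j s))"
    by (simp add: sum_distrib_right mult.assoc)
  also have "\<dots> = (\<Sum>k\<in>A. a k * (if k = j then T / 2 else 0))"
    using L2_mult_integrable[OF L2_e L2_e] by (subst Bochner_Integration.integral_sum) (simp_all add: orthogonal)
  also have "\<dots> = (\<Sum>k\<in>A. if k = j then a j * (T / 2) else 0)" by (intro sum.cong) auto
  also have "\<dots> = (if j \<in> A then a j * (T / 2) else 0)" using assms by (rule sum.delta)
  finally show ?thesis .
qed

lemma integral_partial_sum_square:
  assumes "finite A"
  shows "integral_T (\<lambda>s. (\<Sum>k\<in>A. a k * e k s)\<^sup>2) = T / 2 * (\<Sum>k\<in>A. (a k)\<^sup>2)"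
proof -
  have "integral_T (\<lambda>s. (\<Sum>k\<in>A. a k * e k s)\<^sup>2) = integral_T (\<lambda>s. \<Sum>j\<in>A. a j * ((\<Sum>k\<in>A. a k * e k s) * e j s))"
    by (simp add: power2_eq_square sum_distrib_left mult_ac)
  also have "\<dots> = (\<Sum>j\<in>A. a j * (a j * (T / 2)))"
    using L2_mult_integrable[OF L2_partial_sum L2_e]
    by (subst Bochner_Integration.integral_sum) (simp_all add: integral_partial_sum_mult[OF assms])
  also have "\<dots> = T / 2 * (\<Sum>k\<in>A. (a k)\<^sup>2)"
    by (simp add: sum_distrib_left power2_eq_square mult_ac)
  finally show ?thesis .
qed

lemma Bessel_summable:
  assumes \<phi>: "L2 T \<phi>"
  shows "summable (\<lambda>k. (2 / T * integral_T (\<lambda>s. \<phi> s * e k s))\<^sup>2)"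
proof (rule summableI_nonneg_bounded)
  define a where "a k = 2 / T * integral_T (\<lambda>s. \<phi> s * e k s)" for k
  show "0 \<le> (2 / T * integral_T (\<lambda>s. \<phi> s * e k s))\<^sup>2" for k by simp
  show "(\<Sum>k<n. (2 / T * integral_T (\<lambda>s. \<phi> s * e k s))\<^sup>2) \<le> 2 / T * integral_T (\<lambda>s. (\<phi> s)\<^sup>2)" for n
  proof -
    let ?S = "\<lambda>s. \<Sum>k<n. a k * e k s"
    have ae: "integral_T (\<lambda>s. \<phi> s * e k s) = T / 2 * a k" for k using T by (simp add: a_def)
    have cross: "integral_T (\<lambda>s. \<phi> s * ?S s) = T / 2 * (\<Sum>k<n. (a k)\<^sup>2)"
    proof -
      have "integral_T (\<lambda>s. \<phi> s * ?S s) = integral_T (\<lambda>s. \<Sum>k<n. a k * (\<phi> s * e k s))"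
        by (simp add: sum_distrib_left mult_ac)
      also have "\<dots> = (\<Sum>k<n. a k * (T / 2 * a k))"
        using L2_mult_integrable[OF \<phi> L2_e] by (subst Bochner_Integration.integral_sum) (simp_all add: ae)
      also have "\<dots> = T / 2 * (\<Sum>k<n. (a k)\<^sup>2)"
        by (simp add: sum_distrib_left power2_eq_square mult_ac)
      finally show ?thesis .
    qed
    have "0 \<le> integral_T (\<lambda>s. (\<phi> s - ?S s)\<^sup>2)" by (intro Bochner_Integration.integral_nonneg) auto
    also have "(\<lambda>s. (\<phi> s - ?S s)\<^sup>2) = (\<lambda>s. (\<phi> s)\<^sup>2 - 2 * (\<phi> s * ?S s) + (?S s)\<^sup>2)"
      by (simp add: power2_diff algebra_simps)
    also have "integral_T \<dots> = integral_T (\<lambda>s. (\<phi> s)\<^sup>2) - 2 * integral_T (\<lambda>s. \<phi> s * ?S s) + integral_T (\<lambda>s. (?S s)\<^sup>2)"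
      using \<phi> L2_partial_sum[of a "{..<n}"] L2_mult_integrable[OF \<phi> L2_partial_sum[of a "{..<n}"]]
      by (simp add: L2_def)
    also have "\<dots> = integral_T (\<lambda>s. (\<phi> s)\<^sup>2) - T / 2 * (\<Sum>k<n. (a k)\<^sup>2)"
      unfolding cross by (simp add: integral_partial_sum_square)
    finally have "T / 2 * (\<Sum>k<n. (a k)\<^sup>2) \<le> integral_T (\<lambda>s. (\<phi> s)\<^sup>2)" by simp
    then have "(\<Sum>k<n. (a k)\<^sup>2) \<le> 2 / T * integral_T (\<lambda>s. (\<phi> s)\<^sup>2)" using T by (simp add: field_simps)
    then show ?thesis unfolding a_def .
  qed
qed

text \<open>Orthogonality turns increments of partial sums into pieces of the series of squares. A
  fast subsequence then converges almost everywhere, and Fatou's lemma leads from the subsequence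
  back to the whole sequence.\<close>

lemma Riesz_Fischer:
  assumes a: "summable (\<lambda>k. (a k)\<^sup>2)"
  shows "\<exists>\<psi>. L2_converges T (\<lambda>n s. \<Sum>k<n. a k * e k s) \<psi>"
proof -
  let ?M = "lebesgue_on {0<..<T}"
  define X where "X n s = (\<Sum>k<n. a k * e k s)" for n s
  define tail where "tail n = T / 2 * (\<Sum>k. (a (k + n))\<^sup>2)" for n
  have LX: "L2 T (X n)" for n unfolding X_def by (rule L2_partial_sum)
  have tail_lim: "tail \<longlonglongrightarrow> 0"
    unfolding tail_def using tendsto_mult[OF tendsto_const suminf_exist_split2[OF a], of "T / 2"] by simp
  have tail0: "0 \<le> tail n" for n
    unfolding tail_def using T a by (intro mult_nonneg_nonneg suminf_nonneg) (auto intro: summable_ignore_initial_segment[OF a])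
  have D1: "integral_T (\<lambda>s. (X n s - X m s)\<^sup>2) \<le> tail m" if "m \<le> n" for m n
  proof -
    have "X n s - X m s = (\<Sum>k\<in>{m..<n}. a k * e k s)" for s
      unfolding X_def using that by (simp add: lessThan_atLeast0 sum_diff_nat_ivl)
    then have "integral_T (\<lambda>s. (X n s - X m s)\<^sup>2) = T / 2 * (\<Sum>k\<in>{m..<n}. (a k)\<^sup>2)"
      by (simp add: integral_partial_sum_square)
    also have "(\<Sum>k\<in>{m..<n}. (a k)\<^sup>2) = (\<Sum>k<n - m. (a (k + m))\<^sup>2)"
      using that sum.shift_bounds_nat_ivl[of "\<lambda>k. (a k)\<^sup>2" 0 m "n - m"] by (simp add: lessThan_atLeast0)
    also have "T / 2 * \<dots> \<le> tail m"
      unfolding tail_def using T a by (intro mult_left_mono sum_le_suminf) (auto intro: summable_ignore_initial_segment[OF a])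
    finally show ?thesis .
  qed
  have D: "integral_T (\<lambda>s. (X n s - X m s)\<^sup>2) \<le> tail n + tail m" for m n
    using D1[of m n] D1[of n m] tail0[of m] tail0[of n] by (cases "m \<le> n") (auto simp: power2_commute)
  \<comment> \<open>The rate \<open>(1/4)^j\<close> for squared distances becomes
    \<open>sqrt T * (1/2)^j\<close> for the integrals of \<open>\<bar>Y j s\<bar>\<close> by
    Cauchy-Schwarz, which is summable.\<close>
  define \<nu> where "\<nu> j = (LEAST m. \<forall>n\<ge>m. tail n \<le> (1/4) ^ j)" for j
  have ex: "\<exists>m. \<forall>n\<ge>m. tail n \<le> (1/4) ^ j" for j
    using order_tendstoD(2)[OF tail_lim, of "(1/4) ^ j"] by (auto simp: eventually_sequentially intro: less_imp_le)
  have \<nu>: "tail n \<le> (1/4) ^ j" if "n \<ge> \<nu> j" for n j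
    using LeastI_ex[OF ex[of j]] that unfolding \<nu>_def by blast
  have \<nu>_mono: "\<nu> j \<le> \<nu> (Suc j)" for j
  proof -
    have "(1/4) ^ Suc j \<le> ((1/4) ^ j :: real)" by simp
    then have "\<forall>n\<ge>\<nu> (Suc j). tail n \<le> (1/4) ^ j" using \<nu>[of "Suc j"] by (meson order_trans)
    then show ?thesis unfolding \<nu>_def[of j] by (rule Least_le)
  qed
  define Y where "Y j s = X (\<nu> (Suc j)) s - X (\<nu> j) s" for j s
  have LY: "L2 T (Y j)" for j unfolding Y_def by (intro L2_diff LX)
  have mX [measurable]: "X n \<in> borel_measurable ?M" for n by (rule L2_measurable[OF LX])
  have mY [measurable]: "Y j \<in> borel_measurable ?M" for j by (rule L2_measurable[OF LY])
  have intY: "integrable ?M (\<lambda>s. \<bar>Y j s\<bar>)" for j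
    using L2_integrable[OF T LY] by simp
  have Y: "integral_T (\<lambda>s. \<bar>Y j s\<bar>) \<le> sqrt T * (1/2) ^ j" for j
  proof -
    have LaY: "L2 T (\<lambda>s. \<bar>Y j s\<bar>)" using LY[of j] borel_measurable_abs[OF L2_measurable[OF LY[of j]]] by (simp add: L2_def)
    have "L2 T (\<lambda>_. 1)" by (rule L2_bounded[OF T, of _ 1]) auto
    from L2_Cauchy_Schwarz[OF LaY this]
    have "(integral_T (\<lambda>s. \<bar>Y j s\<bar>))\<^sup>2 \<le> integral_T (\<lambda>s. (Y j s)\<^sup>2) * T"
      using T by (simp add: measure_def emeasure_restrict_space)
    also have "\<dots> \<le> (1/4) ^ j * T"
      unfolding Y_def using D1[OF \<nu>_mono[of j]] \<nu>[of j "\<nu> j"] T by (intro mult_right_mono) auto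
    also have "\<dots> = (sqrt T * (1/2) ^ j)\<^sup>2"
    proof -
      have "((1/2) ^ j)\<^sup>2 = (1/2 * (1/2) :: real) ^ j" by (simp only: power2_eq_square power_mult_distrib)
      then show ?thesis using T by (simp add: power_mult_distrib)
    qed
    finally show ?thesis using T by (intro power2_le_imp_le[of "integral_T (\<lambda>s. \<bar>Y j s\<bar>)"]) auto
  qed
  have "(\<integral>\<^sup>+s. (\<Sum>j. ennreal \<bar>Y j s\<bar>) \<partial>?M) = (\<Sum>j. \<integral>\<^sup>+s. ennreal \<bar>Y j s\<bar> \<partial>?M)"
    by (intro nn_integral_suminf) measurable
  also have "\<dots> = (\<Sum>j. ennreal (integral_T (\<lambda>s. \<bar>Y j s\<bar>)))"
    using intY by (intro suminf_cong nn_integral_eq_integral) auto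
  also have "\<dots> \<le> (\<Sum>j. ennreal (sqrt T * (1/2) ^ j))"
    by (intro suminf_le ennreal_leI Y) auto
  also have "\<dots> = ennreal (\<Sum>j. sqrt T * (1/2) ^ j)"
    using T by (intro suminf_ennreal2 summable_mult summable_geometric) auto
  also have "\<dots> < \<infinity>" by simp
  finally have fin: "(\<integral>\<^sup>+s. (\<Sum>j. ennreal \<bar>Y j s\<bar>) \<partial>?M) \<noteq> \<infinity>" by simp
  have "(\<lambda>s. \<Sum>j. ennreal \<bar>Y j s\<bar>) \<in> borel_measurable ?M" by measurable
  from nn_integral_PInf_AE[OF this fin]
  have AE_conv: "AE s in ?M. convergent (\<lambda>j. X (\<nu> j) s)"
  proof eventually_elim
    case (elim s)
    then have "summable (\<lambda>j. \<bar>Y j s\<bar>)" by (intro summable_suminf_not_top) auto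
    then have "summable (\<lambda>j. Y j s)" by (rule summable_rabs_cancel)
    then have "convergent (\<lambda>n. X (\<nu> 0) s + (\<Sum>j<n. Y j s))"
      by (intro convergent_add convergent_const) (simp add: summable_iff_convergent)
    moreover have "X (\<nu> 0) s + (\<Sum>j<n. Y j s) = X (\<nu> n) s" for n
      unfolding Y_def sum_lessThan_telescope[of "\<lambda>j. X (\<nu> j) s" n] by simp
    ultimately show ?case by simp
  qed
  define \<psi> where "\<psi> s = lim (\<lambda>j. X (\<nu> j) s)" for s
  have \<psi>_meas [measurable]: "\<psi> \<in> borel_measurable ?M"
    unfolding \<psi>_def by (rule borel_measurable_lim_metric[OF mX])
  \<comment> \<open>Fatou's lemma along the subsequence: the squared distance from
    \<open>X n\<close> to \<open>X (\<nu> j)\<close> is at most \<open>tail n + (1/4)^j\<close>, and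
    the second summand disappears in the lower limit.\<close>
  have bound: "(\<integral>\<^sup>+s. ennreal ((X n s - \<psi> s)\<^sup>2) \<partial>?M) \<le> ennreal (tail n)" for n
  proof -
    have "(\<integral>\<^sup>+s. ennreal ((X n s - \<psi> s)\<^sup>2) \<partial>?M) = (\<integral>\<^sup>+s. liminf (\<lambda>j. ennreal ((X n s - X (\<nu> j) s)\<^sup>2)) \<partial>?M)"
    proof (rule nn_integral_cong_AE)
      show "AE s in ?M. ennreal ((X n s - \<psi> s)\<^sup>2) = liminf (\<lambda>j. ennreal ((X n s - X (\<nu> j) s)\<^sup>2))"
        using AE_conv
      proof eventually_elim
        case (elim s)
        then have "(\<lambda>j. X (\<nu> j) s) \<longlonglongrightarrow> \<psi> s" unfolding \<psi>_def by (simp add: convergent_LIMSEQ_iff)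
        then have "(\<lambda>j. ennreal ((X n s - X (\<nu> j) s)\<^sup>2)) \<longlonglongrightarrow> ennreal ((X n s - \<psi> s)\<^sup>2)"
          by (intro tendsto_ennrealI tendsto_intros)
        from lim_imp_Liminf[OF _ this] show ?case by simp
      qed
    qed
    also have "\<dots> \<le> liminf (\<lambda>j. \<integral>\<^sup>+s. ennreal ((X n s - X (\<nu> j) s)\<^sup>2) \<partial>?M)"
      by (intro nn_integral_liminf) measurable
    also have "\<dots> \<le> liminf (\<lambda>j. ennreal (tail n + (1/4) ^ j))"
    proof (intro Liminf_mono always_eventually allI)
      fix j
      have "(\<integral>\<^sup>+s. ennreal ((X n s - X (\<nu> j) s)\<^sup>2) \<partial>?M) = ennreal (integral_T (\<lambda>s. (X n s - X (\<nu> j) s)\<^sup>2))"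
        using L2_diff[OF LX LX] by (intro nn_integral_eq_integral) (auto simp: L2_def)
      also have "\<dots> \<le> ennreal (tail n + (1/4) ^ j)"
        using D[of n "\<nu> j"] \<nu>[of j "\<nu> j"] by (intro ennreal_leI) simp
      finally show "(\<integral>\<^sup>+s. ennreal ((X n s - X (\<nu> j) s)\<^sup>2) \<partial>?M) \<le> ennreal (tail n + (1/4) ^ j)" .
    qed
    also have "\<dots> = ennreal (tail n + 0)"
      by (intro lim_imp_Liminf tendsto_ennrealI tendsto_intros LIMSEQ_realpow_zero) auto
    finally show ?thesis by simp
  qed
  have int: "integrable ?M (\<lambda>s. (X n s - \<psi> s)\<^sup>2)" for n
  proof (rule integrableI_bounded)
    show "(\<integral>\<^sup>+s. ennreal (norm ((X n s - \<psi> s)\<^sup>2)) \<partial>?M) < \<infinity>"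
      using le_less_trans[OF bound[of n] ennreal_less_top] by simp
  qed measurable
  have L: "L2 T \<psi>"
  proof -
    have "(\<lambda>s. X 0 s - \<psi> s) \<in> borel_measurable ?M" by measurable
    then have "L2 T (\<lambda>s. X 0 s - \<psi> s)" using int[of 0] by (simp add: L2_def)
    from L2_diff[OF LX[of 0] this] show ?thesis by simp
  qed
  have "integral_T (\<lambda>s. (X n s - \<psi> s)\<^sup>2) \<le> tail n" for n
  proof -
    have "ennreal (integral_T (\<lambda>s. (X n s - \<psi> s)\<^sup>2)) = (\<integral>\<^sup>+s. ennreal ((X n s - \<psi> s)\<^sup>2) \<partial>?M)"
      using int by (intro nn_integral_eq_integral[symmetric]) auto
    then have "ennreal (integral_T (\<lambda>s. (X n s - \<psi> s)\<^sup>2)) \<le> ennreal (tail n)" using bound[of n] by (simp only:)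
    then show ?thesis by (simp only: ennreal_le_iff[OF tail0])
  qed
  then have "(\<lambda>n. integral_T (\<lambda>s. (X n s - \<psi> s)\<^sup>2)) \<longlonglongrightarrow> 0"
    by (intro Lim_null_comparison[OF always_eventually tail_lim] allI) simp
  then have "L2_converges T X \<psi>" using LX L by (simp add: L2_converges_def)
  then show ?thesis unfolding X_def by blast
qed

end

subsection \<open>The modified Hilbert transform\<close>

text \<open>The value 0 at these points makes antiperiodicity and oddness hold everywhere and not
  just almost everywhere, as the locale \<open>antiperiodic\<close> demands.\<close>

lemma periodic_reflection_multiple:
  assumes T: "T > 0"
  shows "periodic_reflection T \<phi> (of_int m * T) = 0"
proof -
  have "\<not> (of_int a * T < of_int m * T \<and> of_int m * T < of_int (a + 1) * T)" for a
    using T by (simp only: mult_less_cancel_right_disj of_int_less_iff) auto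
  from this[of "4 * k - 2" for k] this[of "4 * k - 1" for k] this[of "4 * k" for k] this[of "4 * k + 1" for k]
  have "of_int m * T \<notin> {(4 * of_int k - 2) * T <..< (4 * of_int k - 1) * T}"
    "of_int m * T \<notin> {(4 * of_int k - 1) * T <..< 4 * of_int k * T}"
    "of_int m * T \<notin> {4 * of_int k * T <..< (4 * of_int k + 1) * T}"
    "of_int m * T \<notin> {(4 * of_int k + 1) * T <..< (4 * of_int k + 2) * T}" for k :: int
    by (simp_all add: add.commute)
  then show ?thesis unfolding periodic_reflection_def Let_def by (simp only: if_False)
qed

lemma non_multiple_cases:
  fixes T s :: real
  assumes "T > 0"
  obtains m :: int where "s = of_int m * T"
  | k :: int where "s \<in> {(4 * k - 2) * T <..< (4 * k - 1) * T}"
  | k :: int where "s \<in> {(4 * k - 1) * T <..< 4 * k * T}"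
  | k :: int where "s \<in> {4 * k * T <..< (4 * k + 1) * T}"
  | k :: int where "s \<in> {(4 * k + 1) * T <..< (4 * k + 2) * T}"
proof (cases "\<exists>m::int. s = of_int m * T")
  case True then show ?thesis using that(1) by blast
next
  case False
  define m where "m = \<lfloor>s / T\<rfloor>"
  have m: "of_int m * T \<le> s" "s < (of_int m + 1) * T"
    using assms unfolding m_def by (simp_all flip: pos_le_divide_eq pos_divide_less_eq) 
  then have m': "of_int m * T < s" "s < (of_int m + 1) * T"
    using False by (auto simp: less_le)
  define k where "k = (m + 2) div 4"
  have "m = 4 * k - 2 \<or> m = 4 * k - 1 \<or> m = 4 * k \<or> m = 4 * k + 1"
    unfolding k_def by presburger
  then show ?thesis
  proof (elim disjE)
    assume "m = 4 * k - 2" then show ?thesis using that(2)[of k] m' by simp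
  next
    assume "m = 4 * k - 1" then show ?thesis using that(3)[of k] m' by simp
  next
    assume "m = 4 * k" then show ?thesis using that(4)[of k] m' by simp
  next
    assume "m = 4 * k + 1" then show ?thesis using that(5)[of k] m' by (simp add: add.commute)
  qed
qed

lemma periodic_reflection_shift:
  assumes T: "T > 0"
  shows "periodic_reflection T \<phi> (s + 2 * T) = - periodic_reflection T \<phi> s"
proof (cases rule: non_multiple_cases[OF T, of s])
  case (1 m)
  then have "s + 2 * T = of_int (m + 2) * T" by (simp add: algebra_simps)
  then show ?thesis using 1 by (simp add: periodic_reflection_multiple[OF T] del: of_int_add of_int_minus)
next
  case (2 k)
  then have "s + 2 * T \<in> {4 * k * T <..< (4 * k + 1) * T}" by (simp add: algebra_simps)
  from periodic_reflection_cases(3)[OF T this, of \<phi>] periodic_reflection_cases(1)[OF T 2, of \<phi>]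
  show ?thesis by (simp add: algebra_simps)
next
  case (3 k)
  then have "s + 2 * T \<in> {(4 * k + 1) * T <..< (4 * k + 2) * T}" by (simp add: algebra_simps)
  from periodic_reflection_cases(4)[OF T this, of \<phi>] periodic_reflection_cases(2)[OF T 3, of \<phi>]
  show ?thesis by (simp add: algebra_simps)
next
  case (4 k)
  then have "s + 2 * T \<in> {(4 * (k + 1) - 2) * T <..< (4 * (k + 1) - 1) * T}" by (simp add: algebra_simps)
  from periodic_reflection_cases(1)[OF T this, of \<phi>] periodic_reflection_cases(3)[OF T 4, of \<phi>]
  show ?thesis by (simp add: algebra_simps)
next
  case (5 k)
  then have "s + 2 * T \<in> {(4 * (k + 1) - 1) * T <..< 4 * (k + 1) * T}" by (simp add: algebra_simps)
  from periodic_reflection_cases(2)[OF T this, of \<phi>] periodic_reflection_cases(4)[OF T 5, of \<phi>]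
  show ?thesis by (simp add: algebra_simps)
qed

lemma periodic_reflection_minus:
  assumes T: "T > 0"
  shows "periodic_reflection T \<phi> (- s) = - periodic_reflection T \<phi> s"
proof (cases rule: non_multiple_cases[OF T, of s])
  case (1 m)
  then show ?thesis
    using periodic_reflection_multiple[OF T, of \<phi> m] periodic_reflection_multiple[OF T, of \<phi> "- m"] by simp
next
  case (2 k)
  then have "- s \<in> {(4 * (- k) + 1) * T <..< (4 * (- k) + 2) * T}" by (simp add: algebra_simps)
  from periodic_reflection_cases(4)[OF T this, of \<phi>] periodic_reflection_cases(1)[OF T 2, of \<phi>]
  show ?thesis by (simp add: algebra_simps)
next
  case (3 k)
  then have "- s \<in> {4 * (- k) * T <..< (4 * (- k) + 1) * T}" by (simp add: algebra_simps)
  from periodic_reflection_cases(3)[OF T this, of \<phi>] periodic_reflection_cases(2)[OF T 3, of \<phi>]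
  show ?thesis by (simp add: algebra_simps)
next
  case (4 k)
  then have "- s \<in> {(4 * (- k) - 1) * T <..< 4 * (- k) * T}" by (simp add: algebra_simps)
  from periodic_reflection_cases(2)[OF T this, of \<phi>] periodic_reflection_cases(3)[OF T 4, of \<phi>]
  show ?thesis by (simp add: algebra_simps)
next
  case (5 k)
  then have "- s \<in> {(4 * (- k) - 2) * T <..< (4 * (- k) - 1) * T}" by (simp add: algebra_simps)
  from periodic_reflection_cases(1)[OF T this, of \<phi>] periodic_reflection_cases(4)[OF T 5, of \<phi>]
  show ?thesis by (simp add: algebra_simps)
qed

lemma periodic_reflection_base:
  "0 < s \<Longrightarrow> s < T \<Longrightarrow> periodic_reflection T \<phi> s = \<phi> s"
  using periodic_reflection_cases(3)[of T s 0 \<phi>] by simp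

section \<open>Trigonometric orthogonality and the coefficients of the modified transform\<close>

lemma integral_interval_FTC:
  fixes f F :: "real \<Rightarrow> real"
  assumes T: "0 < T" and F: "\<And>x. DERIV F x :> f x" and cont: "\<And>x. isCont f x"
  shows "integral\<^sup>L (lebesgue_on {0<..<T}) f = F T - F 0"
proof -
  have f: "f \<in> borel_measurable borel"
    using cont by (intro borel_measurable_continuous_onI continuous_at_imp_continuous_on) auto
  have "integral\<^sup>L (lebesgue_on {0<..<T}) f = (LINT s|lebesgue. indicator {0<..<T} s * f s)"
    by (subst integral_restrict_space) auto
  also have "\<dots> = (LINT s|lebesgue. f s * indicator {0..T} s)"
  proof (rule integral_cong_AE)
    show "AE s in lebesgue. indicator {0<..<T} s * f s = f s * indicator {0..T} s"
      by (rule AE_I'[where N="{0, T}"]) (auto simp: indicator_def simp flip: negligible_iff_null_sets)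
    have "(\<lambda>s. indicator {0<..<T} s * f s) \<in> borel_measurable borel" "(\<lambda>s. f s * indicator {0..T} s) \<in> borel_measurable borel"
      using f by measurable
    then show "(\<lambda>s. indicator {0<..<T} s * f s) \<in> borel_measurable lebesgue" "(\<lambda>s. f s * indicator {0..T} s) \<in> borel_measurable lebesgue"
      by (auto intro: borel_measurable_lebesgueI)
  qed
  also have "\<dots> = (LINT s|lborel. f s * indicator {0..T} s)"
  proof (rule integral_completion)
    have "(\<lambda>s. f s * indicator {0..T} s) \<in> borel_measurable borel" using f by measurable
    then show "(\<lambda>s. f s * indicator {0..T} s) \<in> borel_measurable lborel" by simp
  qed
  also have "\<dots> = F T - F 0"
    using T F cont by (intro integral_FTC_Icc_real) auto
  finally show ?thesis .
qed

lemma integral_cos_multiple: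
  fixes T :: real
  assumes T: "0 < T"
  shows "integral\<^sup>L (lebesgue_on {0<..<T}) (\<lambda>s. cos (of_int m * pi * (s / T))) = (if m = 0 then T else 0)"
proof (cases "m = 0")
  case True
  have "integral\<^sup>L (lebesgue_on {0<..<T}) (\<lambda>s. 1 :: real) = T - 0"
    by (rule integral_interval_FTC[OF T]) (auto intro!: derivative_eq_intros)
  then show ?thesis using True by simp
next
  case False
  have "integral\<^sup>L (lebesgue_on {0<..<T}) (\<lambda>s. cos (of_int m * pi * (s / T)))
     = T / (of_int m * pi) * sin (of_int m * pi * (T / T)) - T / (of_int m * pi) * sin (of_int m * pi * (0 / T))"
    by (rule integral_interval_FTC[OF T]) (use False T in \<open>auto intro!: derivative_eq_intros continuous_intros\<close>)
  also have "\<dots> = 0" using T by (simp add: sin_zero_iff_int2)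
  finally show ?thesis using False by simp
qed

lemma integrable_cos_multiple:
  fixes T :: real
  assumes T: "0 < T"
  shows "integrable (lebesgue_on {0<..<T}) (\<lambda>s. cos (c * (s / T)))"
  by (rule L2_integrable[OF T L2_bounded[OF T, of _ 1]]) auto

text \<open>The frequencies are half-odd multiples of \<open>pi\<close>. The sum of two of them is a
  positive integer multiple of \<open>pi\<close>, so its cosine always integrates to 0; the
  difference contributes only if \<open>j = k\<close>.\<close>

lemma L2_orthogonal_trig:
  fixes T :: real
  assumes T: "0 < T"
  shows "L2_orthogonal T (\<lambda>k s. sin ((pi / 2 + real k * pi) * (s / T)))"
    and "L2_orthogonal T (\<lambda>k s. cos ((pi / 2 + real k * pi) * (s / T)))"
proof -
  let ?I = "integral\<^sup>L (lebesgue_on {0<..<T})"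
  have minus: "(pi / 2 + real j * pi) * (s / T) - (pi / 2 + real k * pi) * (s / T) = of_int (int j - int k) * pi * (s / T)"
    and plus: "(pi / 2 + real j * pi) * (s / T) + (pi / 2 + real k * pi) * (s / T) = of_int (int j + int k + 1) * pi * (s / T)" for j k s
    by (simp_all add: algebra_simps flip: distrib_right left_diff_distrib)
  have int: "integrable (lebesgue_on {0<..<T}) (\<lambda>s. cos (of_int m * pi * (s / T)))" for m :: int
    by (rule integrable_cos_multiple[OF T])
  have I1: "?I (\<lambda>s. cos (of_int (int j - int k) * pi * (s / T))) = (if j = k then T else 0)" for j k
    unfolding integral_cos_multiple[OF T] by simp
  have I2: "?I (\<lambda>s. cos (of_int (int j + int k + 1) * pi * (s / T))) = 0" for j k
    unfolding integral_cos_multiple[OF T] by simp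
  show "L2_orthogonal T (\<lambda>k s. sin ((pi / 2 + real k * pi) * (s / T)))"
  proof
    show "L2 T (\<lambda>s. sin ((pi / 2 + real k * pi) * (s / T)))" for k
      by (rule L2_bounded[OF T, of _ 1]) auto
    show "?I (\<lambda>s. sin ((pi / 2 + real j * pi) * (s / T)) * sin ((pi / 2 + real k * pi) * (s / T))) = (if j = k then T / 2 else 0)" for j k
      unfolding sin_times_sin minus plus
      using Bochner_Integration.integral_diff[OF int[of "int j - int k"] int[of "int j + int k + 1"]]
      unfolding I1 I2 by simp
  qed (rule T)
  show "L2_orthogonal T (\<lambda>k s. cos ((pi / 2 + real k * pi) * (s / T)))"
  proof
    show "L2 T (\<lambda>s. cos ((pi / 2 + real k * pi) * (s / T)))" for k
      by (rule L2_bounded[OF T, of _ 1]) auto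
    show "?I (\<lambda>s. cos ((pi / 2 + real j * pi) * (s / T)) * cos ((pi / 2 + real k * pi) * (s / T))) = (if j = k then T / 2 else 0)" for j k
      unfolding cos_times_cos minus plus
      using Bochner_Integration.integral_add[OF int[of "int j - int k"] int[of "int j + int k + 1"]]
      unfolding I1 I2 by simp
  qed (rule T)
qed

text \<open>Shows that the choice in \<open>modified_hilbert\<close> is not vacuous: Bessel's
  inequality for the sines makes the coefficients square summable, and Riesz-Fischer for the cosines
  supplies a limit.\<close>

lemma modified_hilbert_converges:
  assumes T: "0 < T" and \<phi>: "L2 T \<phi>"
  shows "L2_converges T (\<lambda>n t. \<Sum>k<n. sine_coeff T \<phi> k * cos ((pi / 2 + real k * pi) * (t / T))) (modified_hilbert T \<phi>)"
proof -
  interpret S: L2_orthogonal T "\<lambda>k s. sin ((pi / 2 + real k * pi) * (s / T))" by (rule L2_orthogonal_trig(1)[OF T])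
  interpret C: L2_orthogonal T "\<lambda>k s. cos ((pi / 2 + real k * pi) * (s / T))" by (rule L2_orthogonal_trig(2)[OF T])
  have "summable (\<lambda>k. (sine_coeff T \<phi> k)\<^sup>2)"
    using S.Bessel_summable[OF \<phi>] by (simp add: sine_coeff_def)
  from C.Riesz_Fischer[OF this] show ?thesis
    unfolding modified_hilbert_def by (rule someI_ex)
qed

lemma cosine_coeff_modified_hilbert:
  assumes T: "0 < T" and \<phi>: "L2 T \<phi>"
  shows "integral\<^sup>L (lebesgue_on {0<..<T}) (\<lambda>s. modified_hilbert T \<phi> s * cos ((pi / 2 + real j * pi) * (s / T)))
    = sine_coeff T \<phi> j * (T / 2)"
proof -
  interpret C: L2_orthogonal T "\<lambda>k s. cos ((pi / 2 + real k * pi) * (s / T))" by (rule L2_orthogonal_trig(2)[OF T])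
  have "(\<lambda>n. integral\<^sup>L (lebesgue_on {0<..<T}) (\<lambda>s. (\<Sum>k<n. sine_coeff T \<phi> k * cos ((pi / 2 + real k * pi) * (s / T))) * cos ((pi / 2 + real j * pi) * (s / T))))
    \<longlonglongrightarrow> integral\<^sup>L (lebesgue_on {0<..<T}) (\<lambda>s. modified_hilbert T \<phi> s * cos ((pi / 2 + real j * pi) * (s / T)))"
    by (rule L2_converges_inner[OF modified_hilbert_converges[OF T \<phi>] C.L2_e])
  then have lim: "(\<lambda>n. if j \<in> {..<n} then sine_coeff T \<phi> j * (T / 2) else 0)
    \<longlonglongrightarrow> integral\<^sup>L (lebesgue_on {0<..<T}) (\<lambda>s. modified_hilbert T \<phi> s * cos ((pi / 2 + real j * pi) * (s / T)))"
    unfolding C.integral_partial_sum_mult[OF finite_lessThan] .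
  have "(\<lambda>n. if j \<in> {..<n} then sine_coeff T \<phi> j * (T / 2) else 0) \<longlonglongrightarrow> sine_coeff T \<phi> j * (T / 2)"
    by (rule tendsto_eventually[OF eventually_mono[OF eventually_gt_at_top[of j]]]) simp
  from LIMSEQ_unique[OF lim this] show ?thesis .
qed

text \<open>The odd extension of \<open>h\<close> for \<open>c = -1\<close> and the even one for
  \<open>c = 1\<close>, with value 0 at the origin and outside the open interval from
  \<open>-T\<close> to \<open>T\<close>.\<close>

definition reflect_ext :: "real \<Rightarrow> real \<Rightarrow> (real \<Rightarrow> real) \<Rightarrow> real \<Rightarrow> real" where
  "reflect_ext T c h s = indicator {0<..<T} s * h s + c * (indicator {0<..<T} (- s) * h (- s))"

lemma reflect_ext_outside: "T > 0 \<Longrightarrow> s \<notin> {-T..<T} \<Longrightarrow> reflect_ext T c h s = 0"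
  by (auto simp: reflect_ext_def indicator_def)

lemma reflect_ext_inside: "0 < s \<Longrightarrow> s < T \<Longrightarrow> reflect_ext T c h s = h s"
  by (auto simp: reflect_ext_def indicator_def)

lemma integrable_reflect_ext:
  assumes "integrable (lebesgue_on {0<..<T}) h"
  shows "integrable lebesgue (reflect_ext T c h)"
proof -
  have h: "integrable lebesgue (\<lambda>s. indicator {0<..<T} s * h s)"
    using assms by (subst (asm) integrable_restrict_space) auto
  then have "integrable lebesgue (\<lambda>s. indicator {0<..<T} (- s) * h (- s))"
    using lebesgue_integrable_real_affine[OF h, of "-1" 0] by simp
  then show ?thesis unfolding reflect_ext_def using h by (intro Bochner_Integration.integrable_add integrable_mult_right)
qed

lemma integral_reflect_ext:
  assumes h: "integrable (lebesgue_on {0<..<T}) h" and K: "K \<in> borel_measurable borel" "\<And>s. \<bar>K s\<bar> \<le> C"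
  shows "(LINT s|lebesgue. reflect_ext T c h s * K s) = integral\<^sup>L (lebesgue_on {0<..<T}) (\<lambda>s. h s * (K s + c * K (- s)))"
proof -
  have h0: "integrable lebesgue (\<lambda>s. indicator {0<..<T} s * h s)"
    using h by (subst (asm) integrable_restrict_space) auto
  have hm: "integrable lebesgue (\<lambda>s. indicator {0<..<T} (- s) * h (- s))"
    using lebesgue_integrable_real_affine[OF h0, of "-1" 0] by simp
  have K': "(\<lambda>s. K (- s)) \<in> borel_measurable borel" using K(1) by measurable
  have i1: "integrable lebesgue (\<lambda>s. indicator {0<..<T} s * h s * K s)"
    by (rule integrable_mult_bounded[OF h0 K(1)]) (rule K(2))
  have i2: "integrable lebesgue (\<lambda>s. indicator {0<..<T} (- s) * h (- s) * K s)"
    by (rule integrable_mult_bounded[OF hm K(1)]) (rule K(2))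
  have i3: "integrable lebesgue (\<lambda>s. indicator {0<..<T} s * h s * K (- s))"
    by (rule integrable_mult_bounded[OF h0 K']) (rule K(2))
  have "(LINT s|lebesgue. reflect_ext T c h s * K s)
      = (LINT s|lebesgue. indicator {0<..<T} s * h s * K s + c * (indicator {0<..<T} (- s) * h (- s) * K s))"
    by (simp add: reflect_ext_def distrib_right mult.assoc)
  also have "\<dots> = (LINT s|lebesgue. indicator {0<..<T} s * h s * K s) + c * (LINT s|lebesgue. indicator {0<..<T} (- s) * h (- s) * K s)"
    using i1 i2 by simp
  also have "(LINT s|lebesgue. indicator {0<..<T} (- s) * h (- s) * K s) = (LINT s|lebesgue. indicator {0<..<T} s * h s * K (- s))"
    using lebesgue_integral_real_affine[of "-1" "\<lambda>s. indicator {0<..<T} (- s) * h (- s) * K s" 0] by simp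
  also have "(LINT s|lebesgue. indicator {0<..<T} s * h s * K s) + c * (LINT s|lebesgue. indicator {0<..<T} s * h s * K (- s))
      = (LINT s|lebesgue. indicator {0<..<T} s * (h s * (K s + c * K (- s))))"
    using i1 i3 by (simp add: distrib_left mult_ac)
  also have "\<dots> = integral\<^sup>L (lebesgue_on {0<..<T}) (\<lambda>s. h s * (K s + c * K (- s)))"
    by (subst integral_restrict_space) auto
  finally show ?thesis .
qed

text \<open>In its applications the majorant \<open>B\<close> is the geometric series of odd powers
  of the radius. It converges because the radius is below 1, which is the reason for working with
  Abel means.\<close>

lemma sums_integral_kernel:
  fixes g :: "real \<Rightarrow> real" and b :: "nat \<Rightarrow> real \<Rightarrow> real"
  assumes g: "integrable lebesgue g" and b: "\<And>k. b k \<in> borel_measurable borel" "\<And>k s. \<bar>b k s\<bar> \<le> B k"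
    and B: "summable B" and K: "\<And>s. (\<lambda>k. b k s) sums K s"
  shows "(\<lambda>k. LINT s|lebesgue. g s * b k s) sums (LINT s|lebesgue. g s * K s)"
proof -
  have int: "integrable lebesgue (\<lambda>s. g s * b k s)" for k
    by (rule integrable_mult_bounded[OF g b(1) b(2)])
  have B0: "0 \<le> B k" for k using b(2)[of k 0] by linarith
  have bd: "norm (g s * b k s) \<le> \<bar>g s\<bar> * B k" for k s
    using b(2) by (simp add: abs_mult mult_left_mono)
  have "(\<lambda>k. LINT s|lebesgue. g s * b k s) sums (LINT s|lebesgue. (\<Sum>k. g s * b k s))"
  proof (rule sums_integral[OF int])
    show "AE s in lebesgue. summable (\<lambda>k. norm (g s * b k s))"
      by (intro AE_I2 summable_comparison_test'[OF summable_mult[OF B]]) (use bd in simp)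
    show "summable (\<lambda>k. LINT s|lebesgue. norm (g s * b k s))"
    proof (rule summable_comparison_test'[OF summable_mult[OF B, of "LINT s|lebesgue. \<bar>g s\<bar>"]])
      fix k
      have "(LINT s|lebesgue. norm (g s * b k s)) \<le> (LINT s|lebesgue. \<bar>g s\<bar> * B k)"
        using int g bd by (intro integral_mono) auto
      then show "norm (LINT s|lebesgue. norm (g s * b k s)) \<le> (LINT s|lebesgue. \<bar>g s\<bar>) * B k" by simp
    qed
  qed
  moreover have "(\<Sum>k. g s * b k s) = g s * K s" for s
    using sums_mult[OF K, of "g s"] by (rule sums_unique[symmetric])
  ultimately show ?thesis by simp
qed

text \<open>After folding, the odd extension meets
  \<open>sin (a - b) - sin (a + b) = - 2 * cos a * sin b\<close> and the even one
  \<open>cos (a - b) + cos (a + b) = 2 * cos a * cos b\<close>, where \<open>a\<close> belongs to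
  \<open>t\<close> and \<open>b\<close> to \<open>s\<close>. Both leave \<open>cos a\<close> times
  the same coefficient. The minus sign of the final identity originates here.\<close>

lemma conjugate_integrals:
  assumes T: "0 < T" and \<phi>: "L2 T \<phi>" and w: "w > 0"
  shows "(LINT s|lebesgue. reflect_ext T (- 1) \<phi> s * conj_poisson w (pi * ((t - s) / (2 * T)))) =
    - (LINT s|lebesgue. reflect_ext T 1 (modified_hilbert T \<phi>) s * poisson w (pi * ((t - s) / (2 * T))))"
proof -
  define S where "S = modified_hilbert T \<phi>"
  define \<rho> where "\<rho> = radius w"
  have \<rho>: "0 < \<rho>" "\<rho> < 1" using radius_bounds[OF w] by (auto simp: \<rho>_def)
  have S: "L2 T S" using modified_hilbert_converges[OF T \<phi>] by (simp add: S_def L2_converges_def)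
  note i\<phi> = L2_integrable[OF T \<phi>] and iS = L2_integrable[OF T S]
  have angle: "(2 * real k + 1) * (pi * ((t - s) / (2 * T))) = (pi / 2 + real k * pi) * (t / T) - (pi / 2 + real k * pi) * (s / T)" for k s
    using T by (simp add: field_simps)
  have angle': "(2 * real k + 1) * (pi * ((t - - s) / (2 * T))) = (pi / 2 + real k * pi) * (t / T) + (pi / 2 + real k * pi) * (s / T)" for k s
    using T by (simp add: field_simps)
  have trig: "y * (r * sin (a - b) + - 1 * (r * sin (a + b))) = - 2 * r * cos a * (y * sin b)"
    "y * (r * cos (a - b) + 1 * (r * cos (a + b))) = 2 * r * cos a * (y * cos b)" for y r a b :: real
    by (simp_all add: sin_diff sin_add cos_diff cos_add algebra_simps)
  have summ: "summable (\<lambda>k. \<rho> ^ (2 * k + 1))"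
  proof -
    have "summable (\<lambda>k. \<rho> * (\<rho>\<^sup>2) ^ k)"
      using \<rho> by (intro summable_mult summable_geometric) (simp add: power_less_one_iff)
    then show ?thesis by (simp add: power_mult)
  qed
  have bd: "\<bar>\<rho> ^ (2 * k + 1) * x\<bar> \<le> \<rho> ^ (2 * k + 1)" if "\<bar>x\<bar> \<le> 1" for x k
    using \<rho> that by (simp add: abs_mult mult_left_le del: power_Suc)
  have odd: "(LINT s|lebesgue. reflect_ext T (- 1) \<phi> s * (\<rho> ^ (2 * k + 1) * sin ((2 * real k + 1) * (pi * ((t - s) / (2 * T))))))
      = - (\<rho> ^ (2 * k + 1) * cos ((pi / 2 + real k * pi) * (t / T)) * (T * sine_coeff T \<phi> k))" for k
  proof -
    have "(LINT s|lebesgue. reflect_ext T (- 1) \<phi> s * (\<rho> ^ (2 * k + 1) * sin ((2 * real k + 1) * (pi * ((t - s) / (2 * T))))))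
      = integral\<^sup>L (lebesgue_on {0<..<T}) (\<lambda>s. \<phi> s * (\<rho> ^ (2 * k + 1) * sin ((2 * real k + 1) * (pi * ((t - s) / (2 * T)))) +
          - 1 * (\<rho> ^ (2 * k + 1) * sin ((2 * real k + 1) * (pi * ((t - - s) / (2 * T)))))))"
      by (rule integral_reflect_ext[OF i\<phi>, of _ "\<rho> ^ (2 * k + 1)"]) (measurable, rule bd, simp)
    also have "\<dots> = integral\<^sup>L (lebesgue_on {0<..<T}) (\<lambda>s. - 2 * \<rho> ^ (2 * k + 1) * cos ((pi / 2 + real k * pi) * (t / T)) * (\<phi> s * sin ((pi / 2 + real k * pi) * (s / T))))"
      unfolding angle' unfolding angle unfolding trig ..
    also have "\<dots> = - 2 * \<rho> ^ (2 * k + 1) * cos ((pi / 2 + real k * pi) * (t / T)) * integral\<^sup>L (lebesgue_on {0<..<T}) (\<lambda>s. \<phi> s * sin ((pi / 2 + real k * pi) * (s / T)))"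
      by (rule integral_mult_right_zero)
    also have "integral\<^sup>L (lebesgue_on {0<..<T}) (\<lambda>s. \<phi> s * sin ((pi / 2 + real k * pi) * (s / T))) = T / 2 * sine_coeff T \<phi> k"
      using T by (simp add: sine_coeff_def)
    finally show ?thesis by simp
  qed
  have even: "(LINT s|lebesgue. reflect_ext T 1 S s * (\<rho> ^ (2 * k + 1) * cos ((2 * real k + 1) * (pi * ((t - s) / (2 * T))))))
      = \<rho> ^ (2 * k + 1) * cos ((pi / 2 + real k * pi) * (t / T)) * (T * sine_coeff T \<phi> k)" for k
  proof -
    have "(LINT s|lebesgue. reflect_ext T 1 S s * (\<rho> ^ (2 * k + 1) * cos ((2 * real k + 1) * (pi * ((t - s) / (2 * T))))))
      = integral\<^sup>L (lebesgue_on {0<..<T}) (\<lambda>s. S s * (\<rho> ^ (2 * k + 1) * cos ((2 * real k + 1) * (pi * ((t - s) / (2 * T)))) +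
          1 * (\<rho> ^ (2 * k + 1) * cos ((2 * real k + 1) * (pi * ((t - - s) / (2 * T)))))))"
      by (rule integral_reflect_ext[OF iS, of _ "\<rho> ^ (2 * k + 1)"]) (measurable, rule bd, simp)
    also have "\<dots> = integral\<^sup>L (lebesgue_on {0<..<T}) (\<lambda>s. 2 * \<rho> ^ (2 * k + 1) * cos ((pi / 2 + real k * pi) * (t / T)) * (S s * cos ((pi / 2 + real k * pi) * (s / T))))"
      unfolding angle' unfolding angle unfolding trig ..
    also have "\<dots> = 2 * \<rho> ^ (2 * k + 1) * cos ((pi / 2 + real k * pi) * (t / T)) * integral\<^sup>L (lebesgue_on {0<..<T}) (\<lambda>s. S s * cos ((pi / 2 + real k * pi) * (s / T)))"
      by (rule integral_mult_right_zero)
    also have "integral\<^sup>L (lebesgue_on {0<..<T}) (\<lambda>s. S s * cos ((pi / 2 + real k * pi) * (s / T))) = sine_coeff T \<phi> k * (T / 2)"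
      unfolding S_def by (rule cosine_coeff_modified_hilbert[OF T \<phi>])
    finally show ?thesis by simp
  qed
  have 1: "(\<lambda>k. LINT s|lebesgue. reflect_ext T (- 1) \<phi> s * (\<rho> ^ (2 * k + 1) * sin ((2 * real k + 1) * (pi * ((t - s) / (2 * T))))))
    sums (LINT s|lebesgue. reflect_ext T (- 1) \<phi> s * conj_poisson w (pi * ((t - s) / (2 * T))))"
    by (rule sums_integral_kernel[OF integrable_reflect_ext[OF i\<phi>] _ _ summ])
       (measurable, rule bd, simp, unfold \<rho>_def, rule poisson_series(2)[OF w])
  have 2: "(\<lambda>k. LINT s|lebesgue. reflect_ext T 1 S s * (\<rho> ^ (2 * k + 1) * cos ((2 * real k + 1) * (pi * ((t - s) / (2 * T))))))
    sums (LINT s|lebesgue. reflect_ext T 1 S s * poisson w (pi * ((t - s) / (2 * T))))"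
    by (rule sums_integral_kernel[OF integrable_reflect_ext[OF iS] _ _ summ])
       (measurable, rule bd, simp, unfold \<rho>_def, rule poisson_series(1)[OF w])
  from sums_minus[OF 2] 1 show ?thesis
    unfolding odd even S_def[symmetric] by (rule sums_unique2[rotated])
qed

text \<open>The half-open interval contains \<open>-T\<close> and \<open>0\<close>: there the
  extension vanishes by its open indicators, the reflection by its default value.\<close>

lemma reflect_ext_periodic_reflection:
  assumes T: "0 < T"
  shows "indicator {-T..<T} s * periodic_reflection T \<phi> s = reflect_ext T (- 1) \<phi> s"
proof -
  consider "s \<notin> {-T..<T}" | "s = - T" | "-T < s" "s < 0" | "s = 0" | "0 < s" "s < T" by fastforce
  then show ?thesis
  proof cases
    case 1 then show ?thesis using reflect_ext_outside[OF T 1] by simp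
  next
    case 2 then show ?thesis using periodic_reflection_multiple[OF T, of \<phi> "-1"] T by (simp add: reflect_ext_def)
  next
    case 3 then show ?thesis
      using periodic_reflection_minus[OF T, of \<phi> "- s"] periodic_reflection_base[of "- s" T \<phi>] by (simp add: reflect_ext_def)
  next
    case 4 then show ?thesis using periodic_reflection_multiple[OF T, of \<phi> 0] by (simp add: reflect_ext_def)
  next
    case 5 then show ?thesis using periodic_reflection_base[of s T \<phi>] T by (simp add: reflect_ext_inside)
  qed
qed

theorem theorem2:
  fixes T :: real and \<phi> :: "real \<Rightarrow> real"
  assumes "T > 0" and "L2 T \<phi>"
  shows "AE t in lebesgue_on {0<..<T}.
           hilbert_exists (periodic_reflection T \<phi>) t \<and>
           modified_hilbert T \<phi> t = - hilbert (periodic_reflection T \<phi>) t"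
proof -
  note T = assms(1) and \<phi> = assms(2)
  define S where "S = modified_hilbert T \<phi>"
  define u where "u = reflect_ext T (- 1) \<phi>"
  define v where "v = reflect_ext T 1 S"
  have S: "L2 T S" using modified_hilbert_converges[OF T \<phi>] by (simp add: S_def L2_converges_def)
  have iu: "integrable lebesgue u" and iv: "integrable lebesgue v"
    unfolding u_def v_def by (intro integrable_reflect_ext L2_integrable T \<phi> S)+
  have u0: "u s = 0" and v0: "v s = 0" if "s \<notin> {-T..<T}" for s
    using reflect_ext_outside[OF T that] by (simp_all add: u_def v_def)
  have uP: "indicator {-T..<T} s * periodic_reflection T \<phi> s = u s" for s
    unfolding u_def by (rule reflect_ext_periodic_reflection[OF T])
  interpret antiperiodic "periodic_reflection T \<phi>" T
    by standard (use T iu in \<open>simp_all add: periodic_reflection_shift uP\<close>)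
  have main: "hilbert_exists (periodic_reflection T \<phi>) t \<and> S t = - hilbert (periodic_reflection T \<phi>) t"
    if t: "0 < t" "t < T"
      and lu: "((\<lambda>h. (LINT s:{t-h..t+h}|lebesgue. \<bar>u s - u t\<bar>) / h) \<longlongrightarrow> 0) (at_right 0)"
      and lv: "((\<lambda>h. (LINT s:{t-h..t+h}|lebesgue. \<bar>v s - v t\<bar>) / h) \<longlongrightarrow> 0) (at_right 0)" for t
  proof -
    define Q where "Q w = (LINT s|lebesgue. u s * conj_poisson w (pi * ((t - s) / (2 * T))))" for w
    define C where "C w = (LINT s|lebesgue. u s * (if w < \<bar>t - s\<bar> then 1 / (2 * sin (pi * ((t - s) / (2 * T)))) else 0))" for w
    have "((\<lambda>w. - (LINT s|lebesgue. v s * poisson w (pi * ((t - s) / (2 * T))))) \<longlongrightarrow> - (v t * T)) (at_right 0)"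
      by (intro tendsto_minus poisson_integral_tendsto t iv v0 lv)
    moreover have "\<forall>\<^sub>F w in at_right 0. - (LINT s|lebesgue. v s * poisson w (pi * ((t - s) / (2 * T)))) = Q w"
      using eventually_at_right_less[of "0::real"]
      by (rule eventually_mono) (simp only: Q_def u_def v_def S_def conjugate_integrals[OF T \<phi>])
    ultimately have Q: "(Q \<longlongrightarrow> - (v t * T)) (at_right 0)" by (rule Lim_transform_eventually)
    \<comment> \<open>Here the Abel parameter becomes the truncation radius: smoothed and truncated
      integrals have the same limit, which gives existence of the latter.\<close>
    have "((\<lambda>w. Q w - C w) \<longlongrightarrow> 0) (at_right 0)"
      unfolding Q_def C_def by (intro conj_poisson_integral_tendsto t iu u0 lu)
    from tendsto_diff[OF Q this] have "(C \<longlongrightarrow> - (v t * T)) (at_right 0)" by simp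
    \<comment> \<open>The factor \<open>1 / T\<close> cancels the mass \<open>T\<close> of the
      Poisson kernel and turns \<open>1 / (2 * sin x)\<close> into the kernel
      \<open>1 / (2 * T * sin x)\<close> of \<open>hilbert_limit\<close>.\<close>
    then have "((\<lambda>w. 1 / T * C w) \<longlongrightarrow> 1 / T * - (v t * T)) (at_right 0)" by (intro tendsto_intros)
    moreover have "1 / T * - (v t * T) = - S t"
      using T t by (simp add: v_def reflect_ext_inside)
    moreover have "1 / T * C w = (LINT s|lebesgue. indicator {-T..<T} s *
      (periodic_reflection T \<phi> s * (if w < \<bar>t - s\<bar> then 1 / (2 * T * sin (pi * ((t - s) / (2 * T)))) else 0)))" for w
      unfolding C_def integral_mult_right_zero[symmetric] uP[symmetric]
      by (intro Bochner_Integration.integral_cong refl) simp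
    ultimately have lim: "((\<lambda>w. LINT s|lebesgue. indicator {-T..<T} s *
      (periodic_reflection T \<phi> s * (if w < \<bar>t - s\<bar> then 1 / (2 * T * sin (pi * ((t - s) / (2 * T)))) else 0))) \<longlongrightarrow> - S t) (at_right 0)"
      by simp
    show ?thesis using hilbert_limit[OF t lim] by simp
  qed
  have "AE t in lebesgue. t \<in> {0<..<T} \<longrightarrow>
     hilbert_exists (periodic_reflection T \<phi>) t \<and> S t = - hilbert (periodic_reflection T \<phi>) t"
    using lebesgue_points[OF iu] lebesgue_points[OF iv] by eventually_elim (use main in auto)
  then show ?thesis unfolding S_def by (subst AE_restrict_space_iff) auto
qed

end
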